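(* The following problem is in $\mathsf{DepParaTC}^0$ parametrized by $\mathrm{depth}(\Pi)$. Input: a power circuit $(\Pi,\delta_\Pi)$ together with a marking $M$ on $\Pi$. Output: a reduced power circuit $(\Gamma,\delta)$ together with a compact marking $\widetilde M$ on $\Gamma$ such that $\varepsilon(\widetilde M)=\varepsilon(M)$.
   Context: Power circuits. Let $\Gamma$ be a finite set and $\delta\colon\Gamma\times\Gamma\to\{-1,0,1\}$ such that the directed graph on $\Gamma$ with edge set $\{(P,Q):\delta(P,Q)\neq 0\}$ is acyclic (a dag). A marking on $\Gamma$ is a map $M\colon\Gamma\to\{-1,0,1\}$ with support $\sigma(M)=\{P:M(P)\neq0\}$. The successor marking of $P\in\Gamma$ is $\Lambda_P\colon Q\mapsto\delta(P,Q)$. The evaluation is defined bottom-up in the dag by $\varepsilon(P)=2^{\varepsilon(\Lambda_P)}$ for nodes and $\varepsilon(M)=\sum_{P}M(P)\varepsilon(P)$ for markings (the empty sum is $0$). $(\Gamma,\delta)$ is a power circuit if every node evaluates to an element of $\{2^n:n\in\mathbb{N}\}$. $\mathrm{depth}(\Gamma)$ is the number of edges of a longest path in the dag. A marking $M$ is compact if $|\varepsilon(\Lambda_P)-\varepsilon(\Lambda_Q)|\geq2$ for all $P\neq Q$ in $\sigma(M)$. A reduced power circuit is a power circuit whose node set is given as a sorted list $\Gamma=(P_0,\ldots,P_{n-1})$ such that all successor markings are compact and $\varepsilon(P_i)<\varepsilon(P_j)$ whenever $i<j$. Encoding: a power circuit with $n$ nodes is given by the $n\times n$ matrix of $\delta$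 (in sorted order if reduced), a marking by a sequence of $n$ symbols from $\{-1,0,1\}$, two bits per symbol. $\mathsf{DepParaTC}^k$ with respect to a parameter $\mathrm{par}\colon\{0,1\}^*\to\mathbb{N}$: the class of problems for which there is a family of (non-uniform) circuits $(C_{n,D})_{n,D\in\mathbb{N}}$ with unbounded fan-in And, Or, Not, Majority gates such that $C_{n,D}$ has at most $n^{O(1)}$ gates (independently of $D$) and depth $O(D\cdot\log^kn)$, and for all $n,D$ and all inputs $x\in\{0,1\}^n$ with $\mathrm{par}(x)\leq D$ the circuit $C_{n,D}$ produces a correct answer (output) on $x$. *)

theory Defs
  imports Complex_Main
begin

section \<open>Power circuits\<close>

text \<open>Nodes are drawn from a type, with \<open>\<Gamma>\<close> the actual node set; the values of \<open>\<delta>\<close> and of a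
  marking outside \<open>\<Gamma>\<close> are irrelevant. The successor marking of \<open>P\<close> is \<open>\<delta> P\<close>.\<close>

definition edges :: "'a set \<Rightarrow> ('a \<Rightarrow> 'a \<Rightarrow> int) \<Rightarrow> ('a \<times> 'a) set" where
  "edges \<Gamma> \<delta> = {(P, Q). P \<in> \<Gamma> \<and> Q \<in> \<Gamma> \<and> \<delta> P Q \<noteq> 0}"

definition marking :: "'a set \<Rightarrow> ('a \<Rightarrow> int) \<Rightarrow> bool" where
  "marking \<Gamma> M \<longleftrightarrow> (\<forall>P\<in>\<Gamma>. M P \<in> {-1, 0, 1})"

definition support :: "'a set \<Rightarrow> ('a \<Rightarrow> int) \<Rightarrow> 'a set" where
  "support \<Gamma> M = {P \<in> \<Gamma>. M P \<noteq> 0}"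

definition signed_dag :: "'a set \<Rightarrow> ('a \<Rightarrow> 'a \<Rightarrow> int) \<Rightarrow> bool" where
  "signed_dag \<Gamma> \<delta> \<longleftrightarrow> finite \<Gamma> \<and> (\<forall>P\<in>\<Gamma>. marking \<Gamma> (\<delta> P)) \<and> acyclic (edges \<Gamma> \<delta>)"

text \<open>Well-founded recursion along the dag; lemma \<open>eval_node_eq\<close> below is the intended equation.
  Evaluations are real numbers, since a successor marking may a priori evaluate to a
  negative or fractional number.\<close>

definition eval_node :: "'a set \<Rightarrow> ('a \<Rightarrow> 'a \<Rightarrow> int) \<Rightarrow> 'a \<Rightarrow> real" where
  "eval_node \<Gamma> \<delta> =
     wfrec ((edges \<Gamma> \<delta>)\<inverse>) (\<lambda>\<epsilon> P. 2 powr (\<Sum>Q\<in>\<Gamma>. of_int (\<delta> P Q) * \<epsilon> Q))"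

definition eval_marking :: "'a set \<Rightarrow> ('a \<Rightarrow> 'a \<Rightarrow> int) \<Rightarrow> ('a \<Rightarrow> int) \<Rightarrow> real" where
  "eval_marking \<Gamma> \<delta> M = (\<Sum>P\<in>\<Gamma>. of_int (M P) * eval_node \<Gamma> \<delta> P)"

lemma finite_edges: "finite \<Gamma> \<Longrightarrow> finite (edges \<Gamma> \<delta>)"
  by (rule finite_subset[of _ "\<Gamma> \<times> \<Gamma>"]) (auto simp: edges_def)

lemma eval_node_eq:
  assumes "signed_dag \<Gamma> \<delta>" "P \<in> \<Gamma>"
  shows "eval_node \<Gamma> \<delta> P = 2 powr eval_marking \<Gamma> \<delta> (\<delta> P)"
proof -
  have "wf ((edges \<Gamma> \<delta>)\<inverse>)"
    using assms(1) by (simp add: signed_dag_def finite_acyclic_wf_converse finite_edges)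
  then have "eval_node \<Gamma> \<delta> P =
      2 powr (\<Sum>Q\<in>\<Gamma>. of_int (\<delta> P Q) * cut (eval_node \<Gamma> \<delta>) ((edges \<Gamma> \<delta>)\<inverse>) P Q)"
    unfolding eval_node_def by (subst wfrec) auto
  also have "(\<Sum>Q\<in>\<Gamma>. of_int (\<delta> P Q) * cut (eval_node \<Gamma> \<delta>) ((edges \<Gamma> \<delta>)\<inverse>) P Q) =
      eval_marking \<Gamma> \<delta> (\<delta> P)"
    unfolding eval_marking_def
    using assms(2) by (intro sum.cong) (auto simp: cut_def edges_def)
  finally show ?thesis .
qed

definition power_circuit :: "'a set \<Rightarrow> ('a \<Rightarrow> 'a \<Rightarrow> int) \<Rightarrow> bool" where
  "power_circuit \<Gamma> \<delta> \<longleftrightarrow>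
     signed_dag \<Gamma> \<delta> \<and> (\<forall>P\<in>\<Gamma>. \<exists>n::nat. eval_node \<Gamma> \<delta> P = 2 ^ n)"

text \<open>As \<open>R ^^ 0\<close> is the full identity relation, the empty circuit has depth 0.\<close>

definition depth :: "'a set \<Rightarrow> ('a \<Rightarrow> 'a \<Rightarrow> int) \<Rightarrow> nat" where
  "depth \<Gamma> \<delta> = Max {m. \<exists>P Q. (P, Q) \<in> edges \<Gamma> \<delta> ^^ m}"

lemma finite_path_lengths:
  assumes "signed_dag \<Gamma> \<delta>"
  shows "finite {m. \<exists>P Q. (P, Q) \<in> edges \<Gamma> \<delta> ^^ m}"
proof -
  let ?E = "edges \<Gamma> \<delta>"
  have fin: "finite \<Gamma>" and ac: "acyclic ?E"
    using assms by (auto simp: signed_dag_def)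
  have "m \<le> card \<Gamma>" if "(P, Q) \<in> ?E ^^ m" for m P Q
  proof (rule ccontr)
    assume "\<not> m \<le> card \<Gamma>"
    from that obtain f where f: "\<And>i. i < m \<Longrightarrow> (f i, f (Suc i)) \<in> ?E"
      unfolding relpow_fun_conv by blast
    have path: "i < m \<Longrightarrow> j \<le> m \<Longrightarrow> i < j \<Longrightarrow> (f i, f j) \<in> ?E\<^sup>+" for i j
    proof (induction j)
      case (Suc j)
      show ?case
      proof (cases "i = j")
        case True
        then show ?thesis using Suc.prems f by auto
      next
        case False
        then have "(f i, f j) \<in> ?E\<^sup>+" using Suc by auto
        then show ?thesis using f[of j] Suc.prems by (auto intro: trancl_into_trancl)
      qed
    qed simp
    have "inj_on f {..<m}"
    proof (rule linorder_inj_onI)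
      fix i j assume "i < j" "i \<in> {..<m}" "j \<in> {..<m}"
      then have "(f i, f j) \<in> ?E\<^sup>+" using path by auto
      then show "f i \<noteq> f j" using ac by (auto simp: acyclic_def)
    qed auto
    moreover have "f ` {..<m} \<subseteq> \<Gamma>"
      using f by (auto simp: edges_def)
    ultimately have "m \<le> card \<Gamma>"
      using card_inj_on_le[of f "{..<m}" \<Gamma>] fin by simp
    with \<open>\<not> m \<le> card \<Gamma>\<close> show False by simp
  qed
  then have "{m. \<exists>P Q. (P, Q) \<in> ?E ^^ m} \<subseteq> {..card \<Gamma>}" by auto
  then show ?thesis by (rule finite_subset) simp
qed

definition compact_marking :: "'a set \<Rightarrow> ('a \<Rightarrow> 'a \<Rightarrow> int) \<Rightarrow> ('a \<Rightarrow> int) \<Rightarrow> bool" where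
  "compact_marking \<Gamma> \<delta> M \<longleftrightarrow> marking \<Gamma> M \<and>
     (\<forall>P\<in>support \<Gamma> M. \<forall>Q\<in>support \<Gamma> M. P \<noteq> Q \<longrightarrow>
        \<bar>eval_marking \<Gamma> \<delta> (\<delta> P) - eval_marking \<Gamma> \<delta> (\<delta> Q)\<bar> \<ge> 2)"

definition reduced_power_circuit :: "'a list \<Rightarrow> ('a \<Rightarrow> 'a \<Rightarrow> int) \<Rightarrow> bool" where
  "reduced_power_circuit Ps \<delta> \<longleftrightarrow>
     power_circuit (set Ps) \<delta> \<and>
     (\<forall>P\<in>set Ps. compact_marking (set Ps) \<delta> (\<delta> P)) \<and>
     sorted_wrt (\<lambda>P Q. eval_node (set Ps) \<delta> P < eval_node (set Ps) \<delta> Q) Ps"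


section \<open>Encoding by bit strings\<close>

text \<open>The symbols 0, 1, -1 are written 00, 10, 11. Power circuits are encoded over the node set
  \<open>{0, \<dots>, n - 1}\<close>: the matrix of \<open>\<delta>\<close> row by row, followed by the marking.\<close>

definition encode_symbol :: "int \<Rightarrow> bool list" where
  "encode_symbol s = [s \<noteq> 0, s < 0]"

definition encode_marking :: "nat \<Rightarrow> (nat \<Rightarrow> int) \<Rightarrow> bool list" where
  "encode_marking n M = concat (map (\<lambda>i. encode_symbol (M i)) [0..<n])"

definition encode :: "nat \<Rightarrow> (nat \<Rightarrow> nat \<Rightarrow> int) \<Rightarrow> (nat \<Rightarrow> int) \<Rightarrow> bool list" where
  "encode n \<delta> M = concat (map (\<lambda>i. encode_marking n (\<delta> i)) [0..<n]) @ encode_marking n M"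


section \<open>Threshold circuits\<close>

text \<open>A circuit is a list of gates in topological order: a gate may refer only to gates occurring
  earlier in the list. The predecessors of an unbounded fan-in gate form a set, so there are no
  parallel wires, which matters for majority gates.\<close>

datatype gate =
    Input_Gate nat
  | Not_Gate nat
  | And_Gate "nat set"
  | Or_Gate "nat set"
  | Majority_Gate "nat set"

datatype circuit = Circuit (gates: "gate list") (outputs: "nat list")

fun preds :: "gate \<Rightarrow> nat set" where
  "preds (Input_Gate i) = {}"
| "preds (Not_Gate j) = {j}"
| "preds (And_Gate S) = S"
| "preds (Or_Gate S) = S"
| "preds (Majority_Gate S) = S"

text \<open>The outputs are distinct gates, so that the number of gates also bounds the output length.\<close>

definition wf_circuit :: "nat \<Rightarrow> circuit \<Rightarrow> bool" where
  "wf_circuit n C \<longleftrightarrow>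
     (\<forall>i < length (gates C). preds (gates C ! i) \<subseteq> {..<i}) \<and>
     (\<forall>i. Input_Gate i \<in> set (gates C) \<longrightarrow> i < n) \<and>
     distinct (outputs C) \<and> set (outputs C) \<subseteq> {..<length (gates C)}"

fun gate_value :: "bool list \<Rightarrow> bool list \<Rightarrow> gate \<Rightarrow> bool" where
  "gate_value x vs (Input_Gate i) = x ! i"
| "gate_value x vs (Not_Gate j) = (\<not> vs ! j)"
| "gate_value x vs (And_Gate S) = (\<forall>j\<in>S. vs ! j)"
| "gate_value x vs (Or_Gate S) = (\<exists>j\<in>S. vs ! j)"
| "gate_value x vs (Majority_Gate S) = (card S \<le> 2 * card {j \<in> S. vs ! j})"

definition gate_values :: "circuit \<Rightarrow> bool list \<Rightarrow> bool list" where
  "gate_values C x = foldl (\<lambda>vs g. vs @ [gate_value x vs g]) [] (gates C)"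

definition circuit_output :: "circuit \<Rightarrow> bool list \<Rightarrow> bool list" where
  "circuit_output C x = map (\<lambda>j. gate_values C x ! j) (outputs C)"

definition num_gates :: "circuit \<Rightarrow> nat" where
  "num_gates C = length (gates C)"

text \<open>The level of a gate is the length of a longest path ending in it.\<close>

definition gate_levels :: "circuit \<Rightarrow> nat list" where
  "gate_levels C =
     foldl (\<lambda>ls g. ls @ [Max (insert 0 ((\<lambda>j. Suc (ls ! j)) ` preds g))]) [] (gates C)"

definition circuit_depth :: "circuit \<Rightarrow> nat" where
  "circuit_depth C = Max (insert 0 (set (gate_levels C)))"


section \<open>The class DepParaTC\<close>

text \<open>A problem is given by the relation \<open>correct x y\<close>: \<open>y\<close> is a correct answer on \<open>x\<close>. It need not
  be single-valued, and every \<open>y\<close> counts as correct for an \<open>x\<close> which is not an instance.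
  The bounds \<open>n\<^bsup>O(1)\<^esup>\<close> and \<open>O(D log\<^sup>k n)\<close> are made meaningful for \<open>D = 0\<close> and \<open>n \<le> 1\<close>, where read
  literally they would forbid any computation.\<close>

definition DepParaTC ::
  "nat \<Rightarrow> (bool list \<Rightarrow> nat) \<Rightarrow> (bool list \<Rightarrow> bool list \<Rightarrow> bool) set" where
  "DepParaTC k par = {correct. \<exists>C :: nat \<Rightarrow> nat \<Rightarrow> circuit.
     (\<forall>n D. wf_circuit n (C n D)) \<and>
     (\<exists>c. \<forall>n D. num_gates (C n D) \<le> c * n ^ c + c) \<and>
     (\<exists>c. \<forall>n D. real (circuit_depth (C n D)) \<le>
        c * real (max 1 D) * log 2 (real (max 2 n)) ^ k) \<and>
     (\<forall>n D x. length x = n \<longrightarrow> par x \<le> D \<longrightarrow> correct x (circuit_output (C n D) x))}"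


section \<open>Reduction of power circuits\<close>

definition encodes_instance ::
  "bool list \<Rightarrow> nat \<Rightarrow> (nat \<Rightarrow> nat \<Rightarrow> int) \<Rightarrow> (nat \<Rightarrow> int) \<Rightarrow> bool" where
  "encodes_instance x n \<delta> M \<longleftrightarrow>
     power_circuit {..<n} \<delta> \<and> marking {..<n} M \<and> x = encode n \<delta> M"

definition encodes_reduced ::
  "bool list \<Rightarrow> nat \<Rightarrow> (nat \<Rightarrow> nat \<Rightarrow> int) \<Rightarrow> (nat \<Rightarrow> int) \<Rightarrow> bool" where
  "encodes_reduced y n \<delta> M \<longleftrightarrow>
     reduced_power_circuit [0..<n] \<delta> \<and> compact_marking {..<n} \<delta> M \<and> y = encode n \<delta> M"

definition reduction_correct :: "bool list \<Rightarrow> bool list \<Rightarrow> bool" where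
  "reduction_correct x y \<longleftrightarrow>
     (\<forall>n \<delta> M. encodes_instance x n \<delta> M \<longrightarrow>
        (\<exists>n' \<delta>' M'. encodes_reduced y n' \<delta>' M' \<and>
           eval_marking {..<n'} \<delta>' M' = eval_marking {..<n} \<delta> M))"

text \<open>The depth of the power circuit encoded by \<open>x\<close>; see \<open>instance_depth_eq\<close> below.
  The value on strings which are not instances is irrelevant.\<close>

definition instance_depth :: "bool list \<Rightarrow> nat" where
  "instance_depth x = (THE d. \<exists>n \<delta> M. encodes_instance x n \<delta> M \<and> d = depth {..<n} \<delta>)"

lemma encode_symbol_inj:
  "encode_symbol s = encode_symbol t \<Longrightarrow> s \<in> {-1, 0, 1} \<Longrightarrow> t \<in> {-1, 0, 1} \<Longrightarrow> s = t"
  by (auto simp: encode_symbol_def)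

lemma length_encode_marking: "length (encode_marking n M) = 2 * n"
  by (induction n) (auto simp: encode_marking_def encode_symbol_def)

lemma length_encode: "length (encode n \<delta> M) = 2 * n * n + 2 * n"
proof -
  have "length (concat (map (\<lambda>i. encode_marking n (\<delta> i)) [0..<k])) = 2 * n * k" for k
    by (induction k) (auto simp: length_encode_marking)
  then show ?thesis by (simp add: encode_def length_encode_marking)
qed

lemma concat_map_upt_inj:
  assumes "concat (map f [0..<k]) = concat (map g [0..<k])"
    and "\<And>i. length (f i) = length (g i)" and "i < k"
  shows "f i = g i"
  using assms(1,3)
proof (induction k)
  case (Suc k)
  have "length (concat (map f [0..<k])) = length (concat (map g [0..<k]))" for k
    by (induction k) (auto simp: assms(2))
  with Suc show ?case by (auto simp: less_Suc_eq)
qed simp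

lemma encode_marking_inj:
  assumes "encode_marking n M = encode_marking n M'" "marking {..<n} M" "marking {..<n} M'" "i < n"
  shows "M i = M' i"
proof -
  have "encode_symbol (M i) = encode_symbol (M' i)"
    using concat_map_upt_inj[OF assms(1)[unfolded encode_marking_def] _ assms(4)]
    by (simp add: encode_symbol_def)
  then show ?thesis
    using assms(2-4) encode_symbol_inj unfolding marking_def by blast
qed

lemma encodes_instance_inj:
  assumes "encodes_instance x n \<delta> M" "encodes_instance x n' \<delta>' M'"
  shows "n = n'" and "\<And>i j. i < n \<Longrightarrow> j < n \<Longrightarrow> \<delta> i j = \<delta>' i j" and "\<And>i. i < n \<Longrightarrow> M i = M' i"
proof -
  define f :: "nat \<Rightarrow> nat" where "f a = 2 * a * a + 2 * a" for a
  have "strict_mono f"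
    by (simp add: f_def strict_mono_Suc_iff)
  moreover have "f n = f n'"
    using assms length_encode[of n \<delta> M] length_encode[of n' \<delta>' M']
    by (simp add: encodes_instance_def f_def)
  ultimately show n: "n = n'"
    by (simp add: strict_mono_eq)
  have eq: "encode n \<delta> M = encode n \<delta>' M'"
    using assms n by (simp add: encodes_instance_def)
  then have M: "encode_marking n M = encode_marking n M'"
    and rows: "concat (map (\<lambda>i. encode_marking n (\<delta> i)) [0..<n]) =
      concat (map (\<lambda>i. encode_marking n (\<delta>' i)) [0..<n])"
    by (simp_all add: encode_def length_encode_marking)
  show "M i = M' i" if "i < n" for i
    using encode_marking_inj[OF M _ _ that] assms n by (auto simp: encodes_instance_def)
  show "\<delta> i j = \<delta>' i j" if "i < n" "j < n" for i j
  proof -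
    have "encode_marking n (\<delta> i) = encode_marking n (\<delta>' i)"
      using concat_map_upt_inj[OF rows _ that(1)] by (simp add: length_encode_marking)
    then show ?thesis
      using encode_marking_inj[OF _ _ _ that(2)] assms n that(1)
      by (auto simp: encodes_instance_def power_circuit_def signed_dag_def)
  qed
qed

lemma instance_depth_eq:
  assumes "encodes_instance x n \<delta> M"
  shows "instance_depth x = depth {..<n} \<delta>"
  unfolding instance_depth_def
proof (rule the_equality)
  show "\<exists>n' \<delta>' M'. encodes_instance x n' \<delta>' M' \<and> depth {..<n} \<delta> = depth {..<n'} \<delta>'"
    using assms by blast
next
  fix d assume "\<exists>n' \<delta>' M'. encodes_instance x n' \<delta>' M' \<and> d = depth {..<n'} \<delta>'"
  then obtain n' \<delta>' M' where *: "encodes_instance x n' \<delta>' M'" "d = depth {..<n'} \<delta>'" by blast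
  have "edges {..<n} \<delta> = edges {..<n'} \<delta>'"
    using encodes_instance_inj[OF assms *(1)] by (auto simp: edges_def)
  then show "d = depth {..<n} \<delta>" using *(2) by (simp add: depth_def)
qed

end

theory Submission
  imports Defs
begin

text \<open>
  Write \<open>a\<^sub>P\<close> for the exponent of a node \<open>P\<close>, so that \<open>a\<^sub>P = \<Sum>\<^sub>Q \<delta>(P, Q) \<cdot> 2\<^bsup>a\<^sub>Q\<^esup>\<close>, and add a node
  of exponent 0. All information needed is in the bits \<open>a\<^sub>Q + k \<le> a\<^sub>R\<close> for polynomially bounded \<open>|k|\<close>.
  These are correct for the nodes of height less than \<open>t\<close> after \<open>t\<close> rounds of constant depth, each of which
  computes signs of sums \<open>\<Sum> c\<^sub>S \<cdot> 2\<^bsup>a\<^sub>S\<^esup>\<close> with small coefficients, using the bits of the previous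
  round. If such a sum is read from the most significant position downwards, its running value
  is determined by a window of logarithmic length as long as it is smaller than \<open>B > \<Sum> |c\<^sub>S|\<close>, and
  the first value outside this range has the sign of the whole sum; so counting with weights of
  polynomial size suffices.

  A compact marking is a non-adjacent form. The nonzero digits of the non-adjacent form of
  \<open>\<Sum> c\<^sub>S \<cdot> 2\<^bsup>a\<^sub>S\<^esup>\<close> are at positions \<open>a\<^sub>S + j\<close> with \<open>j\<close> at most logarithmic in \<open>\<Sum> |c\<^sub>S|\<close>. Hence the powers of
  two with exponents \<open>a\<^sub>Q + j\<close>, \<open>0 \<le> j < c\<close>, are the nodes of a reduced power circuit on which all
  markings of the given circuit have compact representations. The digit of \<open>X\<close> at \<open>p\<close> depends on
  \<open>3 X div 2\<^bsup>p + 1\<^esup>\<close> modulo 6, which is again found by sign tests.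
\<close>

section \<open>Building threshold circuits\<close>

text \<open>Exponents may be towers of twos and can never be written out; only comparisons up to
  polynomially bounded shifts are accessible. A number such as \<open>a Q + k\<close> is therefore
  handled through its coefficients over the nodes, the shift \<open>k\<close> being the coefficient
  of the extra node. This makes the choice of the output nodes self-referential: the exponent
  \<open>a Q + j\<close> of an output node must have its own non-adjacent form supported by output
  nodes, so \<open>c\<close> has to dominate the logarithm of coefficients that include
  \<open>j\<close> itself. The condition \<open>3 * (n + T) < 2 ^ c\<close> with
  \<open>T = (n + 1) * c\<close> resolves this. Two features are forced by the complexity class. The
  number of gates must not depend on the depth bound \<open>D\<close>, so the rounds are cut off at
  \<open>n\<close>, by which time all nodes of any dag are settled. And the output length is fixed
  although positions \<open>a Q + j\<close> may coincide, so the new nodes are addressed by their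
  rank among representatives.\<close>

definition vals :: "gate list \<Rightarrow> bool list \<Rightarrow> bool list" where
  "vals gs x = foldl (\<lambda>vs g. vs @ [gate_value x vs g]) [] gs"

definition lvls :: "gate list \<Rightarrow> nat list" where
  "lvls gs = foldl (\<lambda>ls g. ls @ [Max (insert 0 ((\<lambda>j. Suc (ls ! j)) ` preds g))]) [] gs"

lemma vals_Nil [simp]: "vals [] x = []"
  by (simp add: vals_def)

lemma lvls_Nil [simp]: "lvls [] = []"
  by (simp add: lvls_def)

lemma vals_snoc: "vals (gs @ [g]) x = vals gs x @ [gate_value x (vals gs x) g]"
  by (simp add: vals_def)

lemma lvls_snoc: "lvls (gs @ [g]) = lvls gs @ [Max (insert 0 ((\<lambda>j. Suc (lvls gs ! j)) ` preds g))]"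
  by (simp add: lvls_def)

lemma length_vals [simp]: "length (vals gs x) = length gs"
  by (induction gs rule: rev_induct) (auto simp: vals_snoc)

lemma length_lvls [simp]: "length (lvls gs) = length gs"
  by (induction gs rule: rev_induct) (auto simp: lvls_snoc)

lemma vals_append_nth: "i < length gs \<Longrightarrow> vals (gs @ hs) x ! i = vals gs x ! i"
  by (induction hs rule: rev_induct) (auto simp: vals_snoc nth_append simp flip: append_assoc)

lemma lvls_append_nth: "i < length gs \<Longrightarrow> lvls (gs @ hs) ! i = lvls gs ! i"
  by (induction hs rule: rev_induct) (auto simp: lvls_snoc nth_append simp flip: append_assoc)

definition topo :: "gate list \<Rightarrow> bool" where
  "topo gs \<longleftrightarrow> (\<forall>i < length gs. preds (gs ! i) \<subseteq> {..<i})"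

lemma topo_snoc: "topo (gs @ [g]) \<longleftrightarrow> topo gs \<and> preds g \<subseteq> {..<length gs}"
  by (auto simp: topo_def nth_append less_Suc_eq)

text \<open>The level bound \<open>l\<close> is absolute rather than relative to \<open>gs\<close>:
  blocks appended one after the other without depending on each other then cost no depth. Input
  gates are excluded because all of them are placed before any extension.\<close>

definition extends :: "nat \<Rightarrow> nat \<Rightarrow> gate list \<Rightarrow> gate list \<Rightarrow> bool" where
  "extends s l gs hs \<longleftrightarrow> length hs \<le> s \<and> topo (gs @ hs) \<and> (\<forall>i. Input_Gate i \<notin> set hs) \<and>
     (\<forall>i. length gs \<le> i \<longrightarrow> i < length gs + length hs \<longrightarrow> lvls (gs @ hs) ! i \<le> l)"

lemma extends_append:
  assumes "extends s l gs hs" "extends s' l' (gs @ hs) hs'"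
  shows "extends (s + s') (max l l') gs (hs @ hs')"
proof -
  have "lvls (gs @ hs @ hs') ! i \<le> max l l'"
    if "length gs \<le> i" "i < length gs + length hs + length hs'" for i
  proof (cases "i < length (gs @ hs)")
    case True
    then show ?thesis
      using assms(1) that lvls_append_nth[OF True, of hs'] by (auto simp: extends_def le_max_iff_disj)
  next
    case False
    then show ?thesis
      using assms(2) that by (auto simp: extends_def le_max_iff_disj)
  qed
  then show ?thesis
    using assms by (auto simp: extends_def)
qed

lemma extends_mono: "extends s l gs hs \<Longrightarrow> s \<le> s' \<Longrightarrow> l \<le> l' \<Longrightarrow> extends s' l' gs hs"
  by (force simp: extends_def)

lemma extends_snoc:
  assumes "topo gs" "preds g \<subseteq> {..<length gs}" "\<And>i. g \<noteq> Input_Gate i"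
    and "\<And>j. j \<in> preds g \<Longrightarrow> lvls gs ! j < l"
  shows "extends 1 l gs [g]"
proof -
  have "finite (preds g)" using assms(2) finite_subset by blast
  then have "Max (insert 0 ((\<lambda>j. Suc (lvls gs ! j)) ` preds g)) \<le> l"
    using assms(4) by (auto simp: Suc_le_eq)
  then show ?thesis
    using assms(1-3)
    by (auto simp: extends_def topo_snoc lvls_snoc nth_append)
qed

text \<open>The wires \<open>'w\<close> carrying the arguments may be attached to any gates of a given circuit.\<close>

definition realizes :: "nat \<Rightarrow> nat \<Rightarrow> (('w \<Rightarrow> bool) \<Rightarrow> bool) \<Rightarrow> bool" where
  "realizes s d f \<longleftrightarrow> (\<forall>gs idx l. topo gs \<longrightarrow> (\<forall>w. idx w < length gs \<and> lvls gs ! idx w \<le> l) \<longrightarrow>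
     (\<exists>hs. hs \<noteq> [] \<and> extends s (l + d) gs hs \<and>
        (\<forall>x. last (vals (gs @ hs) x) = f (\<lambda>w. vals gs x ! idx w))))"

lemma realizes_mono:
  assumes "realizes s d f" "s \<le> s'" "d \<le> d'"
  shows "realizes s' d' f"
  using assms unfolding realizes_def
  by (meson add_left_mono extends_mono)

text \<open>Copying through a conjunction of fan-in 1 yields a fresh last gate, so a bare wire can
  join families whose members must end in distinct gates.\<close>

lemma realizes_wire:
  fixes w :: 'w
  shows "realizes 1 1 (\<lambda>v. v w)"
  unfolding realizes_def
proof (intro allI impI)
  fix gs :: "gate list" and idx :: "'w \<Rightarrow> nat" and l
  assume "topo gs" and idx: "\<forall>w. idx w < length gs \<and> lvls gs ! idx w \<le> l"
  then have "extends 1 (l + 1) gs [And_Gate {idx w}]"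
    by (intro extends_snoc) (auto simp: less_Suc_eq_le)
  then show "\<exists>hs. hs \<noteq> [] \<and> extends 1 (l + 1) gs hs \<and>
      (\<forall>x. last (vals (gs @ hs) x) = vals gs x ! idx w)"
    by (intro exI[of _ "[And_Gate {idx w}]"]) (auto simp: vals_snoc)
qed

text \<open>All members read the same wires of \<open>gs\<close> and work in parallel: sizes add up
  while the depth stays \<open>d\<close>. Distinct positions matter twice, for majority gates, which
  count a set of gates, and for the outputs of a circuit.\<close>

lemma realizes_family:
  fixes f :: "'a \<Rightarrow> ('w \<Rightarrow> bool) \<Rightarrow> bool" and A :: "'a set" and idx :: "'w \<Rightarrow> nat"
  assumes "finite A" "\<forall>a\<in>A. realizes s d (f a)"
    and "topo gs" "\<forall>w. idx w < length gs \<and> lvls gs ! idx w \<le> l"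
  shows "\<exists>hs pos. extends (card A * s) (l + d) gs hs \<and> inj_on pos A \<and>
    (\<forall>a\<in>A. pos a < length gs + length hs \<and> length gs \<le> pos a \<and>
       (\<forall>x. vals (gs @ hs) x ! pos a = f a (\<lambda>w. vals gs x ! idx w)))"
  using assms(1,2)
proof (induction A rule: finite_induct)
  case empty
  show ?case
    using assms(3) by (intro exI[of _ "[]"]) (auto simp: extends_def)
next
  case (insert a A)
  have "\<forall>a\<in>A. realizes s d (f a)" using insert.prems by simp
  from insert.IH[OF this] obtain hs pos where
    hs: "extends (card A * s) (l + d) gs hs" and inj: "inj_on pos A" and
    *: "\<forall>a\<in>A. pos a < length gs + length hs \<and> length gs \<le> pos a \<and>
       (\<forall>x. vals (gs @ hs) x ! pos a = f a (\<lambda>w. vals gs x ! idx w))"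
    by (elim exE conjE)
  from * have pos: "pos a < length gs + length hs" "length gs \<le> pos a"
      "vals (gs @ hs) x ! pos a = f a (\<lambda>w. vals gs x ! idx w)" if "a \<in> A" for a x
    using that by auto
  have "topo (gs @ hs)" using hs by (simp add: extends_def)
  moreover have "\<forall>w. idx w < length (gs @ hs) \<and> lvls (gs @ hs) ! idx w \<le> l"
    using assms(4) by (simp add: lvls_append_nth trans_less_add1)
  moreover have "realizes s d (f a)" using insert by auto
  ultimately obtain hs' where hs': "hs' \<noteq> []" "extends s (l + d) (gs @ hs) hs'"
    "\<And>x. last (vals ((gs @ hs) @ hs') x) = f a (\<lambda>w. vals (gs @ hs) x ! idx w)"
    unfolding realizes_def by blast
  define p where "p = length (gs @ hs @ hs') - 1"
  have "extends (card (insert a A) * s) (l + d) gs (hs @ hs')"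
    using extends_append[OF hs hs'(2)] insert by (simp add: add.commute)
  moreover have p: "length gs + length hs \<le> p" "p < length gs + length (hs @ hs')"
    using hs'(1) by (cases hs'; simp add: p_def)+
  moreover have "vals (gs @ hs @ hs') x ! p = f a (\<lambda>w. vals gs x ! idx w)" for x
  proof -
    have "vals (gs @ hs @ hs') x \<noteq> []"
      using hs'(1) by (metis append_is_Nil_conv length_0_conv length_vals)
    then have "vals (gs @ hs @ hs') x ! p = last (vals ((gs @ hs) @ hs') x)"
      by (simp add: last_conv_nth p_def)
    then show ?thesis using hs'(3) assms(4) by (simp add: vals_append_nth)
  qed
  moreover have "vals (gs @ hs @ hs') x ! pos b = f b (\<lambda>w. vals gs x ! idx w)" if "b \<in> A" for x b
    using pos that vals_append_nth[of "pos b" "gs @ hs" hs' x] by simp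
  moreover obtain pos' where "inj_on pos' (insert a A)" "pos' a = p" "\<forall>b\<in>A. pos' b = pos b"
  proof
    have "p \<notin> pos ` A" using p(1) pos(1) by fastforce
    then show "inj_on (pos(a := p)) (insert a A)"
      using inj insert(2) by (auto simp: inj_on_def)
  qed (use insert(2) in auto)
  moreover have "length gs \<le> p" "pos b < length gs + length (hs @ hs')" if "b \<in> A" for b
    using p(1) pos(1)[OF that] by auto
  ultimately show ?case
    using pos(2) p by (intro exI[of _ "hs @ hs'"] exI[of _ pos']) auto
qed

text \<open>\<open>con\<close> builds the final gate from the set of positions of its arguments.
  With \<open>inj_on pos A\<close> a majority gate counts arguments and not merely gates.\<close>

lemma realizes_gate:
  fixes f :: "'a \<Rightarrow> ('w \<Rightarrow> bool) \<Rightarrow> bool"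
  assumes "finite A" "\<And>a. a \<in> A \<Longrightarrow> realizes s d (f a)"
    and con: "\<And>pos :: 'a \<Rightarrow> nat. preds (con (pos ` A)) = pos ` A"
      "\<And>S i. con S \<noteq> Input_Gate i"
    and F: "\<And>pos vs x v. inj_on pos A \<Longrightarrow> (\<And>a. a \<in> A \<Longrightarrow> vs ! pos a = f a v) \<Longrightarrow>
      gate_value x vs (con (pos ` A)) = F v"
  shows "realizes (card A * s + 1) (d + 1) F"
  unfolding realizes_def
proof (intro allI impI)
  fix gs :: "gate list" and idx :: "'w \<Rightarrow> nat" and l
  assume gs: "topo gs" and idx: "\<forall>w. idx w < length gs \<and> lvls gs ! idx w \<le> l"
  obtain hs pos where
    hs: "extends (card A * s) (l + d) gs hs" "inj_on pos A" and
    *: "\<forall>a\<in>A. pos a < length gs + length hs \<and> length gs \<le> pos a \<and>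
       (\<forall>x. vals (gs @ hs) x ! pos a = f a (\<lambda>w. vals gs x ! idx w))"
    using realizes_family[OF assms(1) _ gs idx, where f = f] assms(2) by blast
  from * have pos: "pos a < length gs + length hs" "length gs \<le> pos a"
      "vals (gs @ hs) x ! pos a = f a (\<lambda>w. vals gs x ! idx w)" if "a \<in> A" for a x
    using that by auto
  let ?g = "con (pos ` A)"
  have "extends 1 (l + d + 1) (gs @ hs) [?g]"
    using hs(1) pos con by (intro extends_snoc) (auto simp: extends_def less_Suc_eq_le)
  from extends_append[OF hs(1) this]
  have "extends (card A * s + 1) (l + (d + 1)) gs (hs @ [?g])"
    by simp
  moreover have "last (vals (gs @ hs @ [?g]) x) = F (\<lambda>w. vals gs x ! idx w)" for x
    using F[OF hs(2) pos(3)] by (simp add: vals_snoc flip: append_assoc)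
  ultimately show "\<exists>hs. hs \<noteq> [] \<and> extends (card A * s + 1) (l + (d + 1)) gs hs \<and>
      (\<forall>x. last (vals (gs @ hs) x) = F (\<lambda>w. vals gs x ! idx w))"
    by blast
qed

lemma realizes_Ball:
  assumes "finite A" "\<And>a. a \<in> A \<Longrightarrow> realizes s d (f a)"
  shows "realizes (card A * s + 1) (d + 1) (\<lambda>v. \<forall>a\<in>A. f a v)"
  by (rule realizes_gate[OF assms, where con = And_Gate]) auto

lemma realizes_Bex:
  assumes "finite A" "\<And>a. a \<in> A \<Longrightarrow> realizes s d (f a)"
  shows "realizes (card A * s + 1) (d + 1) (\<lambda>v. \<exists>a\<in>A. f a v)"
  by (rule realizes_gate[OF assms, where con = Or_Gate]) auto

lemma realizes_const: "realizes 1 1 (\<lambda>v. b)"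
proof (cases b)
  case True
  then show ?thesis
    using realizes_Ball[of "{} :: nat set" 0 0 "\<lambda>_ _. True"] by simp
next
  case False
  then show ?thesis
    using realizes_Bex[of "{} :: nat set" 0 0 "\<lambda>_ _. True"] by simp
qed

lemma realizes_majority:
  assumes "finite A" "\<And>a. a \<in> A \<Longrightarrow> realizes s d (f a)"
  shows "realizes (card A * s + 1) (d + 1) (\<lambda>v. card A \<le> 2 * card {a \<in> A. f a v})"
proof (rule realizes_gate[OF assms, where con = Majority_Gate])
  fix pos :: "'a \<Rightarrow> nat" and vs x v
  assume inj: "inj_on pos A" and vs: "\<And>a. a \<in> A \<Longrightarrow> vs ! pos a = f a v"
  have "{j \<in> pos ` A. vs ! j} = pos ` {a \<in> A. f a v}"
    using vs by auto
  moreover have "inj_on pos {a \<in> A. f a v}"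
    using inj by (rule inj_on_subset) auto
  ultimately show "gate_value x vs (Majority_Gate (pos ` A)) = (card A \<le> 2 * card {a \<in> A. f a v})"
    using inj by (simp add: card_image)
qed auto

lemma realizes_Not:
  assumes "realizes s d f"
  shows "realizes (s + 1) (d + 1) (\<lambda>v. \<not> f v)"
proof -
  have "realizes (card {()} * s + 1) (d + 1) (\<lambda>v. \<not> f v)"
    by (rule realizes_gate[where f = "\<lambda>_. f" and con = "\<lambda>S. Not_Gate (the_elem S)"])
      (use assms in auto)
  then show ?thesis by simp
qed

lemma realizes_threshold:
  assumes "finite A" "\<And>a. a \<in> A \<Longrightarrow> realizes s d (f a)" "1 \<le> s" "1 \<le> d"
  shows "realizes (4 * card A * s + 1) (d + 1) (\<lambda>v. t \<le> card {a \<in> A. f a v})"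
proof (cases "t \<le> card A")
  case False
  then have "\<not> t \<le> card {a \<in> A. f a v}" for v
    using card_mono[OF assms(1), of "{a \<in> A. f a v}"] by force
  then show ?thesis
    using realizes_mono[OF realizes_const, of "4 * card A * s + 1" "d + 1" False] by simp
next
  case True
  \<comment> \<open>padding with \<open>card A\<close> constants \<open>True\<close> and \<open>2 * t\<close> constants \<open>False\<close> moves the threshold of
    the majority gate to \<open>t\<close>\<close>
  let ?A = "Inl ` A \<union> Inr ` ({0} \<times> {..<card A} \<union> {1::nat} \<times> {..<2 * t})"
  let ?f = "\<lambda>c v. case c of Inl a \<Rightarrow> f a v | Inr (i, j) \<Rightarrow> i = (0::nat)"
  have const: "realizes s d (\<lambda>v. b)" for b
    using realizes_const assms(3,4) by (rule realizes_mono)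
  have fin: "finite ?A" using assms(1) by auto
  have "card ({0} \<times> {..<card A} \<union> {1::nat} \<times> {..<2 * t}) = card A + 2 * t"
    by (subst card_Un_disjoint) auto
  then have card: "card ?A = 2 * card A + 2 * t"
    using assms(1) by (subst card_Un_disjoint) (auto simp: card_image)
  have "realizes (card ?A * s + 1) (d + 1) (\<lambda>v. card ?A \<le> 2 * card {c \<in> ?A. ?f c v})"
    using assms(2) const by (intro realizes_majority[OF fin]) (auto split: prod.splits)
  moreover have "card {c \<in> ?A. ?f c v} = card {a \<in> A. f a v} + card A" for v
  proof -
    have "{c \<in> ?A. ?f c v} = Inl ` {a \<in> A. f a v} \<union> Inr ` ({0} \<times> {..<card A})"
      by (auto split: prod.splits)
    then show ?thesis
      using assms(1) by (simp, subst card_Un_disjoint) (auto simp: card_image)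
  qed
  ultimately have "realizes (card ?A * s + 1) (d + 1) (\<lambda>v. t \<le> card {a \<in> A. f a v})"
    unfolding card by simp
  then show ?thesis
    by (rule realizes_mono) (use True card in auto)
qed

section \<open>The sign of a sum of signed powers of two\<close>

text \<open>The value read so far when the sum is scanned from the top down to position
  \<open>p\<close>, in units of \<open>2 ^ p\<close>. Positions are integers because the scan
  continues below 0, where, for nonnegative exponents, the value just doubles.\<close>

definition tail :: "'i set \<Rightarrow> ('i \<Rightarrow> int) \<Rightarrow> ('i \<Rightarrow> int) \<Rightarrow> int \<Rightarrow> int" where
  "tail I a c p = (\<Sum>i\<in>I. if p \<le> a i then c i * 2 ^ nat (a i - p) else 0)"

definition digit_sum :: "'i set \<Rightarrow> ('i \<Rightarrow> int) \<Rightarrow> ('i \<Rightarrow> int) \<Rightarrow> int \<Rightarrow> int" where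
  "digit_sum I a c p = (\<Sum>i\<in>I. c i * of_bool (a i = p))"

definition window :: "nat \<Rightarrow> 'i set \<Rightarrow> ('i \<Rightarrow> int) \<Rightarrow> ('i \<Rightarrow> int) \<Rightarrow> int \<Rightarrow> int" where
  "window G I a c p = (\<Sum>i\<in>I. \<Sum>l\<in>{..G}. 2 ^ l * (c i * of_bool (a i = p + int l)))"

text \<open>The symmetric residue modulo \<open>2 ^ (G + 1)\<close>, from which a value of modulus
  below \<open>2 ^ G\<close> can be recovered.\<close>

definition srem :: "nat \<Rightarrow> int \<Rightarrow> int" where
  "srem G u = (u + 2 ^ G) mod 2 ^ (G + 1) - 2 ^ G"

text \<open>One Horner step from the value reconstructed at \<open>p + 1\<close>. It is the true
  value at \<open>p\<close> if the one at \<open>p + 1\<close> is small, even if the value at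
  \<open>p\<close> is not; so the first excess over \<open>B\<close> is seen correctly.\<close>

definition overflow :: "nat \<Rightarrow> 'i set \<Rightarrow> ('i \<Rightarrow> int) \<Rightarrow> ('i \<Rightarrow> int) \<Rightarrow> int \<Rightarrow> int" where
  "overflow G I a c p = 2 * srem G (window G I a c (p + 1)) + digit_sum I a c p"

lemma tail_split:
  assumes "q \<le> p"
  shows "tail I a c q = 2 ^ nat (p - q) * tail I a c p +
    (\<Sum>i\<in>I. if q \<le> a i \<and> a i < p then c i * 2 ^ nat (a i - q) else 0)"
  unfolding tail_def sum_distrib_left sum.distrib[symmetric]
proof (rule sum.cong[OF refl])
  fix i
  have "(2::int) ^ nat (p - q) * 2 ^ nat (a i - p) = 2 ^ nat (a i - q)" if "p \<le> a i"
    using that assms by (simp add: power_add[symmetric] nat_add_distrib[symmetric])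
  then show "(if q \<le> a i then c i * 2 ^ nat (a i - q) else 0) =
      2 ^ nat (p - q) * (if p \<le> a i then c i * 2 ^ nat (a i - p) else 0) +
      (if q \<le> a i \<and> a i < p then c i * 2 ^ nat (a i - q) else 0)"
    using assms by auto
qed

lemma tail_rest_bound:
  assumes "finite I" "q \<le> p"
  shows "\<bar>tail I a c q - 2 ^ nat (p - q) * tail I a c p\<bar> \<le> 2 ^ nat (p - q) * (\<Sum>i\<in>I. \<bar>c i\<bar>)"
proof -
  have "\<bar>\<Sum>i\<in>I. if q \<le> a i \<and> a i < p then c i * 2 ^ nat (a i - q) else 0\<bar> \<le>
      (\<Sum>i\<in>I. \<bar>if q \<le> a i \<and> a i < p then c i * 2 ^ nat (a i - q) else 0\<bar>)"
    by (rule sum_abs)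
  also have "\<dots> \<le> (\<Sum>i\<in>I. 2 ^ nat (p - q) * \<bar>c i\<bar>)"
  proof (rule sum_mono)
    fix i
    have "(2::int) ^ nat (a i - q) \<le> 2 ^ nat (p - q)" if "a i < p"
      using that by (intro power_increasing) auto
    then show "\<bar>if q \<le> a i \<and> a i < p then c i * 2 ^ nat (a i - q) else 0\<bar> \<le> 2 ^ nat (p - q) * \<bar>c i\<bar>"
      by (auto simp: abs_mult mult.commute[of "2 ^ _"] intro!: mult_left_mono)
  qed
  finally show ?thesis
    using tail_split[OF assms(2), of I a c] by (simp add: sum_distrib_left)
qed

text \<open>In units of \<open>2 ^ p\<close> the terms below \<open>p\<close> add up to less than
  \<open>B\<close>, too little to bring a value beyond \<open>B\<close> back to 0.\<close>

lemma tail_persistent: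
  assumes "finite I" "(\<Sum>i\<in>I. \<bar>c i\<bar>) < B" "q \<le> p"
  shows "B \<le> tail I a c p \<Longrightarrow> 0 < tail I a c q" "tail I a c p \<le> - B \<Longrightarrow> tail I a c q < 0"
proof -
  let ?e = "2 ^ nat (p - q) :: int"
  have *: "\<bar>tail I a c q - ?e * tail I a c p\<bar> < ?e * B"
    using tail_rest_bound[OF assms(1,3), of a c] assms(2)
    by (meson le_less_trans mult_strict_left_mono zero_less_numeral zero_less_power)
  show "0 < tail I a c q" if "B \<le> tail I a c p"
    using * mult_left_mono[OF that, of ?e] zero_le_power[of "2::int" "nat (p - q)"] by (smt (verit))
  show "tail I a c q < 0" if "tail I a c p \<le> - B"
    using * mult_left_mono[OF that, of ?e] by simp
qed

lemma tail_Suc: "tail I a c p = 2 * tail I a c (p + 1) + digit_sum I a c p"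
  using tail_split[of p "p + 1" I a c]
  by (auto simp: digit_sum_def intro!: sum.cong)

lemma tail_window: "tail I a c p = 2 ^ (G + 1) * tail I a c (p + int G + 1) + window G I a c p"
proof -
  have "(\<Sum>l\<in>{..G}. 2 ^ l * (c i * of_bool (a i = p + int l))) =
      (if p \<le> a i \<and> a i < p + int G + 1 then c i * 2 ^ nat (a i - p) else 0)" for i
  proof (cases "p \<le> a i \<and> a i < p + int G + 1")
    case True
    then have "(\<Sum>l\<in>{..G}. 2 ^ l * (c i * of_bool (a i = p + int l))) =
        (\<Sum>l\<in>{..G}. if l = nat (a i - p) then 2 ^ l * c i else 0)"
      by (intro sum.cong) auto
    also have "\<dots> = c i * 2 ^ nat (a i - p)"
      using True by (simp add: mult.commute) linarith
    finally show ?thesis using True by simp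
  next
    case False
    then show ?thesis by (auto intro!: sum.neutral)
  qed
  moreover have "nat (p + int G + 1 - p) = G + 1" by simp
  ultimately show ?thesis
    using tail_split[of p "p + int G + 1" I a c] by (simp add: window_def)
qed

text \<open>Terms above the window contribute a multiple of \<open>2 ^ (G + 1)\<close>, so window
  and value agree modulo that number.\<close>

lemma srem_window:
  assumes "\<bar>tail I a c p\<bar> < B" "B \<le> 2 ^ G"
  shows "srem G (window G I a c p) = tail I a c p"
proof -
  let ?T = "tail I a c p"
  have "(window G I a c p + 2 ^ G) mod 2 ^ (G + 1) = (?T + 2 ^ G) mod 2 ^ (G + 1)"
    using tail_window[of I a c p G] by (simp add: mod_eq_dvd_iff)
  also have "\<dots> = ?T + 2 ^ G"
    using assms by (intro mod_pos_pos_trivial) auto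
  finally show ?thesis by (simp add: srem_def)
qed

lemma overflow_eq_tail:
  assumes "\<bar>tail I a c (p + 1)\<bar> < B" "B \<le> 2 ^ G"
  shows "overflow G I a c p = tail I a c p"
  using srem_window[OF assms] tail_Suc[of I a c p] by (simp add: overflow_def)

lemma tail_below:
  assumes "\<And>i. i \<in> I \<Longrightarrow> q \<le> a i"
  shows "tail I a c (q - int k) = 2 ^ k * tail I a c q"
proof -
  have "(\<Sum>i\<in>I. if q - int k \<le> a i \<and> a i < q then c i * 2 ^ nat (a i - (q - int k)) else 0) = 0"
    using assms by (intro sum.neutral) force
  then show ?thesis using tail_split[of "q - int k" q I a c] by simp
qed

text \<open>A nonzero value doubles at each step below position 0 and so reaches \<open>B\<close> by
  position \<open>- G\<close>. The highest position with modulus at least \<open>B\<close> has a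
  term at most \<open>G\<close> places above it: an empty stretch from \<open>p\<close> to
  \<open>p + G\<close> would make the value at \<open>p + 1\<close> a multiple of
  \<open>2 ^ G\<close> of modulus below \<open>B\<close>, hence 0, and then also the value at
  \<open>p\<close>. Thus a circuit has only polynomially many positions to try.\<close>

lemma ex_top_overflow:
  assumes "finite I" "0 < B" "B \<le> 2 ^ G" and a: "\<And>i. i \<in> I \<Longrightarrow> 0 \<le> a i" and "tail I a c 0 \<noteq> 0"
  obtains p where "B \<le> \<bar>tail I a c p\<bar>" "\<And>p'. p < p' \<Longrightarrow> \<bar>tail I a c p'\<bar> < B"
    "\<exists>i\<in>I. \<exists>j\<in>{..G}. c i \<noteq> 0 \<and> p = a i - int j"
proof -
  let ?T = "tail I a c"
  \<comment> \<open>A common upper bound of the exponents that needs no case distinction for empty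
    \<open>I\<close>.\<close>
  define m where "m = (\<Sum>i\<in>I. a i)"
  have m: "a i \<le> m" if "i \<in> I" for i
    using member_le_sum[of i I a] that assms(1) a by (auto simp: m_def)
  have zero: "?T p = 0" if "m < p" for p
    using that m by (fastforce simp: tail_def intro!: sum.neutral)
  let ?S = "{p. - int G \<le> p \<and> p \<le> m \<and> B \<le> \<bar>?T p\<bar>}"
  have T: "B \<le> \<bar>?T (- int G)\<bar>"
  proof -
    have "?T (- int G) = 2 ^ G * ?T 0"
      using tail_below[of I 0 a c G] a by simp
    moreover have "(2 :: int) ^ G * 1 \<le> \<bar>2 ^ G\<bar> * \<bar>?T 0\<bar>"
      using assms(5) by (intro mult_mono) auto
    ultimately show ?thesis using assms(3) by (simp only: abs_mult)
  qed
  then have "- int G \<in> ?S"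
    using zero[of "- int G"] assms(2) by force
  moreover have fin: "finite ?S"
    by (rule finite_subset[of _ "{- int G..m}"]) auto
  ultimately have "Max ?S \<in> ?S" by (intro Max_in) auto
  define p where "p = Max ?S"
  have p: "- int G \<le> p" "B \<le> \<bar>?T p\<bar>" using \<open>Max ?S \<in> ?S\<close> by (auto simp: p_def)
  have above: "\<bar>?T p'\<bar> < B" if "p < p'" for p'
  proof (rule ccontr)
    assume "\<not> \<bar>?T p'\<bar> < B"
    then have "p' \<in> ?S" using that p(1) zero[of p'] assms(2) by force
    then show False using that Max_ge[OF fin] unfolding p_def by fastforce
  qed
  have "\<exists>i\<in>I. \<exists>j\<in>{..G}. c i \<noteq> 0 \<and> p = a i - int j"
  proof (rule ccontr)
    assume "\<not> ?thesis"
    then have *: "c i = 0 \<or> \<not> (p \<le> a i \<and> a i \<le> p + int G)" if "i \<in> I" for i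
      using that by (auto dest!: bspec[of _ _ i] bspec[of _ _ "nat (a i - p)"])
    let ?r = "p + int G + 1"
    have rest: "(\<Sum>i\<in>I. if q \<le> a i \<and> a i < ?r then c i * 2 ^ nat (a i - q) else 0) = 0"
      if "p \<le> q" for q
      using * that by (intro sum.neutral) fastforce
    have "?T (p + 1) = 2 ^ G * ?T ?r"
      using tail_split[of "p + 1" ?r I a c] rest[of "p + 1"] by simp
    then have "2 ^ G * \<bar>?T ?r\<bar> < B"
      using above[of "p + 1"] by (simp add: abs_mult)
    then have "2 ^ G * \<bar>?T ?r\<bar> < 2 ^ G * 1" using assms(3) by linarith
    then have "\<bar>?T ?r\<bar> < 1" by (rule mult_left_less_imp_less) simp
    then have "?T ?r = 0" by simp
    then have "?T p = 0"
      using tail_split[of p ?r I a c] rest[of p] by simp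
    then show False using p assms(2) by simp
  qed
  with p above show ?thesis using that by blast
qed

text \<open>Read from the top, the running value of the sum is known from a window of \<open>G + 1\<close> positions
  as long as it is small; the sign is decided at the highest position where it ceases to be.\<close>

theorem sum_pos_iff_overflow:
  assumes "finite I" and B: "(\<Sum>i\<in>I. \<bar>c i\<bar>) < B" "B \<le> 2 ^ G"
    and a: "\<And>i. i \<in> I \<Longrightarrow> 0 \<le> a i"
  shows "0 < (\<Sum>i\<in>I. c i * 2 ^ nat (a i)) \<longleftrightarrow>
    (\<exists>i\<in>I. \<exists>j\<in>{..G}. c i \<noteq> 0 \<and> B \<le> overflow G I a c (a i - int j) \<and>
      (\<forall>i'\<in>I. \<forall>j'\<in>{..G}. c i' \<noteq> 0 \<longrightarrow> a i - int j < a i' - int j' \<longrightarrow>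
         \<bar>overflow G I a c (a i' - int j')\<bar> < B))"
    (is "_ \<longleftrightarrow> ?R")
proof -
  let ?T = "tail I a c" and ?o = "overflow G I a c"
  have T0: "(\<Sum>i\<in>I. c i * 2 ^ nat (a i)) = ?T 0"
    using a by (auto simp: tail_def intro!: sum.cong)
  have B0: "0 < B" using sum_nonneg[of I "\<lambda>i. \<bar>c i\<bar>", OF abs_ge_zero] B(1) by linarith
  \<comment> \<open>At negative positions, proportionality to the value at 0 replaces the
    persistence argument.\<close>
  have persist: "0 < ?T 0" if "B \<le> ?T p" for p
  proof (cases "0 \<le> p")
    case True
    then show ?thesis using tail_persistent(1)[OF assms(1) B(1)] that by blast
  next
    case False
    then have "?T p = 2 ^ nat (- p) * ?T 0"
      using tail_below[of I 0 a c "nat (- p)"] a by simp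
    then show ?thesis using that B0 by (metis not_le order.strict_trans1 zero_less_mult_pos zero_less_numeral zero_less_power)
  qed
  show ?thesis
  proof (cases "?T 0 = 0")
    case True
    have small: "\<bar>?T p\<bar> < B" for p
    proof (cases "0 \<le> p")
      case True
      then show ?thesis
        using tail_persistent[OF assms(1) B(1) True, of a] \<open>?T 0 = 0\<close> by force
    next
      case False
      then show ?thesis
        using tail_below[of I 0 a c "nat (- p)"] a \<open>?T 0 = 0\<close> B0 by simp
    qed
    then have "\<bar>?o p\<bar> < B" for p
      using overflow_eq_tail[OF small B(2)] by metis
    then have "\<not> B \<le> ?o p" for p by (metis abs_ge_self not_le order.strict_trans1)
    then have "\<not> ?R" by blast
    then show ?thesis using T0 True by simp
  next
    case False
    obtain p where p: "B \<le> \<bar>?T p\<bar>" "\<And>p'. p < p' \<Longrightarrow> \<bar>?T p'\<bar> < B"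
      "\<exists>i\<in>I. \<exists>j\<in>{..G}. c i \<noteq> 0 \<and> p = a i - int j"
      using ex_top_overflow[OF assms(1) B0 B(2) a False] by blast
    have o: "?o p' = ?T p'" if "p \<le> p'" for p'
      using overflow_eq_tail[OF p(2) B(2)] that by simp
    show ?thesis
    proof
      assume "0 < (\<Sum>i\<in>I. c i * 2 ^ nat (a i))"
      then have "0 < ?T 0" using T0 by simp
      have "\<not> ?T p \<le> - B"
      proof
        assume "?T p \<le> - B"
        have "0 \<le> p \<or> ?T p = 2 ^ nat (- p) * ?T 0"
          using tail_below[of I 0 a c "nat (- p)"] a by (cases "0 \<le> p") auto
        then show False
          using tail_persistent(2)[OF assms(1) B(1) _ \<open>?T p \<le> - B\<close>, of 0] \<open>0 < ?T 0\<close> \<open>?T p \<le> - B\<close> B0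
          by (smt (verit) zero_less_mult_iff zero_less_power)
      qed
      then have "B \<le> ?T p" using p(1) by linarith
      then show ?R using p o by (metis less_imp_le order_refl)
    next
      assume ?R
      then obtain i j where ij: "i \<in> I" "j \<in> {..G}" "B \<le> ?o (a i - int j)"
        and top: "\<And>i' j'. i' \<in> I \<Longrightarrow> j' \<in> {..G} \<Longrightarrow> c i' \<noteq> 0 \<Longrightarrow> a i - int j < a i' - int j' \<Longrightarrow>
          \<bar>?o (a i' - int j')\<bar> < B"
        by blast
      \<comment> \<open>Below \<open>p\<close> the computed values may be wrong, but then
        \<open>p\<close> is itself a higher candidate and violates \<open>top\<close>.\<close>
      have "p \<le> a i - int j"
        using p(1,3) top o[of p] by force
      then have "B \<le> ?T (a i - int j)" using o ij by simp
      then show "0 < (\<Sum>i\<in>I. c i * 2 ^ nat (a i))" using persist T0 by simp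
    qed
  qed
qed

section \<open>Non-adjacent form\<close>

text \<open>The non-adjacent form of \<open>X = (3 X - X) / 2\<close> results from subtracting bit by bit, without borrows.\<close>

definition naf :: "int \<Rightarrow> nat \<Rightarrow> int" where
  "naf X p = 3 * X div 2 ^ (p + 1) mod 2 - X div 2 ^ (p + 1) mod 2"

text \<open>With \<open>F = 3 * X div 2 ^ (p + 1)\<close> also
  \<open>X div 2 ^ (p + 1) = F div 3\<close>, so both bits in the definition are functions of
  \<open>F mod 6\<close>.\<close>

lemma naf_cases:
  "naf X p = (let F = 3 * X div 2 ^ (p + 1) mod 6 in if F = 1 then 1 else if F = 4 then -1 else 0)"
proof -
  define F where "F = 3 * X div 2 ^ (p + 1)"
  have "F div 3 = X div 2 ^ (p + 1)"
    unfolding F_def by (simp add: zdiv_zmult2_eq[symmetric] mult.commute[of _ 3])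
  then have "naf X p = F mod 2 - F div 3 mod 2"
    by (simp add: naf_def F_def)
  also have "\<dots> = (let F = F mod 6 in if F = 1 then 1 else if F = 4 then -1 else 0)"
  proof -
    define k r where "k = F div 6" and "r = F mod 6"
    then have F: "F = 6 * k + r" "r \<in> {0..<6}" by simp_all
    have "F div 3 = 2 * k + r div 3" "F mod 2 = r mod 2"
      using F(1) by presburger+
    then have "F mod 2 - F div 3 mod 2 = r mod 2 - r div 3 mod 2" by simp
    moreover have "r \<in> {0, 1, 2, 3, 4, 5}" using F(2) by auto
    ultimately show ?thesis unfolding r_def[symmetric] Let_def by auto
  qed
  finally show ?thesis by (simp add: F_def)
qed

lemma naf_range: "naf X p \<in> {-1, 0, 1}"
  by (auto simp: naf_cases Let_def)

text \<open>A telescoping sum. The bits start at position 1 and are moved down by one place, which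
  is the halving in \<open>(3 X - X) / 2\<close>.\<close>

lemma sum_bits: "(\<Sum>p<L. X div 2 ^ (p + 1) mod 2 * 2 ^ p) = X div 2 - 2 ^ L * (X div 2 ^ (L + 1))"
  for X :: int
proof (induction L)
  case (Suc L)
  have "X div 2 ^ (L + 1) div 2 = X div 2 ^ (Suc L + 1)"
    by (simp add: zdiv_zmult2_eq[symmetric] ac_simps)
  then have "X div 2 ^ (L + 1) mod 2 = X div 2 ^ (L + 1) - 2 * (X div 2 ^ (Suc L + 1))"
    by (metis minus_mult_div_eq_mod)
  then show ?case
    by (simp only: sum.lessThan_Suc Suc) (simp add: algebra_simps)
qed simp

lemma div_power_large:
  fixes X :: int
  assumes "\<bar>X\<bar> < 2 ^ L"
  shows "X div 2 ^ L = (if X < 0 then -1 else 0)"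
proof (cases "X < 0")
  case True
  have "X div 2 ^ L = -1"
    by (rule int_div_pos_eq[where r = "X + 2 ^ L"]) (use assms True in auto)
  then show ?thesis using True by simp
next
  case False
  then show ?thesis using assms by simp
qed

lemma sum_naf:
  assumes "3 * \<bar>X\<bar> < 2 ^ L"
  shows "(\<Sum>p<L. naf X p * 2 ^ p) = X"
proof -
  have "(\<Sum>p<L. naf X p * 2 ^ p) =
      (\<Sum>p<L. 3 * X div 2 ^ (p + 1) mod 2 * 2 ^ p) - (\<Sum>p<L. X div 2 ^ (p + 1) mod 2 * 2 ^ p)"
    by (simp add: naf_def sum_subtractf[symmetric] left_diff_distrib)
  also have "\<dots> = 3 * X div 2 - X div 2 -
      2 ^ L * (3 * X div 2 ^ (L + 1) - X div 2 ^ (L + 1))"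
    by (simp only: sum_bits) (simp add: algebra_simps)
  \<comment> \<open>Beyond the top digits both quotients are 0 or -1 according to the sign of
    \<open>X\<close>, so the two truncation errors cancel.\<close>
  also have "3 * X div 2 ^ (L + 1) = X div 2 ^ (L + 1)"
    using assms by (subst (1 2) div_power_large) (auto simp: abs_mult)
  also have "3 * X div 2 - X div 2 = X" by presburger
  finally show ?thesis by simp
qed

text \<open>Passing from \<open>p\<close> to \<open>Suc p\<close> halves \<open>F\<close>: residue 1
  modulo 6 leads to 0 or 3 and residue 4 leads to 2 or 5, none of which gives a nonzero
  digit.\<close>

lemma naf_nonadjacent: "naf X p \<noteq> 0 \<Longrightarrow> naf X (Suc p) = 0"
proof -
  assume nz: "naf X p \<noteq> 0"
  define F where "F = 3 * X div 2 ^ (p + 1)"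
  have "3 * X div 2 ^ (Suc p + 1) = F div 2"
    by (simp add: F_def zdiv_zmult2_eq[symmetric] mult.commute)
  moreover have "F mod 6 = 1 \<or> F mod 6 = 4"
    using nz by (auto simp: naf_cases Let_def F_def split: if_splits)
  then have "F div 2 mod 6 \<noteq> 1" "F div 2 mod 6 \<noteq> 4" by presburger+
  ultimately show ?thesis by (simp add: naf_cases)
qed

lemma naf_bound:
  assumes "naf X p \<noteq> 0"
  shows "2 ^ (p + 1) \<le> 3 * \<bar>X\<bar>"
proof (rule ccontr)
  assume "\<not> ?thesis"
  then have "\<bar>3 * X\<bar> < 2 ^ (p + 1)" by (simp add: abs_mult)
  from div_power_large[OF this] have "naf X p = 0"
    by (auto simp: naf_cases Let_def)
  then show False using assms by simp
qed

text \<open>This will make the constructed circuits acyclic: successors of the node with exponent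
  \<open>e\<close> have smaller exponents. A digit at \<open>p\<close> forces
  \<open>2 ^ (p + 1) \<le> 3 * e\<close>, impossible for \<open>p \<ge> e\<close>.\<close>

lemma naf_less:
  assumes "naf (int e) p \<noteq> 0"
  shows "p < e"
proof (rule ccontr)
  assume "\<not> p < e"
  have less: "3 * k < 2 ^ (k + 1)" if "k \<noteq> 1" for k :: nat
    using that
  proof (induction k)
    case (Suc k)
    show ?case
    proof (cases "k \<le> 1")
      case True
      then show ?thesis using Suc by (auto simp: le_Suc_eq)
    next
      case False
      then have "2 ^ (1 + 1) \<le> (2::nat) ^ (k + 1)" by (intro power_increasing) auto
      then show ?thesis using Suc False by simp
    qed
  qed simp
  have "2 ^ (p + 1) \<le> 3 * e"
    using naf_bound[OF assms] by (metis abs_of_nat of_nat_le_iff of_nat_mult of_nat_numeral of_nat_power)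
  moreover have "(2::nat) ^ (e + 1) \<le> 2 ^ (p + 1)"
    using \<open>\<not> p < e\<close> by (intro power_increasing) auto
  ultimately have "e = 1" using less[of e] by linarith
  then show False using \<open>2 ^ (p + 1) \<le> 3 * e\<close> \<open>\<not> p < e\<close>
    using power_increasing[of 2 "p + 1" "2::nat"] by simp
qed

section \<open>Closure rules for circuits of polynomial size and constant depth\<close>

text \<open>With all sizes measured in powers of a fixed base \<open>N\<close>, a single exponent bounds both the
  number of gates and the depth.\<close>

locale size_base =
  fixes N :: nat
  assumes N: "2 \<le> N"
begin

definition hf :: "nat \<Rightarrow> (('w \<Rightarrow> bool) \<Rightarrow> bool) \<Rightarrow> bool" where
  "hf c f \<longleftrightarrow> realizes (N ^ c) c f"

lemma N_power_mono: "c \<le> c' \<Longrightarrow> N ^ c \<le> N ^ c'"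
  using N by (intro power_increasing) auto

lemma N_power_ge1: "1 \<le> N ^ c"
  using N by simp

lemma hf_mono: "hf c f \<Longrightarrow> c \<le> c' \<Longrightarrow> hf c' f"
  unfolding hf_def by (erule realizes_mono) (auto intro: N_power_mono)

lemma N_power_add1: "2 * N ^ c \<le> N ^ (c + 1)"
  using N by simp

lemma hf_wire: "hf 1 (\<lambda>v. v w)"
  unfolding hf_def by (rule realizes_mono[OF realizes_wire]) (use N in auto)

lemma hf_const: "hf 1 (\<lambda>v. b)"
  unfolding hf_def by (rule realizes_mono[OF realizes_const]) (use N in auto)

lemma hf_Not: "hf c f \<Longrightarrow> hf (c + 1) (\<lambda>v. \<not> f v)"
proof -
  assume "hf c f"
  moreover have "N ^ c + 1 \<le> N ^ (c + 1)"
    using N_power_add1[of c] N_power_ge1[of c] by linarith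
  ultimately show ?thesis
    unfolding hf_def by (intro realizes_mono[OF realizes_Not _ order_refl])
qed

lemma power_bound:
  assumes "k \<le> N ^ a"
  shows "k * N ^ c + 1 \<le> N ^ (a + c + 1)"
proof -
  have "k * N ^ c + 1 \<le> N ^ (a + c) + N ^ (a + c)"
    using mult_right_mono[OF assms, of "N ^ c"] N_power_ge1 by (intro add_mono) (auto simp: power_add)
  then show ?thesis using N_power_add1[of "a + c"] by linarith
qed

lemma hf_Ball_power:
  assumes "finite A" "card A \<le> N ^ a" "\<And>i. i \<in> A \<Longrightarrow> hf c (f i)"
  shows "hf (a + c + 1) (\<lambda>v. \<forall>i\<in>A. f i v)"
  unfolding hf_def
proof (rule realizes_mono)
  show "realizes (card A * N ^ c + 1) (c + 1) (\<lambda>v. \<forall> i\<in>A. f i v)"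
    using assms(3) unfolding hf_def by (rule realizes_Ball[OF assms(1)])
qed (use power_bound[OF assms(2)] in auto)

lemma hf_Bex_power:
  assumes "finite A" "card A \<le> N ^ a" "\<And>i. i \<in> A \<Longrightarrow> hf c (f i)"
  shows "hf (a + c + 1) (\<lambda>v. \<exists>i\<in>A. f i v)"
  unfolding hf_def
proof (rule realizes_mono)
  show "realizes (card A * N ^ c + 1) (c + 1) (\<lambda>v. \<exists> i\<in>A. f i v)"
    using assms(3) unfolding hf_def by (rule realizes_Bex[OF assms(1)])
qed (use power_bound[OF assms(2)] in auto)

lemma hf_Ball:
  assumes "finite A" "card A \<le> N" "\<And>i. i \<in> A \<Longrightarrow> hf c (f i)"
  shows "hf (c + 2) (\<lambda>v. \<forall>i\<in>A. f i v)"
  using hf_Ball_power[of A 1 c f] assms by simp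

lemma hf_Bex:
  assumes "finite A" "card A \<le> N" "\<And>i. i \<in> A \<Longrightarrow> hf c (f i)"
  shows "hf (c + 2) (\<lambda>v. \<exists>i\<in>A. f i v)"
  using hf_Bex_power[of A 1 c f] assms by simp

lemma hf_conj:
  assumes "hf c f" "hf c' g"
  shows "hf (max c c' + 2) (\<lambda>v. f v \<and> g v)"
proof -
  have "hf (max c c' + 2) (\<lambda>v. \<forall>b\<in>(UNIV :: bool set). (if b then f else g) v)"
  proof (rule hf_Ball)
    show "hf (max c c') (if b then f else g)" for b
      using hf_mono[OF assms(1), of "max c c'"] hf_mono[OF assms(2), of "max c c'"] by simp
  qed (use N in auto)
  moreover have "(\<forall>b\<in>UNIV. (if b then f else g) v) = (f v \<and> g v)" for v by auto
  ultimately show ?thesis by simp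
qed

lemma hf_disj:
  assumes "hf c f" "hf c' g"
  shows "hf (max c c' + 2) (\<lambda>v. f v \<or> g v)"
proof -
  have "hf (max c c' + 2) (\<lambda>v. \<exists>b\<in>(UNIV :: bool set). (if b then f else g) v)"
  proof (rule hf_Bex)
    show "hf (max c c') (if b then f else g)" for b
      using hf_mono[OF assms(1), of "max c c'"] hf_mono[OF assms(2), of "max c c'"] by simp
  qed (use N in auto)
  moreover have "(\<exists>b\<in>UNIV. (if b then f else g) v) = (f v \<or> g v)" for v by auto
  ultimately show ?thesis by simp
qed

lemma hf_imp:
  assumes "hf c f" "hf c' g"
  shows "hf (max (c + 1) c' + 2) (\<lambda>v. f v \<longrightarrow> g v)"
  using hf_disj[OF hf_Not[OF assms(1)] assms(2)] by (simp only: imp_conv_disj)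

text \<open>Integers of polynomial size are represented in unary, as the number of true wires minus
  a constant.\<close>

definition unary ::
  "nat \<Rightarrow> (('w \<Rightarrow> bool) \<Rightarrow> int) \<Rightarrow> nat \<Rightarrow> nat \<Rightarrow> (nat \<Rightarrow> ('w \<Rightarrow> bool) \<Rightarrow> bool) \<Rightarrow> bool" where
  "unary c X m k f \<longleftrightarrow> m \<le> N ^ c \<and> k \<le> N ^ c \<and> (\<forall>i < m. hf c (f i)) \<and>
     (\<forall>v. X v = int (card {i \<in> {..<m}. f i v}) - int k)"

definition hz :: "nat \<Rightarrow> (('w \<Rightarrow> bool) \<Rightarrow> int) \<Rightarrow> bool" where
  "hz c X \<longleftrightarrow> (\<exists>m k f. unary c X m k f)"

lemma unaryD:
  assumes "unary c X m k f"
  shows "m \<le> N ^ c" "k \<le> N ^ c" "i < m \<Longrightarrow> hf c (f i)"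
    "X v = int (card {i \<in> {..<m}. f i v}) - int k"
  using assms unfolding unary_def by blast+

text \<open>Frees the unary representation from indices below \<open>m\<close>; the arithmetic below
  uses disjoint unions and dependent pairs as index sets.\<close>

lemma hzI:
  assumes "finite J" "card J \<le> N ^ c" "k \<le> N ^ c" "\<And>j. j \<in> J \<Longrightarrow> hf c (f j)"
    "\<And>v. X v = int (card {j \<in> J. f j v}) - int k"
  shows "hz c X"
proof -
  obtain b where "bij_betw b {..<card J} J"
    using ex_bij_betw_nat_finite[OF assms(1)] by (auto simp: atLeast0LessThan)
  then have inj: "inj_on b {..<card J}" and J: "J = b ` {..<card J}"
    by (auto simp: bij_betw_def)
  have "card {j \<in> J. f j v} = card {i \<in> {..<card J}. f (b i) v}" for v
  proof -
    have "{j \<in> b ` {..<card J}. f j v} = b ` {i \<in> {..<card J}. f (b i) v}"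
      by blast
    then have "{j \<in> J. f j v} = b ` {i \<in> {..<card J}. f (b i) v}"
      by (simp only: J[symmetric])
    moreover have "inj_on b {i \<in> {..<card J}. f (b i) v}"
      using inj by (rule inj_on_subset) blast
    ultimately show ?thesis by (simp only: card_image)
  qed
  moreover have "hf c (f (b i))" if "i < card J" for i
  proof (rule assms(4))
    have "b i \<in> b ` {..<card J}" using that by blast
    then show "b i \<in> J" by (simp only: J[symmetric])
  qed
  ultimately have "unary c X (card J) k (\<lambda>i. f (b i))"
    using assms(2,3,5) by (simp add: unary_def)
  then show ?thesis unfolding hz_def by blast
qed

lemma hz_mono:
  assumes "hz c X" "c \<le> c'"
  shows "hz c' X"
proof -
  obtain m k f where "unary c X m k f"
    using assms(1) by (auto simp: hz_def)
  note X = unaryD[OF this]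
  show ?thesis
  proof (rule hzI[of "{..<m}" c' k f])
    show "card {..<m} \<le> N ^ c'" "k \<le> N ^ c'"
      using X(1,2) N_power_mono[OF assms(2)] by auto
  qed (use X(4) hf_mono[OF X(3) assms(2)] in auto)
qed

lemma hz_const:
  assumes "\<bar>z\<bar> \<le> int N"
  shows "hz 1 (\<lambda>v. z)"
  by (rule hzI[of "{..<nat z}" 1 "nat (- z)" "\<lambda>_ _. True"]) (use assms hf_const in auto)

lemma hz_of_bool:
  assumes "hf c f"
  shows "hz c (\<lambda>v. of_bool (f v))"
  by (rule hzI[of "{()}" c 0 "\<lambda>_. f"]) (use assms N_power_ge1 in auto)

text \<open>If \<open>X\<close> is \<open>x - k\<close> with \<open>x\<close> of \<open>m\<close>
  wires true, then \<open>- X\<close> is \<open>(m - x) + k - m\<close>: negate the wires, add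
  \<open>k\<close> constants \<open>True\<close>, and take \<open>m\<close> as the new
  offset.\<close>

lemma hz_uminus:
  assumes "hz c X"
  shows "hz (c + 1) (\<lambda>v. - X v)"
proof -
  obtain m k f where u: "unary c X m k f"
    using assms by (auto simp: hz_def)
  note X = unaryD[OF u]
  let ?J = "{..<m} <+> {..<k}" and ?f = "case_sum (\<lambda>i v. \<not> f i v) (\<lambda>_ _. True)"
  show ?thesis
  proof (rule hzI[of ?J "c + 1" m ?f])
    show "card ?J \<le> N ^ (c + 1)" "m \<le> N ^ (c + 1)"
      using X(1,2) N_power_add1[of c] by (auto simp: card_Plus simp del: power_Suc power_add)
    show "hf (c + 1) (?f j)" if "j \<in> ?J" for j
      using that hf_Not[OF X(3)] hf_mono[OF hf_const, of "c + 1"] by auto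
    fix v
    have "{j \<in> ?J. ?f j v} = ({..<m} - {i \<in> {..<m}. f i v}) <+> {..<k}"
      by auto
    then have "card {j \<in> ?J. ?f j v} = m - card {i \<in> {..<m}. f i v} + k"
      by (simp only: card_Plus finite_lessThan finite_Diff card_lessThan)
        (subst card_Diff_subset, auto)
    moreover have "card {i \<in> {..<m}. f i v} \<le> m"
      using card_mono[of "{..<m}" "{i \<in> {..<m}. f i v}"] by auto
    ultimately show "- X v = int (card {j \<in> ?J. ?f j v}) - int m"
      using X(4)[of v] by simp
  qed auto
qed

lemma hz_sum:
  assumes "finite A" "card A \<le> N" "\<And>a. a \<in> A \<Longrightarrow> hz c (X a)"
  shows "hz (c + 1) (\<lambda>v. \<Sum>a\<in>A. X a v)"
proof -
  have "\<exists>m k f. unary c (X a) m k f" if "a \<in> A" for a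
    using assms(3)[OF that] by (simp add: hz_def)
  then obtain m k f where "\<And>a. a \<in> A \<Longrightarrow> unary c (X a) (m a) (k a) (f a)"
    by metis
  note X = unaryD[OF this]
  let ?J = "SIGMA a:A. {..<m a}" and ?f = "\<lambda>(a, i). f a i"
  have bound: "(\<Sum>a\<in>A. h a) \<le> N ^ (c + 1)" if "\<And>a. a \<in> A \<Longrightarrow> h a \<le> N ^ c" for h
  proof -
    have "(\<Sum>a\<in>A. h a) \<le> card A * N ^ c" using sum_bounded_above[OF that] by simp
    also have "\<dots> \<le> N * N ^ c" using assms(2) by simp
    finally show ?thesis by simp
  qed
  show ?thesis
  proof (rule hzI[of ?J "c + 1" "\<Sum>a\<in>A. k a" ?f])
    show "card ?J \<le> N ^ (c + 1)" using bound[OF X(1)] assms(1) by simp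
    show "(\<Sum>a\<in>A. k a) \<le> N ^ (c + 1)" using bound[OF X(2)] .
    show "hf (c + 1) (?f j)" if "j \<in> ?J" for j
      using that hf_mono[OF X(3)] by auto
    fix v
    have "{j \<in> ?J. ?f j v} = (SIGMA a:A. {i \<in> {..<m a}. f a i v})" by auto
    then have "int (card {j \<in> ?J. ?f j v}) = (\<Sum>a\<in>A. int (card {i \<in> {..<m a}. f a i v}))"
      using assms(1) by simp
    then show "(\<Sum>a\<in>A. X a v) = int (card {j \<in> ?J. ?f j v}) - int (\<Sum>a\<in>A. k a)"
      using X(4) by (simp add: sum_subtractf)
  qed (use assms(1) in auto)
qed

lemma hz_add:
  assumes "hz c X" "hz c' Y"
  shows "hz (max c c' + 1) (\<lambda>v. X v + Y v)"
proof -
  have "hz (max c c' + 1) (\<lambda>v. \<Sum>b\<in>(UNIV :: bool set). (if b then X else Y) v)"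
  proof (rule hz_sum)
    show "hz (max c c') (if b then X else Y)" for b
      using hz_mono[OF assms(1), of "max c c'"] hz_mono[OF assms(2), of "max c c'"] by simp
  qed (use N in auto)
  then show ?thesis by (simp add: UNIV_bool add.commute)
qed

lemma hz_diff:
  assumes "hz c X" "hz c' Y"
  shows "hz (max c (c' + 1) + 1) (\<lambda>v. X v - Y v)"
  using hz_add[OF assms(1) hz_uminus[OF assms(2)]] by simp

text \<open>A false \<open>g\<close> must not only switch off the wires of \<open>X\<close> but also
  cancel the offset \<open>k\<close>; the \<open>k\<close> wires carrying the negation of
  \<open>g\<close> do this.\<close>

lemma hz_times_bool:
  assumes "hz c X" "hf c' g"
  shows "hz (max c c' + 2) (\<lambda>v. X v * of_bool (g v))"
proof -
  let ?c = "max c c'"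
  have g: "hf ?c g" using assms(2) hf_mono by fastforce
  have "hz ?c X" using assms(1) by (rule hz_mono) simp
  then obtain m k f where u: "unary ?c X m k f"
    by (auto simp: hz_def)
  note X = unaryD[OF u]
  let ?J = "{..<m} <+> {..<k}" and ?f = "case_sum (\<lambda>i v. f i v \<and> g v) (\<lambda>_ v. \<not> g v)"
  have le: "2 * N ^ ?c \<le> N ^ (?c + 2)"
    using N_power_add1[of ?c] N_power_mono[of "?c + 1" "?c + 2"] by linarith
  show ?thesis
  proof (rule hzI[of ?J "?c + 2" k ?f])
    show "card ?J \<le> N ^ (?c + 2)" "k \<le> N ^ (?c + 2)"
      using X(1,2) le by (auto simp: card_Plus simp del: power_Suc power_add power_add_numeral2)
    show "hf (?c + 2) (?f j)" if "j \<in> ?J" for j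
    proof (cases j)
      case (Inl i)
      then show ?thesis using that hf_conj[OF X(3) g] by auto
    next
      case (Inr i)
      have "hf (?c + 2) (\<lambda>v. \<not> g v)" by (rule hf_mono[OF hf_Not[OF g]]) linarith
      then show ?thesis using Inr by simp
    qed
    fix v
    have "{j \<in> ?J. ?f j v} = (if g v then Inl ` {i \<in> {..<m}. f i v} else Inr ` {..<k})"
      by auto
    then have "card {j \<in> ?J. ?f j v} = (if g v then card {i \<in> {..<m}. f i v} else k)"
      by (simp add: card_image)
    then show "X v * of_bool (g v) = int (card {j \<in> ?J. ?f j v}) - int k"
      using X(4)[of v] by simp
  qed auto
qed

lemma hz_scale:
  assumes "hz c X" "\<bar>z\<bar> \<le> int N"
  shows "hz (c + 2) (\<lambda>v. z * X v)"
proof -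
  have "hz (c + 1) (\<lambda>v. \<Sum>i<nat \<bar>z\<bar>. X v)"
    using assms by (intro hz_sum) auto
  from hz_mono[OF this, of "c + 2"] hz_uminus[OF this] show ?thesis
    by (cases "0 \<le> z") auto
qed

lemma hf_card_eq:
  assumes "m \<le> N ^ c" "\<And>i. i < m \<Longrightarrow> hf c (f i)" "1 \<le> c"
  shows "hf (2 * c + 6) (\<lambda>v. card {i \<in> {..<m :: nat}. f i v} = t)"
proof -
  have thr: "hf (2 * c + 3) (\<lambda>v. t \<le> card {i \<in> {..<m}. f i v})" for t
    unfolding hf_def
  proof (rule realizes_mono[OF realizes_threshold[of "{..<m}" "N ^ c" c f]])
    have "4 * (m * N ^ c) + 1 \<le> 4 * (N ^ c * N ^ c) + 4 * (N ^ c * N ^ c)"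
      using mult_right_mono[OF assms(1), of "N ^ c"] N_power_ge1[of "c + c"]
      by (intro add_mono) (auto simp: power_add)
    also have "\<dots> = 2 ^ 3 * N ^ (2 * c)" by (simp add: power_add mult_2)
    also have "\<dots> \<le> N ^ 3 * N ^ (2 * c)"
      using N by (intro mult_right_mono power_mono) auto
    finally show "4 * card {..<m} * N ^ c + 1 \<le> N ^ (2 * c + 3)"
      by (simp add: power_add ac_simps)
  qed (use assms N_power_ge1 in \<open>auto simp: hf_def\<close>)
  have "hf (max (2 * c + 3) (2 * c + 3 + 1) + 2)
      (\<lambda>v. t \<le> card {i \<in> {..<m}. f i v} \<and> \<not> t + 1 \<le> card {i \<in> {..<m}. f i v})"
    by (intro hf_conj hf_Not thr)
  moreover have "(t \<le> x \<and> \<not> t + 1 \<le> x) = (x = t)" for x by auto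
  ultimately show ?thesis by (simp add: add.commute)
qed

text \<open>A unary integer takes polynomially many values, so any predicate is a disjunction of
  equality tests. Operations such as remainders never have to be built from gates.\<close>

lemma hf_pred:
  assumes "hz c X" "1 \<le> c"
  shows "hf (3 * c + 8) (\<lambda>v. P (X v))"
proof -
  obtain m k f where u: "unary c X m k f"
    using assms(1) by (auto simp: hz_def)
  note X = unaryD[OF u]
  let ?T = "{t. t \<le> m \<and> P (int t - int k)}"
  have "card ?T \<le> m + 1"
    using card_mono[of "{..m}" ?T] by auto
  also have "\<dots> \<le> N ^ (c + 1)"
    using X(1) N_power_add1[of c] N_power_ge1[of c] by linarith
  finally have "hf ((c + 1) + (2 * c + 6) + 1) (\<lambda>v. \<exists>t\<in>?T. card {i \<in> {..<m}. f i v} = t)"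
    by (intro hf_Bex_power hf_card_eq X assms(2)) auto
  moreover have "(\<exists>t\<in>?T. card {i \<in> {..<m}. f i v} = t) = P (X v)" for v
    using X(4)[of v] card_mono[of "{..<m}" "{i \<in> {..<m}. f i v}"] by auto
  ultimately show ?thesis by (simp add: numeral_eq_Suc)
qed

lemma hz_range:
  assumes "hz c X"
  shows "X v \<in> {- int (N ^ c)..int (N ^ c)}"
proof -
  obtain m k f where u: "unary c X m k f"
    using assms by (auto simp: hz_def)
  note X = unaryD[OF u]
  have "card {i \<in> {..<m}. f i v} \<le> m"
    using card_mono[of "{..<m}" "{i \<in> {..<m}. f i v}"] by auto
  then have "card {i \<in> {..<m}. f i v} \<le> N ^ c" using X(1) by linarith
  then have "int (card {i \<in> {..<m}. f i v}) \<le> int (N ^ c)" "int k \<le> int (N ^ c)"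
    using X(2) by (auto simp only: of_nat_le_iff)
  then show ?thesis unfolding X(4)[of v] atLeastAtMost_iff by linarith
qed

lemma hf_pred2:
  assumes "hz c X" "hz c Y" "1 \<le> c"
  shows "hf (4 * c + 13) (\<lambda>v. P (X v) (Y v))"
proof -
  let ?T = "{- int (N ^ c)..int (N ^ c)}"
  have "card ?T = 2 * N ^ c + 1" by (simp del: of_nat_power)
  also have "\<dots> \<le> 2 * N ^ (c + 1)" using N_power_add1[of c] N_power_ge1[of c] by linarith
  also have "\<dots> \<le> N ^ (c + 2)" using N_power_add1[of "c + 1"] by simp
  finally have "hf ((c + 2) + (max (3 * c + 8) (3 * c + 8) + 2) + 1) (\<lambda>v. \<exists>t\<in>?T. X v = t \<and> P t (Y v))"
    by (intro hf_Bex_power hf_conj hf_pred assms) auto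
  moreover have "(\<exists>t\<in>?T. X v = t \<and> P t (Y v)) = P (X v) (Y v)" for v
    using hz_range[OF assms(1), of v] by auto
  ultimately show ?thesis by (simp add: numeral_eq_Suc)
qed

end

section \<open>Comparing exponents by circuits\<close>

text \<open>The wire \<open>Le Q R k\<close> is to carry the truth value of \<open>a Q + k \<le> a R\<close>, where \<open>a\<close> denotes the
  exponents of the nodes. A pair \<open>(Q, j)\<close> stands for the position \<open>a Q + j\<close>.\<close>

datatype wire = In nat | Le nat nat int

definition pval :: "(nat \<Rightarrow> int) \<Rightarrow> nat \<times> int \<Rightarrow> int" where
  "pval a p = a (fst p) + snd p"

definition shift :: "nat \<times> int \<Rightarrow> int \<Rightarrow> nat \<times> int" where
  "shift p k = (fst p, snd p + k)"

definition ple :: "(wire \<Rightarrow> bool) \<Rightarrow> nat \<times> int \<Rightarrow> nat \<times> int \<Rightarrow> bool" where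
  "ple v p q \<longleftrightarrow> v (Le (fst p) (fst q) (snd p - snd q))"

definition peq :: "(wire \<Rightarrow> bool) \<Rightarrow> nat \<times> int \<Rightarrow> nat \<times> int \<Rightarrow> bool" where
  "peq v p q \<longleftrightarrow> ple v p q \<and> ple v q p"

text \<open>\<open>goverflow\<close> and \<open>gpos\<close> are \<open>overflow\<close> and the
  criterion of \<open>sum_pos_iff_overflow\<close> with every comparison of positions replaced by
  wires. The window begins at \<open>p + 1\<close>, hence the shifts by
  \<open>1 + int l\<close>.\<close>

definition goverflow ::
  "nat \<Rightarrow> 'i set \<Rightarrow> ('i \<Rightarrow> nat \<times> int) \<Rightarrow> (wire \<Rightarrow> bool) \<Rightarrow> ('i \<Rightarrow> int) \<Rightarrow> nat \<times> int \<Rightarrow> int" where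
  "goverflow G I ps v c p =
     2 * srem G (\<Sum>i\<in>I. \<Sum>l\<in>{..G}. 2 ^ l * (c i * of_bool (peq v (ps i) (shift p (1 + int l))))) +
     (\<Sum>i\<in>I. c i * of_bool (peq v (ps i) p))"

definition gpos ::
  "nat \<Rightarrow> int \<Rightarrow> 'i set \<Rightarrow> ('i \<Rightarrow> nat \<times> int) \<Rightarrow> (wire \<Rightarrow> bool) \<Rightarrow> ('i \<Rightarrow> int) \<Rightarrow> bool" where
  "gpos G B I ps v c \<longleftrightarrow>
     (\<exists>i\<in>I. \<exists>j\<in>{..G}. c i \<noteq> 0 \<and> B \<le> goverflow G I ps v c (shift (ps i) (- int j)) \<and>
      (\<forall>i'\<in>I. \<forall>j'\<in>{..G}. c i' \<noteq> 0 \<longrightarrow>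
        \<not> ple v (shift (ps i') (- int j')) (shift (ps i) (- int j)) \<longrightarrow>
         \<bar>goverflow G I ps v c (shift (ps i') (- int j'))\<bar> < B))"

definition exact_on :: "nat set \<Rightarrow> int \<Rightarrow> (nat \<Rightarrow> int) \<Rightarrow> (wire \<Rightarrow> bool) \<Rightarrow> bool" where
  "exact_on S K a v \<longleftrightarrow>
     (\<forall>Q\<in>S. \<forall>R\<in>S. \<forall>k. \<bar>k\<bar> \<le> K \<longrightarrow> v (Le Q R k) \<longleftrightarrow> a Q + k \<le> a R)"

lemma ple_iff:
  assumes "exact_on S K a v" "fst p \<in> S" "fst q \<in> S" "\<bar>snd p - snd q\<bar> \<le> K"
  shows "ple v p q \<longleftrightarrow> pval a p \<le> pval a q"
  using assms by (force simp: exact_on_def ple_def pval_def)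

lemma peq_iff:
  assumes "exact_on S K a v" "fst p \<in> S" "fst q \<in> S" "\<bar>snd p - snd q\<bar> \<le> K"
  shows "peq v p q \<longleftrightarrow> pval a p = pval a q"
  using ple_iff[OF assms] ple_iff[OF assms(1,3,2)] assms(4) by (auto simp: peq_def abs_minus_commute)

lemma pval_shift [simp]: "pval a (shift p k) = pval a p + k"
  by (simp add: pval_def shift_def)

lemma fst_shift [simp]: "fst (shift p k) = fst p"
  and snd_shift [simp]: "snd (shift p k) = snd p + k"
  by (simp_all add: shift_def)

text \<open>Only nodes with nonzero coefficient need exact comparisons, which is what lets a round
  build on the previous one. \<open>K\<close> leaves room for two labels of modulus at most
  \<open>J\<close> and for the shifts along the windows.\<close>

theorem gpos_iff:
  assumes fin: "finite I" and B: "(\<Sum>i\<in>I. \<bar>c i\<bar>) < B" "B \<le> 2 ^ G"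
    and ex: "exact_on S K a v"
    and ps: "\<And>i. i \<in> I \<Longrightarrow> c i \<noteq> 0 \<Longrightarrow> fst (ps i) \<in> S \<and> \<bar>snd (ps i)\<bar> \<le> J \<and> 0 \<le> pval a (ps i)"
    and K: "2 * J + 2 * int G + 1 \<le> K"
  shows "gpos G B I ps v c \<longleftrightarrow> 0 < (\<Sum>i\<in>I. c i * 2 ^ nat (pval a (ps i)))"
proof -
  \<comment> \<open>nodes with coefficient 0 may be ones whose exponents are not known yet\<close>
  define b where "b i = (if c i = 0 then 0 else pval a (ps i))" for i
  have over: "goverflow G I ps v c (shift (ps i) (- int j)) = overflow G I b c (b i - int j)"
    if i: "i \<in> I" "c i \<noteq> 0" "j \<in> {..G}" for i j
  proof -
    let ?p = "shift (ps i) (- int j)"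
    have eq: "c i' * of_bool (peq v (ps i') (shift ?p k)) = c i' * of_bool (b i' = b i - int j + k)"
      if "i' \<in> I" "0 \<le> k" "k \<le> int G + 1" for i' k
    proof (cases "c i' = 0")
      case False
      have "\<bar>snd (ps i') - snd (shift ?p k)\<bar> \<le> K"
        using ps[OF that(1) False] ps[OF i(1,2)] that(2,3) i(3) K by auto
      then have "peq v (ps i') (shift ?p k) \<longleftrightarrow> pval a (ps i') = pval a (shift ?p k)"
        using ps[OF that(1) False] ps[OF i(1,2)] by (intro peq_iff[OF ex]) auto
      then show ?thesis using False i(2) by (simp add: b_def)
    qed simp
    have eq0: "c i' * of_bool (peq v (ps i') ?p) = c i' * of_bool (b i' = b i - int j)"
      if "i' \<in> I" for i'
      using eq[OF that, of 0] by (simp add: shift_def)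
    have eq1: "c i' * of_bool (peq v (ps i') (shift ?p (1 + int l))) =
        c i' * of_bool (b i' = b i - int j + 1 + int l)" if "i' \<in> I" "l \<in> {..G}" for i' l
      using eq[OF that(1), of "1 + int l"] that(2) by (simp add: add.assoc)
    show ?thesis
      unfolding goverflow_def overflow_def window_def digit_sum_def
      by (intro arg_cong2[of _ _ _ _ "(+)"] arg_cong2[of _ _ _ _ "(*)"] arg_cong[of _ _ "srem G"]
          sum.cong refl eq0 eq1)
  qed
  have ple: "ple v (shift (ps i') (- int j')) (shift (ps i) (- int j)) \<longleftrightarrow>
      b i' - int j' \<le> b i - int j"
    if "i \<in> I" "c i \<noteq> 0" "j \<in> {..G}" "i' \<in> I" "c i' \<noteq> 0" "j' \<in> {..G}" for i j i' j'
  proof -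
    have "\<bar>snd (shift (ps i') (- int j')) - snd (shift (ps i) (- int j))\<bar> \<le> K"
      using ps[OF that(1,2)] ps[OF that(4,5)] that(3,6) K by auto
    from ple_iff[OF ex _ _ this] show ?thesis
      using ps[OF that(1,2)] ps[OF that(4,5)] that(2,5) by (simp add: b_def)
  qed
  have "gpos G B I ps v c \<longleftrightarrow>
    (\<exists>i\<in>I. \<exists>j\<in>{..G}. c i \<noteq> 0 \<and> B \<le> overflow G I b c (b i - int j) \<and>
      (\<forall>i'\<in>I. \<forall>j'\<in>{..G}. c i' \<noteq> 0 \<longrightarrow> b i - int j < b i' - int j' \<longrightarrow>
         \<bar>overflow G I b c (b i' - int j')\<bar> < B))"
    unfolding gpos_def
    by (intro bex_cong refl conj_cong ball_cong imp_cong) (simp_all add: over ple not_le)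
  also have "\<dots> \<longleftrightarrow> 0 < (\<Sum>i\<in>I. c i * 2 ^ nat (b i))"
    using ps by (intro sum_pos_iff_overflow[symmetric] fin B) (auto simp: b_def)
  also have "(\<Sum>i\<in>I. c i * 2 ^ nat (b i)) = (\<Sum>i\<in>I. c i * 2 ^ nat (pval a (ps i)))"
    by (intro sum.cong) (auto simp: b_def)
  finally show ?thesis .
qed

section \<open>Circuit complexity of the sign test\<close>

context size_base
begin

lemma hf_ple: "hf 1 (\<lambda>v. ple v p q)"
  unfolding ple_def by (rule hf_wire)

lemma hf_peq: "hf 3 (\<lambda>v. peq v p q)"
  unfolding peq_def using hf_conj[OF hf_ple hf_ple, of p q q p] by (rule hf_mono) simp

text \<open>The window and the digit sum are both unary integers, the weights \<open>2 ^ l\<close>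
  being at most \<open>N\<close>; \<open>srem\<close> and the test \<open>P\<close> are absorbed
  into the predicate of \<open>hf_pred2\<close>.\<close>

lemma hf_goverflow:
  assumes I: "finite I" "card I \<le> N" and G: "2 ^ G \<le> N" "G + 1 \<le> N"
    and c: "\<And>i. i \<in> I \<Longrightarrow> hz e (\<lambda>v. c v i)" and e: "3 \<le> e"
  shows "hf (4 * e + 37) (\<lambda>v. P (goverflow G I ps v (c v) p))"
proof -
  have le: "hz (e + 2) (\<lambda>v. c v i * of_bool (peq v (ps i) q))" if "i \<in> I" for i q
    using hz_times_bool[OF c[OF that] hf_peq] e by (simp add: max_absorb1)
  have pow: "\<bar>2 ^ l\<bar> \<le> int N" if "l \<le> G" for l :: nat
  proof -
    have "(2::nat) ^ l \<le> N"
      using power_increasing[OF that, of "2::nat"] G(1) by linarith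
    then show ?thesis by (metis abs_of_nat of_nat_le_iff of_nat_numeral of_nat_power)
  qed
  have "hz (e + 2 + 2 + 1 + 1) (\<lambda>v. \<Sum>i\<in>I. \<Sum>l\<in>{..G}.
      2 ^ l * (c v i * of_bool (peq v (ps i) (shift p (1 + int l)))))"
    using pow by (intro hz_sum hz_scale le I) (use G in auto)
  moreover have "hz (e + 2 + 1) (\<lambda>v. \<Sum>i\<in>I. c v i * of_bool (peq v (ps i) p))"
    by (intro hz_sum le I)
  then have "hz (e + 2 + 2 + 1 + 1) (\<lambda>v. \<Sum>i\<in>I. c v i * of_bool (peq v (ps i) p))"
    by (rule hz_mono) simp
  ultimately have "hf (4 * (e + 2 + 2 + 1 + 1) + 13) (\<lambda>v. P (2 * srem G (\<Sum>i\<in>I. \<Sum>l\<in>{..G}.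
      2 ^ l * (c v i * of_bool (peq v (ps i) (shift p (1 + int l))))) +
      (\<Sum>i\<in>I. c v i * of_bool (peq v (ps i) p))))"
    by (rule hf_pred2) simp
  then show ?thesis unfolding goverflow_def by (rule hf_mono) simp
qed

lemma hf_gpos:
  assumes I: "finite I" "card I \<le> N" and G: "2 ^ G \<le> N" "G + 1 \<le> N"
    and c: "\<And>i. i \<in> I \<Longrightarrow> hz e (\<lambda>v. c v i)" and e: "3 \<le> e"
  shows "hf (4 * e + 53) (\<lambda>v. gpos G B I ps v (c v))"
proof -
  let ?o = "\<lambda>v i j. goverflow G I ps v (c v) (shift (ps i) (- int j))"
  have nz: "hf (3 * e + 8) (\<lambda>v. c v i \<noteq> 0)" if "i \<in> I" for i
    using c[OF that] e by (intro hf_pred) auto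
  have over: "hf (4 * e + 37) (\<lambda>v. P (?o v i j))" for P i j
    using assms by (rule hf_goverflow)
  have G': "finite {..G}" "card {..G} \<le> N" using G by auto
  have 1: "hf (4 * e + 45) (\<lambda>v. \<forall>i'\<in>I. \<forall>j'\<in>{..G}. c v i' \<noteq> 0 \<longrightarrow> \<not> ple v (p i' j') q \<longrightarrow>
      \<bar>?o v i' j'\<bar> < B)" for p q
  proof -
    have "hf (max (3 * e + 8 + 1) (max (1 + 1 + 1) (4 * e + 37) + 2) + 2 + 2 + 2)
      (\<lambda>v. \<forall>i'\<in>I. \<forall>j'\<in>{..G}. c v i' \<noteq> 0 \<longrightarrow> \<not> ple v (p i' j') q \<longrightarrow> \<bar>?o v i' j'\<bar> < B)"
      by (intro hf_Ball I G' hf_imp hf_Not nz hf_ple over)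
    then show ?thesis by (rule hf_mono) simp
  qed
  have "hf (max (3 * e + 8) (max (4 * e + 37) (4 * e + 45) + 2) + 2 + 2 + 2)
    (\<lambda>v. \<exists>i\<in>I. \<exists>j\<in>{..G}. c v i \<noteq> 0 \<and> B \<le> ?o v i j \<and> (\<forall>i'\<in>I. \<forall>j'\<in>{..G}. c v i' \<noteq> 0 \<longrightarrow>
        \<not> ple v (shift (ps i') (- int j')) (shift (ps i) (- int j)) \<longrightarrow> \<bar>?o v i' j'\<bar> < B))"
    by (intro hf_Bex I G' hf_conj nz over 1)
  then show ?thesis unfolding gpos_def by (rule hf_mono) simp
qed

end

subsection \<open>One round per level of the dag\<close>

text \<open>The pair 01, which encodes nothing, is read as 0, so coefficients have modulus at most 1
  under every assignment.\<close>

definition symbol :: "(wire \<Rightarrow> bool) \<Rightarrow> nat \<Rightarrow> int" where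
  "symbol v i = of_bool (v (In i)) - 2 * of_bool (v (In i) \<and> v (In (i + 1)))"

text \<open>Besides the \<open>n\<close> nodes of the given circuit there is a node number \<open>n\<close> of value 1.\<close>

definition succ_coeff :: "nat \<Rightarrow> (wire \<Rightarrow> bool) \<Rightarrow> nat \<Rightarrow> nat \<Rightarrow> int" where
  "succ_coeff n v Q S = (if Q < n \<and> S < n then symbol v (2 * n * Q + 2 * S) else 0)"

definition mark_coeff :: "nat \<Rightarrow> (wire \<Rightarrow> bool) \<Rightarrow> nat \<Rightarrow> int" where
  "mark_coeff n v S = (if S < n then symbol v (2 * n * n + 2 * S) else 0)"

text \<open>The coefficients of \<open>a Q + k\<close> for \<open>p = (Q, k)\<close>: node
  \<open>n\<close> has exponent 0, so \<open>k\<close> is \<open>k\<close> times its power of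
  two.\<close>

definition pos_coeff :: "nat \<Rightarrow> (wire \<Rightarrow> bool) \<Rightarrow> nat \<times> int \<Rightarrow> nat \<Rightarrow> int" where
  "pos_coeff n v p S = succ_coeff n v (fst p) S + (if S = n then snd p else 0)"

definition round_le :: "nat \<Rightarrow> nat \<Rightarrow> int \<Rightarrow> (wire \<Rightarrow> bool) \<Rightarrow> nat \<Rightarrow> nat \<Rightarrow> int \<Rightarrow> bool" where
  "round_le n G B v Q R k \<longleftrightarrow>
     \<not> gpos G B {..n} (\<lambda>S. (S, 0)) v (\<lambda>S. pos_coeff n v (Q, k) S - succ_coeff n v R S)"

definition exponents :: "nat \<Rightarrow> (nat \<Rightarrow> nat \<Rightarrow> int) \<Rightarrow> (nat \<Rightarrow> int) \<Rightarrow> bool" where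
  "exponents n \<delta> a \<longleftrightarrow> a n = 0 \<and> (\<forall>Q\<le>n. 0 \<le> a Q) \<and>
     (\<forall>Q<n. a Q = (\<Sum>S<n. \<delta> Q S * 2 ^ nat (a S)))"

lemma exponentsD:
  assumes "exponents n \<delta> a"
  shows "a n = 0" "Q \<le> n \<Longrightarrow> 0 \<le> a Q" "Q < n \<Longrightarrow> a Q = (\<Sum>S<n. \<delta> Q S * 2 ^ nat (a S))"
  using assms unfolding exponents_def by blast+

definition reads :: "nat \<Rightarrow> (nat \<Rightarrow> nat \<Rightarrow> int) \<Rightarrow> (nat \<Rightarrow> int) \<Rightarrow> (wire \<Rightarrow> bool) \<Rightarrow> bool" where
  "reads n \<delta> M v \<longleftrightarrow> (\<forall>Q<n. \<forall>S<n. succ_coeff n v Q S = \<delta> Q S) \<and> (\<forall>S<n. mark_coeff n v S = M S)"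

lemma abs_symbol: "\<bar>symbol v i\<bar> \<le> 1"
  by (auto simp: symbol_def)

lemma abs_succ_coeff: "\<bar>succ_coeff n v Q S\<bar> \<le> 1"
  using abs_symbol by (simp add: succ_coeff_def)

lemma abs_mark_coeff: "\<bar>mark_coeff n v S\<bar> \<le> 1"
  using abs_symbol by (simp add: mark_coeff_def)

lemma succ_coeff_last [simp]: "succ_coeff n v Q n = 0" "succ_coeff n v n S = 0"
  by (simp_all add: succ_coeff_def)

lemma sum_abs_succ_coeff: "(\<Sum>S\<le>n. \<bar>succ_coeff n v Q S\<bar>) \<le> int n"
  using sum_bounded_above[of "{..<n}" "\<lambda>S. \<bar>succ_coeff n v Q S\<bar>" 1] abs_succ_coeff
  by (simp flip: lessThan_Suc_atMost)

lemma sum_abs_mark_coeff: "(\<Sum>S\<le>n. \<bar>mark_coeff n v S\<bar>) \<le> int n"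
proof -
  have "mark_coeff n v n = 0" by (simp add: mark_coeff_def)
  then show ?thesis
    using sum_bounded_above[of "{..<n}" "\<lambda>S. \<bar>mark_coeff n v S\<bar>" 1] abs_mark_coeff
    by (simp flip: lessThan_Suc_atMost)
qed

lemma sum_abs_pos_coeff: "(\<Sum>S\<le>n. \<bar>pos_coeff n v p S\<bar>) \<le> int n + \<bar>snd p\<bar>"
proof -
  have "(\<Sum>S\<le>n. \<bar>pos_coeff n v p S\<bar>) \<le>
      (\<Sum>S\<le>n. \<bar>succ_coeff n v (fst p) S\<bar>) + (\<Sum>S\<le>n. if S = n then \<bar>snd p\<bar> else 0)"
    unfolding sum.distrib[symmetric] by (intro sum_mono) (auto simp: pos_coeff_def)
  then show ?thesis using sum_abs_succ_coeff[of n v "fst p"] by simp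
qed

lemma pval_eq_sum:
  assumes "exponents n \<delta> a" "reads n \<delta> M v" "fst p \<le> n"
  shows "(\<Sum>S\<le>n. pos_coeff n v p S * 2 ^ nat (a S)) = pval a p"
proof -
  have an: "a n = 0" by (rule exponentsD(1)[OF assms(1)])
  have "(\<Sum>S\<le>n. pos_coeff n v p S * 2 ^ nat (a S)) =
      (\<Sum>S<n. succ_coeff n v (fst p) S * 2 ^ nat (a S)) + snd p"
    by (simp add: an pos_coeff_def flip: lessThan_Suc_atMost)
  also have "(\<Sum>S<n. succ_coeff n v (fst p) S * 2 ^ nat (a S)) = a (fst p)"
  proof (cases "fst p = n")
    case True
    then show ?thesis by (simp add: an)
  next
    case False
    then have "fst p < n" using assms(3) by simp
    then have "a (fst p) = (\<Sum>S<n. \<delta> (fst p) S * 2 ^ nat (a S))"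
      by (rule exponentsD(3)[OF assms(1)])
    also have "\<dots> = (\<Sum>S<n. succ_coeff n v (fst p) S * 2 ^ nat (a S))"
      using assms(2) \<open>fst p < n\<close> by (intro sum.cong) (auto simp: reads_def)
    finally show ?thesis by simp
  qed
  finally show ?thesis by (simp add: pval_def)
qed

text \<open>The nodes of height less than \<open>t\<close>, together with \<open>n\<close>. Leaves
  enter only for \<open>t = 1\<close>, since round 0 guarantees comparisons for \<open>n\<close>
  alone.\<close>

fun known :: "nat \<Rightarrow> (nat \<Rightarrow> nat \<Rightarrow> int) \<Rightarrow> nat \<Rightarrow> nat set" where
  "known n \<delta> 0 = {n}"
| "known n \<delta> (Suc t) = insert n {Q. Q < n \<and> (\<forall>S<n. \<delta> Q S \<noteq> 0 \<longrightarrow> S \<in> known n \<delta> t)}"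

lemma known_subset: "known n \<delta> t \<subseteq> {..n}"
  by (cases t) auto

lemma last_in_known [simp]: "n \<in> known n \<delta> t"
  by (cases t) auto

text \<open>The coefficients of \<open>a Q + k - a R\<close> vanish outside \<open>n\<close> and the
  successors of \<open>Q\<close> and \<open>R\<close>, which are known one round earlier. Their
  moduli sum to at most \<open>2 * n + K\<close>, whence the bound on \<open>B\<close>.\<close>

lemma round_le_iff:
  assumes a: "exponents n \<delta> a" and v: "reads n \<delta> M v" and ex: "exact_on (known n \<delta> t) K a v"
    and K: "2 * int G + 1 \<le> K" and B: "2 * int n + K < B" "B \<le> 2 ^ G"
    and Q: "Q \<in> known n \<delta> (Suc t)" and R: "R \<in> known n \<delta> (Suc t)" and k: "\<bar>k\<bar> \<le> K"
  shows "round_le n G B v Q R k \<longleftrightarrow> a Q + k \<le> a R"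
proof -
  let ?c = "\<lambda>S. pos_coeff n v (Q, k) S - succ_coeff n v R S"
  have le: "Q \<le> n" "R \<le> n" using Q R known_subset by blast+
  have "(\<Sum>S\<le>n. \<bar>?c S\<bar>) \<le> (\<Sum>S\<le>n. \<bar>pos_coeff n v (Q, k) S\<bar>) + (\<Sum>S\<le>n. \<bar>succ_coeff n v R S\<bar>)"
    unfolding sum.distrib[symmetric] by (intro sum_mono) auto
  then have sum: "(\<Sum>S\<le>n. \<bar>?c S\<bar>) < B"
    using sum_abs_pos_coeff[of n v "(Q, k)"] sum_abs_succ_coeff[of n v R] B k by simp
  have known: "S \<in> known n \<delta> t" if "S \<le> n" "?c S \<noteq> 0" for S
  proof (cases "S = n")
    case False
    then have "S < n" using that by simp
    then have "succ_coeff n v Q S \<noteq> 0 \<or> succ_coeff n v R S \<noteq> 0"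
      using that(2) by (auto simp: pos_coeff_def)
    then have "Q < n \<and> \<delta> Q S \<noteq> 0 \<or> R < n \<and> \<delta> R S \<noteq> 0"
      using v \<open>S < n\<close> by (cases "Q < n"; cases "R < n") (auto simp: reads_def succ_coeff_def)
    then show ?thesis using Q R \<open>S < n\<close> by auto
  qed simp
  have "gpos G B {..n} (\<lambda>S. (S, 0)) v ?c \<longleftrightarrow> 0 < (\<Sum>S\<le>n. ?c S * 2 ^ nat (pval a (S, 0)))"
  proof (rule gpos_iff[OF _ sum B(2) ex, of _ 0])
    show "fst (S, 0::int) \<in> known n \<delta> t \<and> \<bar>snd (S, 0::int)\<bar> \<le> 0 \<and> 0 \<le> pval a (S, 0)"
      if "S \<in> {..n}" "?c S \<noteq> 0" for S
      using known[of S] that exponentsD(2)[OF a, of S] by (simp add: pval_def)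
  qed (use K in auto)
  also have "(\<Sum>S\<le>n. ?c S * 2 ^ nat (pval a (S, 0))) =
      (\<Sum>S\<le>n. pos_coeff n v (Q, k) S * 2 ^ nat (a S)) - (\<Sum>S\<le>n. pos_coeff n v (R, 0) S * 2 ^ nat (a S))"
    unfolding sum_subtractf[symmetric]
    by (intro sum.cong) (auto simp: pval_def pos_coeff_def left_diff_distrib)
  also have "\<dots> = a Q + k - a R"
    using pval_eq_sum[OF a v, of "(Q, k)"] pval_eq_sum[OF a v, of "(R, 0)"] le by (simp add: pval_def)
  finally show ?thesis by (auto simp: round_le_def)
qed

text \<open>A relation, since the circuit determines only input wires and comparisons with
  \<open>Q, R \<le> n\<close> and \<open>\<bar>k\<bar> \<le> K\<close>. The guess
  \<open>k \<le> 0\<close> of round 0 is right for \<open>Q = R = n\<close>, the only pair that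
  counts then.\<close>

fun after_rounds :: "nat \<Rightarrow> nat \<Rightarrow> int \<Rightarrow> int \<Rightarrow> nat \<Rightarrow> bool list \<Rightarrow> (wire \<Rightarrow> bool) \<Rightarrow> bool" where
  "after_rounds n G B K 0 x v \<longleftrightarrow> (\<forall>i<length x. v (In i) = x ! i) \<and>
     (\<forall>Q\<le>n. \<forall>R\<le>n. \<forall>k. \<bar>k\<bar> \<le> K \<longrightarrow> v (Le Q R k) = (k \<le> 0))"
| "after_rounds n G B K (Suc t) x v \<longleftrightarrow> (\<forall>i<length x. v (In i) = x ! i) \<and>
     (\<exists>u. after_rounds n G B K t x u \<and>
       (\<forall>Q\<le>n. \<forall>R\<le>n. \<forall>k. \<bar>k\<bar> \<le> K \<longrightarrow> v (Le Q R k) = round_le n G B u Q R k))"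

lemma after_rounds_inputs: "after_rounds n G B K t x v \<Longrightarrow> i < length x \<Longrightarrow> v (In i) = x ! i"
  by (cases t) auto

lemma concat_map_upt_nth:
  assumes "\<And>i. i < k \<Longrightarrow> length (f i) = l" "i < k" "j < l"
  shows "concat (map f [0..<k]) ! (l * i + j) = f i ! j"
  using assms(1,2)
proof (induction k)
  case (Suc k)
  have len: "length (concat (map f [0..<m])) = l * m" if "m \<le> k" for m
    using that Suc.prems(1) by (induction m) auto
  show ?case
  proof (cases "i = k")
    case True
    then show ?thesis using len[of k] by (simp add: nth_append)
  next
    case False
    then have "i < k" using Suc.prems(2) by simp
    have "l * i + j < l * (i + 1)" using assms(3) by simp
    also have "\<dots> \<le> l * k" using \<open>i < k\<close> by (intro mult_le_mono2) simp
    finally have "l * i + j < l * k" .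
    then show ?thesis using Suc \<open>i < k\<close> len[of k] by (simp add: nth_append)
  qed
qed simp

lemma encode_marking_nth:
  assumes "i < n"
  shows "encode_marking n M ! (2 * i) = (M i \<noteq> 0)" "encode_marking n M ! (2 * i + 1) = (M i < 0)"
  using concat_map_upt_nth[of n "\<lambda>i. encode_symbol (M i)" 2 i 0]
    concat_map_upt_nth[of n "\<lambda>i. encode_symbol (M i)" 2 i 1] assms
  by (simp_all add: encode_marking_def encode_symbol_def)

lemma encode_nth:
  assumes "j < 2 * n"
  shows "i < n \<Longrightarrow> encode n \<delta> M ! (2 * n * i + j) = encode_marking n (\<delta> i) ! j"
    and "encode n \<delta> M ! (2 * n * n + j) = encode_marking n M ! j"
proof -
  \<comment> \<open>The marking is laid out like one further row of the matrix, with number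
    \<open>n\<close>.\<close>
  have "encode n \<delta> M = concat (map (\<lambda>i. encode_marking n ((\<delta>(n := M)) i)) [0..<Suc n])"
  proof -
    have "map (\<lambda>i. encode_marking n ((\<delta>(n := M)) i)) [0..<n] = map (\<lambda>i. encode_marking n (\<delta> i)) [0..<n]"
      by (rule map_cong) auto
    then show ?thesis unfolding encode_def by (simp only: upt_Suc_append le0 map_append concat_append) simp
  qed
  then have "encode n \<delta> M ! (2 * n * i + j) = encode_marking n ((\<delta>(n := M)) i) ! j"
    if "i < Suc n" for i
    using concat_map_upt_nth[of "Suc n" "\<lambda>i. encode_marking n ((\<delta>(n := M)) i)" "2 * n" i j] that assms
    by (simp add: length_encode_marking del: upt_Suc)
  from this[of i] this[of n]
  show "i < n \<Longrightarrow> encode n \<delta> M ! (2 * n * i + j) = encode_marking n (\<delta> i) ! j"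
    and "encode n \<delta> M ! (2 * n * n + j) = encode_marking n M ! j"
    by auto
qed

lemma reads_encode:
  assumes \<delta>: "\<And>Q. Q < n \<Longrightarrow> marking {..<n} (\<delta> Q)" and M: "marking {..<n} M"
    and v: "\<And>i. i < length (encode n \<delta> M) \<Longrightarrow> v (In i) = encode n \<delta> M ! i"
  shows "reads n \<delta> M v"
proof -
  have less: "2 * n * Q + 2 * S + 1 < length (encode n \<delta> M)" if "Q \<le> n" "S < n" for Q S
  proof -
    have "2 * n * Q \<le> 2 * n * n" using that by (intro mult_le_mono2)
    then have "2 * n * Q + 2 * S + 1 < 2 * n * n + 2 * n" using that(2) by linarith
    then show ?thesis by (simp add: length_encode)
  qed
  have symbol: "symbol v (2 * n * Q + 2 * S) = of_bool b - 2 * of_bool (b \<and> b')"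
    if "Q \<le> n" "S < n" "encode n \<delta> M ! (2 * n * Q + 2 * S) = b"
      "encode n \<delta> M ! (2 * n * Q + (2 * S + 1)) = b'" for Q S b b'
    using less[OF that(1,2)] v[of "2 * n * Q + 2 * S"] v[of "2 * n * Q + 2 * S + 1"] that(3,4)
    by (simp add: symbol_def)
  have "succ_coeff n v Q S = \<delta> Q S" if "Q < n" "S < n" for Q S
  proof -
    have "symbol v (2 * n * Q + 2 * S) = of_bool (\<delta> Q S \<noteq> 0) - 2 * of_bool (\<delta> Q S \<noteq> 0 \<and> \<delta> Q S < 0)"
      using that by (intro symbol) (auto simp: encode_nth encode_marking_nth simp del: add_Suc_right One_nat_def)
    moreover have "\<delta> Q S \<in> {-1, 0, 1}" using \<delta>[OF that(1)] that(2) by (simp add: marking_def)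
    ultimately show ?thesis using that by (auto simp: succ_coeff_def)
  qed
  moreover have "mark_coeff n v S = M S" if "S < n" for S
  proof -
    have "symbol v (2 * n * n + 2 * S) = of_bool (M S \<noteq> 0) - 2 * of_bool (M S \<noteq> 0 \<and> M S < 0)"
      using that by (intro symbol) (auto simp: encode_nth encode_marking_nth simp del: add_Suc_right One_nat_def)
    moreover have "M S \<in> {-1, 0, 1}" using M that by (simp add: marking_def)
    ultimately show ?thesis using that by (auto simp: mark_coeff_def)
  qed
  ultimately show ?thesis by (simp add: reads_def)
qed

lemma after_rounds_exact:
  assumes a: "exponents n \<delta> a" and \<delta>: "\<And>Q. Q < n \<Longrightarrow> marking {..<n} (\<delta> Q)" "marking {..<n} M"
    and K: "2 * int G + 1 \<le> K" and B: "2 * int n + K < B" "B \<le> 2 ^ G"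
    and "after_rounds n G B K t (encode n \<delta> M) v"
  shows "exact_on (known n \<delta> t) K a v"
  using assms(7)
proof (induction t arbitrary: v)
  case 0
  with exponentsD(1)[OF a] show ?case by (simp add: exact_on_def)
next
  case (Suc t)
  then obtain u where u: "after_rounds n G B K t (encode n \<delta> M) u"
    and v: "\<And>Q R k. Q \<le> n \<Longrightarrow> R \<le> n \<Longrightarrow> \<bar>k\<bar> \<le> K \<Longrightarrow> v (Le Q R k) = round_le n G B u Q R k"
    by auto
  have "reads n \<delta> M u"
    using \<delta> after_rounds_inputs[OF u] by (intro reads_encode) auto
  note round = round_le_iff[OF a this Suc.IH[OF u] K B]
  show ?case
    unfolding exact_on_def
  proof (intro ballI allI impI)
    fix Q R k
    assume QR: "Q \<in> known n \<delta> (Suc t)" "R \<in> known n \<delta> (Suc t)" and k: "\<bar>k\<bar> \<le> K"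
    then have "Q \<le> n" "R \<le> n" using known_subset by blast+
    then show "v (Le Q R k) = (a Q + k \<le> a R)" using v[OF _ _ k] round[OF QR k] by simp
  qed
qed

section \<open>Number of rounds until all nodes are known\<close>

lemma path_if_not_known:
  assumes "P < n" "P \<notin> known n \<delta> (Suc t)"
  shows "\<exists>Q. (P, Q) \<in> edges {..<n} \<delta> ^^ Suc t"
  using assms
proof (induction t arbitrary: P)
  case 0
  then show ?case by (auto simp: edges_def)
next
  case (Suc t)
  then obtain S where S: "S < n" "\<delta> P S \<noteq> 0" "S \<notin> known n \<delta> (Suc t)" by auto
  then obtain Q where "(S, Q) \<in> edges {..<n} \<delta> ^^ Suc t" using Suc.IH by blast
  moreover have "(P, S) \<in> edges {..<n} \<delta>" using S Suc.prems by (simp add: edges_def)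
  ultimately show ?case by (metis relpow_Suc_I2)
qed

lemma known_all_depth:
  assumes "signed_dag {..<n} \<delta>" "depth {..<n} \<delta> \<le> D"
  shows "known n \<delta> (Suc D) = {..n}"
proof -
  have "P \<in> known n \<delta> (Suc D)" if "P \<le> n" for P
  proof (rule ccontr)
    assume P: "P \<notin> known n \<delta> (Suc D)"
    then have "P < n" using that last_in_known[of n \<delta> "Suc D"] by (cases "P = n") auto
    from path_if_not_known[OF this P]
    have "Suc D \<le> depth {..<n} \<delta>"
      unfolding depth_def by (intro Max_ge finite_path_lengths assms(1)) blast
    then show False using assms(2) by simp
  qed
  then show ?thesis using known_subset by blast
qed

text \<open>As long as some node is missing, there is a missing one all of whose successors are
  known, so each round gains a node. This bound without the depth keeps the number of gates
  independent of \<open>D\<close>.\<close>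

lemma known_all_nodes:
  assumes "signed_dag {..<n} \<delta>"
  shows "known n \<delta> n = {..n}"
proof -
  let ?E = "edges {..<n} \<delta>" and ?U = "\<lambda>t. {..<n} \<inter> known n \<delta> t"
  have wf: "wf (?E\<inverse>)"
    using assms by (simp add: signed_dag_def finite_acyclic_wf_converse finite_edges)
  have mono: "known n \<delta> t \<subseteq> known n \<delta> (Suc t)" for t
    by (induction t) auto
  have "t \<le> card (?U t) \<or> ?U t = {..<n}" for t
  proof (induction t)
    case (Suc t)
    show ?case
    proof (cases "?U t = {..<n}")
      case True
      then show ?thesis using mono[of t] by blast
    next
      case False
      then obtain P where P: "P \<in> {..<n} - ?U t"
        and min: "\<And>S. (S, P) \<in> ?E\<inverse> \<Longrightarrow> S \<notin> {..<n} - ?U t"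
        using wfE_min[OF wf, of _ "{..<n} - ?U t"] by blast
      then have "P \<in> known n \<delta> (Suc t)"
        by (auto simp: edges_def)
      then have "?U t \<subset> ?U (Suc t)" using P mono[of t] by blast
      then have "card (?U t) < card (?U (Suc t))" by (intro psubset_card_mono) auto
      then show ?thesis using Suc False by simp
    qed
  qed simp
  from this[of n] have "?U n = {..<n}"
    using card_subset_eq[of "{..<n}" "?U n"] card_mono[of "{..<n}" "?U n"] by force
  then show ?thesis
    using known_subset[of n \<delta> n] last_in_known[of n \<delta> n]
    by (auto simp: le_less)
qed

lemma known_all:
  assumes "signed_dag {..<n} \<delta>" "depth {..<n} \<delta> \<le> D"
  shows "known n \<delta> (min (Suc D) n) = {..n}"
  using known_all_depth[OF assms] known_all_nodes[OF assms(1)] by (simp add: min_def)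

context size_base
begin

lemma hz_symbol: "hz 7 (\<lambda>v. symbol v i)"
proof -
  have "hz (max 1 (max 1 1 + 2 + 2 + 1) + 1) (\<lambda>v. symbol v i)"
    unfolding symbol_def using N by (intro hz_diff hz_of_bool hz_scale hf_conj hf_wire) auto
  then show ?thesis by (rule hz_mono) simp
qed

lemma hz_succ_coeff: "hz 7 (\<lambda>v. succ_coeff n v Q S)"
proof -
  have "hz 7 (\<lambda>v :: wire \<Rightarrow> bool. 0)" by (rule hz_mono[OF hz_const]) auto
  then show ?thesis by (cases "Q < n \<and> S < n") (auto simp: succ_coeff_def hz_symbol)
qed

lemma hz_mark_coeff: "hz 7 (\<lambda>v. mark_coeff n v S)"
proof -
  have "hz 7 (\<lambda>v :: wire \<Rightarrow> bool. 0)" by (rule hz_mono[OF hz_const]) auto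
  then show ?thesis by (cases "S < n") (auto simp: mark_coeff_def hz_symbol)
qed

lemma hz_pos_coeff:
  assumes "\<bar>snd p\<bar> \<le> int N"
  shows "hz 8 (\<lambda>v. pos_coeff n v p S)"
proof -
  have "hz (max 7 1 + 1) (\<lambda>v. pos_coeff n v p S)"
    unfolding pos_coeff_def using assms by (intro hz_add hz_succ_coeff hz_const) auto
  then show ?thesis by (rule hz_mono) simp
qed

lemma hf_round_le:
  assumes "2 ^ G \<le> N" "G + 1 \<le> N" "n + 1 \<le> N" "\<bar>k\<bar> \<le> int N"
  shows "hf 90 (\<lambda>v. round_le n G B v Q R k)"
proof -
  have "hz (max 8 (7 + 1) + 1) (\<lambda>v. pos_coeff n v (Q, k) S - succ_coeff n v R S)" for S
    using assms by (intro hz_diff hz_pos_coeff hz_succ_coeff) auto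
  then have "hz 9 (\<lambda>v. pos_coeff n v (Q, k) S - succ_coeff n v R S)" for S
    by (rule hz_mono) simp
  then have "hf (4 * 9 + 53 + 1) (\<lambda>v. round_le n G B v Q R k)"
    unfolding round_le_def using assms by (intro hf_Not hf_gpos) auto
  then show ?thesis by (rule hf_mono) simp
qed

end

text \<open>Suppose \<open>p\<close> is away from all terms. The terms above \<open>p\<close>
  contribute a multiple \<open>3 * U\<close> to \<open>3 * X div 2 ^ (p + 1)\<close>, and the lower
  ones are so small that they contribute only 0 or -1. The residue modulo 6 is then 0, 3, 5 or 2, so
  the digit vanishes.\<close>

lemma naf_support:
  assumes fin: "finite I" and small: "3 * (\<Sum>i\<in>I. \<bar>c i\<bar>) < 2 ^ K"
    and nz: "naf (\<Sum>i\<in>I. c i * 2 ^ e i) p \<noteq> 0"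
  shows "\<exists>i\<in>I. c i \<noteq> 0 \<and> e i \<le> p \<and> p < e i + K"
proof (rule ccontr)
  assume "\<not> ?thesis"
  then have far: "p < e i \<or> e i + K \<le> p" if "i \<in> I" "c i \<noteq> 0" for i
    using that by force
  define Y where "Y = (\<Sum>i\<in>I. if e i \<le> p then c i * 2 ^ e i else 0)"
  define U where "U = (\<Sum>i\<in>I. if e i \<le> p then 0 else c i * 2 ^ (e i - (p + 1)))"
  have X: "(\<Sum>i\<in>I. c i * 2 ^ e i) = Y + 2 ^ (p + 1) * U"
    unfolding Y_def U_def sum_distrib_left sum.distrib[symmetric]
    by (intro sum.cong) (auto simp flip: power_Suc power_add)
  have "2 ^ K * \<bar>Y\<bar> \<le> (\<Sum>i\<in>I. 2 ^ p * \<bar>c i\<bar>)"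
  proof -
    have "\<bar>Y\<bar> \<le> (\<Sum>i\<in>I. \<bar>if e i \<le> p then c i * 2 ^ e i else 0\<bar>)"
      unfolding Y_def by (rule sum_abs)
    then have "2 ^ K * \<bar>Y\<bar> \<le> (\<Sum>i\<in>I. 2 ^ K * \<bar>if e i \<le> p then c i * 2 ^ e i else 0\<bar>)"
      unfolding sum_distrib_left[symmetric] by (intro mult_left_mono) auto
    also have "\<dots> \<le> (\<Sum>i\<in>I. 2 ^ p * \<bar>c i\<bar>)"
    proof (rule sum_mono)
      fix i assume "i \<in> I"
      show "2 ^ K * \<bar>if e i \<le> p then c i * 2 ^ e i else 0\<bar> \<le> 2 ^ p * \<bar>c i\<bar>"
      proof (cases "c i \<noteq> 0 \<and> e i \<le> p")
        case True
        then have "(2::int) ^ (e i + K) \<le> 2 ^ p"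
          using far[OF \<open>i \<in> I\<close>] by (intro power_increasing) auto
        then have "2 ^ (e i + K) * \<bar>c i\<bar> \<le> 2 ^ p * \<bar>c i\<bar>" by (rule mult_right_mono) simp
        then show ?thesis using True by (simp add: abs_mult power_add ac_simps)
      qed auto
    qed
    finally show ?thesis .
  qed
  then have "2 ^ K * \<bar>3 * Y\<bar> \<le> 2 ^ p * (3 * (\<Sum>i\<in>I. \<bar>c i\<bar>))"
    by (simp add: sum_distrib_left[symmetric] abs_mult)
  also have "\<dots> < 2 ^ p * 2 ^ K" using small by (intro mult_strict_left_mono) auto
  also have "\<dots> \<le> 2 ^ K * 2 ^ (p + 1)" by simp
  finally have "\<bar>3 * Y\<bar> < 2 ^ (p + 1)"
    by (rule mult_left_less_imp_less) simp
  from div_power_large[OF this] have small_div: "3 * Y div 2 ^ (p + 1) \<in> {-1, 0}" by auto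
  have "3 * (\<Sum>i\<in>I. c i * 2 ^ e i) = 3 * Y + 3 * U * 2 ^ (p + 1)"
    by (simp add: X)
  then have "3 * (\<Sum>i\<in>I. c i * 2 ^ e i) div 2 ^ (p + 1) = 3 * U + 3 * Y div 2 ^ (p + 1)"
    by (simp only: div_mult_self1 power_not_zero zero_neq_numeral not_False_eq_True
        numeral_neq_zero) 
  moreover have "F mod 6 \<noteq> 1 \<and> F mod 6 \<noteq> 4" if "F = 3 * U + d" "d \<in> {-1, 0}" for F d :: int
    using that(2) unfolding that(1) by (elim insertE emptyE; presburger)
  ultimately have "naf (\<Sum>i\<in>I. c i * 2 ^ e i) p = 0"
    using small_div by (simp add: naf_cases Let_def)
  then show False using nz by simp
qed

section \<open>Reduced power circuits from closed sets of exponents\<close>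

lemma card_less_nth_sorted_list:
  assumes "finite E" "u < card E"
  shows "card {e \<in> E. e < sorted_list_of_set E ! u} = u"
proof -
  let ?es = "sorted_list_of_set E"
  have st: "sorted_wrt (<) ?es" using strict_sorted_list_of_set by blast
  have len: "length ?es = card E" by simp
  have "{e \<in> E. e < ?es ! u} = (\<lambda>i. ?es ! i) ` {..<u}"
  proof (intro equalityI subsetI)
    fix e assume "e \<in> {e \<in> E. e < ?es ! u}"
    then obtain i where i: "i < length ?es" "e = ?es ! i" "e < ?es ! u"
      using assms(1) by (metis (no_types, lifting) in_set_conv_nth mem_Collect_eq set_sorted_list_of_set)
    then have "i < u"
      using sorted_wrt_nth_less[OF st, of u i] by (cases u i rule: linorder_cases) auto
    then show "e \<in> (\<lambda>i. ?es ! i) ` {..<u}" using i by blast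
  next
    fix e assume "e \<in> (\<lambda>i. ?es ! i) ` {..<u}"
    then obtain i where "i < u" "e = ?es ! i" by blast
    then show "e \<in> {e \<in> E. e < ?es ! u}"
      using sorted_wrt_nth_less[OF st, of i u] assms nth_mem[of i ?es] by simp
  qed
  moreover have "inj_on (\<lambda>i. ?es ! i) {..<u}"
    using assms(2) by (intro inj_on_nth) auto
  ultimately show ?thesis by (simp add: card_image)
qed

text \<open>Node \<open>u\<close> stands for the power of two with exponent \<open>es ! u\<close>,
  and its successor marking is the non-adjacent form of that exponent. Closedness of
  \<open>E\<close> makes every digit of this form fall on a node.\<close>

context
  fixes E :: "nat set" and es :: "nat list" and N :: nat and d :: "nat \<Rightarrow> nat \<Rightarrow> int"
  assumes fin: "finite E" and closed: "\<And>e p. e \<in> E \<Longrightarrow> naf (int e) p \<noteq> 0 \<Longrightarrow> p \<in> E"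
  defines "es \<equiv> sorted_list_of_set E" and "N \<equiv> card E"
    and "d \<equiv> \<lambda>u w. naf (int (es ! u)) (es ! w)"
begin

lemma es_mem: "u < N \<Longrightarrow> es ! u \<in> E"
  using fin nth_mem[of u es] by (simp add: es_def N_def)

lemma es_less: "u < w \<Longrightarrow> w < N \<Longrightarrow> es ! u < es ! w"
  using sorted_wrt_nth_less[OF strict_sorted_list_of_set, of u w E] fin by (simp add: es_def N_def)

lemma es_less_iff: "u < N \<Longrightarrow> w < N \<Longrightarrow> es ! u < es ! w \<longleftrightarrow> u < w"
  using es_less[of u w] es_less[of w u] by (cases u w rule: linorder_cases) auto

lemma es_bij: "bij_betw (\<lambda>w. es ! w) {..<N} E"
proof -
  have "bij_betw ((!) es) {..<length es} (set es)"
    by (rule bij_betw_nth) (auto simp: es_def)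
  then show ?thesis using fin by (simp add: es_def N_def)
qed

lemma sum_naf_es:
  assumes "\<And>p. naf X p \<noteq> 0 \<Longrightarrow> p \<in> E"
  shows "(\<Sum>w<N. naf X (es ! w) * 2 ^ (es ! w)) = X"
proof -
  obtain L :: nat where L: "3 * \<bar>X\<bar> < 2 ^ L" "\<forall>p\<in>E. p < L"
  proof -
    have "3 * \<bar>X\<bar> < 2 ^ (nat (3 * \<bar>X\<bar>) + Max (insert 0 E) + 1)"
    proof -
      have "nat (3 * \<bar>X\<bar>) < 2 ^ nat (3 * \<bar>X\<bar>)" by (rule less_exp)
      also have "\<dots> \<le> 2 ^ (nat (3 * \<bar>X\<bar>) + Max (insert 0 E) + 1)" by (intro power_increasing) auto
      finally show ?thesis by (simp add: nat_less_iff)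
    qed
    moreover have "\<forall>p\<in>E. p < nat (3 * \<bar>X\<bar>) + Max (insert 0 E) + 1"
    proof
      fix p assume "p \<in> E"
      then have "p \<le> Max (insert 0 E)" using fin by (intro Max_ge) auto
      then show "p < nat (3 * \<bar>X\<bar>) + Max (insert 0 E) + 1" by simp
    qed
    ultimately show ?thesis by (rule that)
  qed
  have "(\<Sum>w<N. naf X (es ! w) * 2 ^ (es ! w)) = (\<Sum>p\<in>E. naf X p * 2 ^ p)"
    using sum.reindex_bij_betw[OF es_bij, of "\<lambda>p. naf X p * 2 ^ p"] by simp
  also have "\<dots> = (\<Sum>p<L. naf X p * 2 ^ p)"
    using L(2) assms by (intro sum.mono_neutral_left) auto
  also have "\<dots> = X" by (rule sum_naf[OF L(1)])
  finally show ?thesis .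
qed

lemma signed_dag_naf: "signed_dag {..<N} d"
proof -
  \<comment> \<open>Digits of an exponent lie strictly below it, and indices are ordered like
    exponents, so edges decrease the index.\<close>
  have "edges {..<N} d \<subseteq> less_than\<inverse>"
  proof (rule subrelI)
    fix u w assume "(u, w) \<in> edges {..<N} d"
    then have "u < N" "w < N" "naf (int (es ! u)) (es ! w) \<noteq> 0" by (auto simp: edges_def d_def)
    then show "(u, w) \<in> less_than\<inverse>" using naf_less[of "es ! u" "es ! w"] es_less_iff[of w u] by simp
  qed
  then have "acyclic (edges {..<N} d)"
    using acyclic_subset[OF _ \<open>edges {..<N} d \<subseteq> less_than\<inverse>\<close>] wf_acyclic[OF wf_less_than] by simp
  then show ?thesis using naf_range by (simp add: signed_dag_def marking_def d_def)
qed

lemma eval_node_naf: "u < N \<Longrightarrow> eval_node {..<N} d u = 2 ^ (es ! u)"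
proof (induction u rule: less_induct)
  case (less u)
  have "eval_marking {..<N} d (d u) = (\<Sum>w<N. real_of_int (d u w * 2 ^ (es ! w)))"
    unfolding eval_marking_def
  proof (rule sum.cong)
    fix w assume w: "w \<in> {..<N}"
    show "real_of_int (d u w) * eval_node {..<N} d w = real_of_int (d u w * 2 ^ (es ! w))"
    proof (cases "d u w = 0")
      case False
      then have "w < u"
        using naf_less[of "es ! u" "es ! w"] es_less_iff[of w u] w less.prems by (simp add: d_def)
      then show ?thesis using less.IH w by simp
    qed simp
  qed simp
  also have "\<dots> = real_of_int (\<Sum>w<N. naf (int (es ! u)) (es ! w) * 2 ^ (es ! w))"
    by (simp add: d_def)
  also have "(\<Sum>w<N. naf (int (es ! u)) (es ! w) * 2 ^ (es ! w)) = int (es ! u)"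
    using closed[OF es_mem[OF less.prems]] by (rule sum_naf_es)
  finally show ?case
    using eval_node_eq[OF signed_dag_naf, of u] less.prems by (simp add: powr_realpow)
qed

lemma eval_marking_naf:
  assumes "\<And>p. naf X p \<noteq> 0 \<Longrightarrow> p \<in> E"
  shows "eval_marking {..<N} d (\<lambda>w. naf X (es ! w)) = real_of_int X"
proof -
  have "eval_marking {..<N} d (\<lambda>w. naf X (es ! w)) =
      real_of_int (\<Sum>w<N. naf X (es ! w) * 2 ^ (es ! w))"
    by (simp add: eval_marking_def eval_node_naf)
  then show ?thesis by (simp add: sum_naf_es[OF assms])
qed

lemma compact_marking_naf: "compact_marking {..<N} d (\<lambda>w. naf X (es ! w))"
  unfolding compact_marking_def
proof (intro conjI ballI impI)
  show "marking {..<N} (\<lambda>w. naf X (es ! w))" using naf_range by (simp add: marking_def)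
next
  have *: "es ! u + 2 \<le> es ! w" if "u < w" "w < N" "naf X (es ! u) \<noteq> 0" "naf X (es ! w) \<noteq> 0" for u w
  proof -
    have "es ! u < es ! w" using es_less that by blast
    moreover have "es ! w \<noteq> Suc (es ! u)" using naf_nonadjacent[OF that(3)] that(4) by auto
    ultimately show ?thesis by simp
  qed
  have ev: "eval_marking {..<N} d (d u) = real (es ! u)" if "u < N" for u
    unfolding d_def using eval_marking_naf[OF closed[OF es_mem[OF that]]] by (simp add: d_def)
  fix u w assume "u \<in> support {..<N} (\<lambda>w. naf X (es ! w))" "w \<in> support {..<N} (\<lambda>w. naf X (es ! w))" "u \<noteq> w"
  then show "2 \<le> \<bar>eval_marking {..<N} d (d u) - eval_marking {..<N} d (d w)\<bar>"
    using *[of u w] *[of w u] by (cases u w rule: linorder_cases) (auto simp: support_def ev)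
qed

lemma encodes_reduced_naf:
  "encodes_reduced (encode N d (\<lambda>w. naf X (es ! w))) N d (\<lambda>w. naf X (es ! w))"
proof -
  have set: "set [0..<N] = {..<N}" by auto
  have "power_circuit {..<N} d"
    using signed_dag_naf eval_node_naf by (auto simp: power_circuit_def)
  moreover have "compact_marking {..<N} d (d u)" for u
    using compact_marking_naf[of "int (es ! u)"] unfolding d_def .
  moreover have "sorted_wrt (\<lambda>P Q. eval_node {..<N} d P < eval_node {..<N} d Q) [0..<N]"
    by (auto simp: sorted_wrt_iff_nth_less eval_node_naf es_less)
  ultimately show ?thesis
    using compact_marking_naf unfolding encodes_reduced_def reduced_power_circuit_def set by blast
qed

end

section \<open>The output formula\<close>

lemma le_div_iff:
  fixes z w k :: int
  assumes "0 < k"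
  shows "z \<le> w div k \<longleftrightarrow> z * k \<le> w"
proof
  assume "z \<le> w div k"
  then have "z * k \<le> w div k * k" using assms by (intro mult_right_mono) auto
  also have "\<dots> \<le> w" using assms by (simp add: minus_mod_eq_div_mult[symmetric])
  finally show "z * k \<le> w" .
next
  assume "z * k \<le> w"
  then show "z \<le> w div k" using zdiv_mono1[of "z * k" w k] assms by simp
qed

text \<open>For counting distinct values by gates: each value is counted at its preimage with the
  largest first component, which is unique because \<open>g\<close> is injective on pairs with equal
  first component.\<close>

lemma card_eq_sum_representatives:
  fixes C :: "(nat \<times> int) set"
  assumes fin: "finite C"
    and inj: "\<And>p p'. p \<in> C \<Longrightarrow> p' \<in> C \<Longrightarrow> fst p = fst p' \<Longrightarrow> g p = g p' \<Longrightarrow> p = p'"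
  shows "(\<Sum>p\<in>C. of_bool ((\<forall>p'\<in>C. fst p < fst p' \<longrightarrow> g p \<noteq> g p') \<and> P (g p))) =
    int (card {e \<in> g ` C. P e})"
proof -
  let ?A = "{p \<in> C. (\<forall>p'\<in>C. fst p < fst p' \<longrightarrow> g p \<noteq> g p') \<and> P (g p)}"
  have "g ` ?A = {e \<in> g ` C. P e}"
  proof (intro equalityI subsetI)
    fix e assume e: "e \<in> {e \<in> g ` C. P e}"
    let ?F = "fst ` {p \<in> C. g p = e}"
    have "finite ?F" "?F \<noteq> {}" using fin e by auto
    then have "Max ?F \<in> ?F" by (rule Max_in)
    then obtain p where p: "p \<in> C" "g p = e" "fst p = Max ?F" by force
    have "g p \<noteq> g p'" if "p' \<in> C" "fst p < fst p'" for p'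
    proof
      assume "g p = g p'"
      then have "fst p' \<in> ?F" using that p by auto
      then have "fst p' \<le> Max ?F" using \<open>finite ?F\<close> by (rule Max_ge[rotated])
      then show False using that p by simp
    qed
    then show "e \<in> g ` ?A" using p e by blast
  qed auto
  moreover have "inj_on g ?A"
  proof (rule inj_onI)
    fix p p' assume p: "p \<in> ?A" "p' \<in> ?A" and eq: "g p = g p'"
    have "\<forall>p'\<in>C. fst p < fst p' \<longrightarrow> g p \<noteq> g p'" "p \<in> C" using p(1) by blast+
    moreover have "\<forall>p\<in>C. fst p' < fst p \<longrightarrow> g p' \<noteq> g p" "p' \<in> C" using p(2) by blast+
    ultimately have "fst p = fst p'" using eq by (metis linorder_less_linear)
    with \<open>p \<in> C\<close> \<open>p' \<in> C\<close> show "p = p'" using eq by (rule inj)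
  qed
  ultimately have "card {e \<in> g ` C. P e} = card ?A"
    using card_image[of g ?A] by simp
  moreover have "(\<Sum>p\<in>C. of_bool (Q p)) = int (card {p \<in> C. Q p})" for Q
    using fin by (simp add: of_bool_def sum.If_cases Int_def)
  ultimately show ?thesis by simp
qed

text \<open>\<open>c\<close> is the number of shifts per node, \<open>T\<close> the number of nodes
  of the result, and \<open>Z\<close> bounds the quotients that determine digits. Coefficient sums
  are at most \<open>n + T\<close> because a shift below \<open>T\<close> may be among the
  coefficients. In the bound on \<open>K\<close>, \<open>int T + 1\<close> allows for moving a
  position up one place in the digit test; \<open>2 * Z + 1 < B\<close> is for sign tests with
  \<open>z\<close> up to \<open>Z + 1\<close>.\<close>

locale layout = size_base N for N +
  fixes n G c T :: nat and K B Z :: int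
  assumes T: "T = (n + 1) * c"
    and c: "3 * (n + T) < 2 ^ c"
    and Z: "Z = 3 * (int n + int T)"
    and K: "2 * (int T + 1) + 2 * int G + 1 \<le> K"
    and B: "2 * Z + 1 < B" "2 * int n + K < B" "B \<le> 2 ^ G"
    and sizes: "2 ^ G \<le> N" "G + 1 \<le> N" "n + 2 \<le> N" "2 * T + 1 \<le> N" "2 * Z + 1 \<le> int N" "3 \<le> N"
begin

text \<open>Compares \<open>z\<close> with the quotient of \<open>3 * Y\<close> by two to the power
  of \<open>q\<close>, where \<open>Y\<close> keeps only the terms not above \<open>q\<close>; index
  \<open>Suc n\<close> carries the summand for \<open>z\<close>. Omitting the higher terms changes
  the quotient by a multiple of 6, harmless for digits, and keeps it polynomially bounded.\<close>

definition floor_ge :: "(wire \<Rightarrow> bool) \<Rightarrow> (nat \<Rightarrow> int) \<Rightarrow> nat \<times> int \<Rightarrow> int \<Rightarrow> bool" where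
  "floor_ge v cf q z \<longleftrightarrow> \<not> gpos G B {..Suc n} (\<lambda>i. if i \<le> n then (i, 0) else q) v
     (\<lambda>i. if i \<le> n then - (3 * (cf i * of_bool (ple v (i, 0) q))) else z)"

definition naf_class :: "(wire \<Rightarrow> bool) \<Rightarrow> (nat \<Rightarrow> int) \<Rightarrow> nat \<times> int \<Rightarrow> int \<Rightarrow> bool" where
  "naf_class v cf p r \<longleftrightarrow> (\<exists>z\<in>{-Z..Z}. z mod 6 = r \<and> floor_ge v cf (shift p 1) z \<and>
     \<not> floor_ge v cf (shift p 1) (z + 1))"

text \<open>Positions of the new nodes. A circuit has a fixed number of outputs, so the result must have
  the same number \<open>T\<close> of nodes for all inputs of the same length; this is achieved by the choice
  of \<open>m\<close>, which depends on the coincidences among the other positions.\<close>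

definition cands :: "nat \<Rightarrow> (nat \<times> int) set" where
  "cands m = {..<n} \<times> {0..<int c} \<union> {n} \<times> {0..<int m}"

definition canon :: "(wire \<Rightarrow> bool) \<Rightarrow> nat \<Rightarrow> nat \<times> int \<Rightarrow> bool" where
  "canon v m p \<longleftrightarrow> (\<forall>p'\<in>cands m. fst p < fst p' \<longrightarrow> \<not> peq v p p')"

definition rank :: "(wire \<Rightarrow> bool) \<Rightarrow> nat \<Rightarrow> nat \<times> int \<Rightarrow> int" where
  "rank v m q = (\<Sum>p\<in>cands m. of_bool (canon v m p \<and> \<not> ple v q p))"

definition total :: "(wire \<Rightarrow> bool) \<Rightarrow> nat \<Rightarrow> int" where
  "total v m = (\<Sum>p\<in>cands m. of_bool (canon v m p))"

text \<open>Residues 1 and 4 belong to the digits 1 and -1. \<open>b = False\<close> asks for the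
  first bit of the symbol, nonzero, and \<open>b = True\<close> for the second, negative.\<close>

definition digit_bit :: "(wire \<Rightarrow> bool) \<Rightarrow> (nat \<Rightarrow> int) \<Rightarrow> nat \<times> int \<Rightarrow> bool \<Rightarrow> bool" where
  "digit_bit v cf p b \<longleftrightarrow> naf_class v cf p 4 \<or> \<not> b \<and> naf_class v cf p 1"

text \<open>Nodes are addressed by rank, which is the same for coinciding positions. Several
  \<open>m\<close> may attain the total \<open>T\<close>, but they all yield the same exponents, so
  the quantifier over \<open>m\<close> causes no ambiguity.\<close>

definition row_bit :: "(wire \<Rightarrow> bool) \<Rightarrow> nat \<Rightarrow> nat \<Rightarrow> bool \<Rightarrow> bool" where
  "row_bit v u w b \<longleftrightarrow> (\<exists>m\<in>{..T}. total v m = int T \<and> (\<exists>p\<in>cands m. rank v m p = int w \<and>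
     (\<exists>p'\<in>cands m. rank v m p' = int u \<and> digit_bit v (pos_coeff n v p') p b)))"

definition mark_bit :: "(wire \<Rightarrow> bool) \<Rightarrow> nat \<Rightarrow> bool \<Rightarrow> bool" where
  "mark_bit v w b \<longleftrightarrow> (\<exists>m\<in>{..T}. total v m = int T \<and> (\<exists>p\<in>cands m. rank v m p = int w \<and>
     digit_bit v (mark_coeff n v) p b))"

lemma c_le_T: "c \<le> T" and nc_le_T: "n * c + c = T"
  using T by auto

lemma finite_cands [simp]: "finite (cands m)"
  by (simp add: cands_def)

lemma cands_fst: "p \<in> cands m \<Longrightarrow> fst p \<le> n"
  by (auto simp: cands_def)

lemma cands_snd: "m \<le> T \<Longrightarrow> p \<in> cands m \<Longrightarrow> 0 \<le> snd p \<and> snd p < int T"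
  using c_le_T by (auto simp: cands_def)

lemma card_cands: "m \<le> T \<Longrightarrow> card (cands m) \<le> N"
proof -
  assume "m \<le> T"
  have "card (cands m) \<le> n * c + m"
    unfolding cands_def by (rule order.trans[OF card_Un_le]) (simp add: card_cartesian_product)
  also have "\<dots> \<le> 2 * T" using nc_le_T \<open>m \<le> T\<close> by linarith
  finally show ?thesis using sizes by linarith
qed

section \<open>Circuit complexity of the output formula\<close>

lemma hf_floor_ge:
  assumes cf: "\<And>i. hz 8 (\<lambda>v. cf v i)" and z: "\<bar>z\<bar> \<le> int N"
  shows "hf 106 (\<lambda>v. floor_ge v (cf v) q z)"
proof -
  have "hz (max 8 1 + 2 + 2 + 1) (\<lambda>v. - (3 * (cf v i * of_bool (ple v (i, 0) q))))" for i
    using sizes by (intro hz_uminus hz_scale hz_times_bool cf hf_ple) auto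
  then have 1: "hz 13 (\<lambda>v. - (3 * (cf v i * of_bool (ple v (i, 0) q))))" for i
    by (rule hz_mono) simp
  have 2: "hz 13 (\<lambda>v :: wire \<Rightarrow> bool. z)"
    by (rule hz_mono[OF hz_const[OF z]]) simp
  have "hf (4 * 13 + 53 + 1) (\<lambda>v. floor_ge v (cf v) q z)"
    unfolding floor_ge_def
  proof (intro hf_Not hf_gpos)
    show "hz 13 (\<lambda>v. if i \<le> n then - (3 * (cf v i * of_bool (ple v (i, 0) q))) else z)" for i
      using 1 2 by (cases "i \<le> n") simp_all
  qed (use sizes in auto)
  then show ?thesis by (rule hf_mono) simp
qed

lemma hf_naf_class:
  assumes cf: "\<And>i. hz 8 (\<lambda>v. cf v i)"
  shows "hf 113 (\<lambda>v. naf_class v (cf v) p r)"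
proof -
  have "hf (max 1 (max 106 (106 + 1) + 2) + 2 + 2) (\<lambda>v. naf_class v (cf v) p r)"
    unfolding naf_class_def
  proof (intro hf_Bex hf_conj hf_Not hf_floor_ge cf hf_const)
    show "card {- Z..Z} \<le> N" using sizes(5) by simp
  qed (use Z sizes(5) in auto)
  then show ?thesis by (rule hf_mono) simp
qed

lemma hf_digit_bit:
  assumes cf: "\<And>i. hz 8 (\<lambda>v. cf v i)"
  shows "hf 117 (\<lambda>v. digit_bit v (cf v) p b)"
proof -
  have "hf (max 113 (max 1 113 + 2) + 2) (\<lambda>v. digit_bit v (cf v) p b)"
    unfolding digit_bit_def by (intro hf_disj hf_conj hf_const hf_naf_class cf)
  then show ?thesis by (rule hf_mono) simp
qed

lemma hf_canon: "m \<le> T \<Longrightarrow> hf 8 (\<lambda>v. canon v m p)"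
proof -
  assume m: "m \<le> T"
  have "hf (max (1 + 1) (3 + 1) + 2 + 2) (\<lambda>v. canon v m p)"
    unfolding canon_def by (intro hf_Ball hf_imp hf_Not hf_peq hf_const finite_cands card_cands[OF m])
  then show ?thesis by (rule hf_mono) simp
qed

lemma hf_total: "m \<le> T \<Longrightarrow> hf 35 (\<lambda>v. total v m = t)"
proof -
  assume m: "m \<le> T"
  have "hf (3 * (8 + 1) + 8) (\<lambda>v. total v m = t)"
    unfolding total_def
    by (intro hf_pred hz_sum hz_of_bool hf_canon finite_cands card_cands m) auto
  then show ?thesis by (rule hf_mono) simp
qed

lemma hf_rank: "m \<le> T \<Longrightarrow> hf 41 (\<lambda>v. rank v m q = t)"
proof -
  assume m: "m \<le> T"
  have "hf (3 * (max 8 (1 + 1) + 2 + 1) + 8) (\<lambda>v. rank v m q = t)"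
    unfolding rank_def
    by (intro hf_pred hz_sum hz_of_bool hf_conj hf_Not hf_ple hf_canon finite_cands card_cands m) auto
  then show ?thesis by (rule hf_mono) simp
qed

lemma hf_row_bit: "hf 130 (\<lambda>v. row_bit v u w b)"
proof -
  have pc: "hz 8 (\<lambda>v. pos_coeff n v p S)" if "m \<le> T" "p \<in> cands m" for m p S
    using cands_snd[OF that] sizes by (intro hz_pos_coeff) linarith
  have 1: "hf (max 41 (max 41 117 + 2 + 2) + 2 + 2) (\<lambda>v. \<exists>p\<in>cands m. rank v m p = int w \<and>
     (\<exists>p'\<in>cands m. rank v m p' = int u \<and> digit_bit v (pos_coeff n v p') p b))" if "m \<le> T" for m
    using that by (intro hf_Bex hf_conj hf_rank hf_digit_bit pc[OF that] finite_cands card_cands)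
  have "hf (max 35 (max 41 (max 41 117 + 2 + 2) + 2 + 2) + 2 + 2) (\<lambda>v. row_bit v u w b)"
    unfolding row_bit_def
    using sizes by (intro hf_Bex hf_conj[OF hf_total 1]) auto
  then show ?thesis by (rule hf_mono) simp
qed

lemma hf_mark_bit: "hf 130 (\<lambda>v. mark_bit v w b)"
proof -
  have mc: "hz 8 (\<lambda>v. mark_coeff n v S)" for S
    by (rule hz_mono[OF hz_mark_coeff]) simp
  have 1: "hf (max 41 117 + 2 + 2) (\<lambda>v. \<exists>p\<in>cands m. rank v m p = int w \<and>
     digit_bit v (mark_coeff n v) p b)" if "m \<le> T" for m
    using that by (intro hf_Bex hf_conj hf_rank hf_digit_bit mc finite_cands card_cands)
  have "hf (max 35 (max 41 117 + 2 + 2) + 2 + 2) (\<lambda>v. mark_bit v w b)"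
    unfolding mark_bit_def
    using sizes by (intro hf_Bex hf_conj[OF hf_total 1]) auto
  then show ?thesis by (rule hf_mono) simp
qed

section \<open>Meaning of the output formula under exact comparisons\<close>

lemma floor_ge_iff:
  assumes a: "\<forall>i\<le>n. 0 \<le> a i" and ex: "exact_on {..n} K a v"
    and cf: "3 * (\<Sum>i\<le>n. \<bar>cf i\<bar>) \<le> Z" and z: "\<bar>z\<bar> \<le> Z + 1"
    and q: "fst q \<le> n" "\<bar>snd q\<bar> \<le> int T + 1" "0 \<le> pval a q"
  shows "floor_ge v cf q z \<longleftrightarrow>
    z \<le> 3 * (\<Sum>i\<le>n. cf i * of_bool (a i \<le> pval a q) * 2 ^ nat (a i)) div 2 ^ nat (pval a q)"
proof -
  let ?c = "\<lambda>i. if i \<le> n then - (3 * (cf i * of_bool (ple v (i, 0) q))) else z"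
  let ?ps = "\<lambda>i. if i \<le> n then (i, 0) else q"
  have J: "2 * (int T + 1) + 2 * int G + 1 \<le> K" by (rule K)
  have ple: "ple v (i, 0) q \<longleftrightarrow> a i \<le> pval a q" if "i \<le> n" for i
    using ple_iff[OF ex, of "(i, 0)" q] that q K by (simp add: pval_def)
  have split: "(\<Sum>i\<le>Suc n. h i) = (\<Sum>i\<le>n. h i) + h (Suc n)" for h :: "nat \<Rightarrow> int" by simp
  have "(\<Sum>i\<le>n. \<bar>?c i\<bar>) \<le> (\<Sum>i\<le>n. 3 * \<bar>cf i\<bar>)"
    by (intro sum_mono) (auto simp: abs_mult)
  then have sum: "(\<Sum>i\<le>Suc n. \<bar>?c i\<bar>) < B"
    unfolding split using cf z B(1) by (simp add: sum_distrib_left[symmetric])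
  have "gpos G B {..Suc n} ?ps v ?c \<longleftrightarrow> 0 < (\<Sum>i\<le>Suc n. ?c i * 2 ^ nat (pval a (?ps i)))"
  proof (rule gpos_iff[OF _ sum B(3) ex _ J])
    show "fst (?ps i) \<in> {..n} \<and> \<bar>snd (?ps i)\<bar> \<le> int T + 1 \<and> 0 \<le> pval a (?ps i)"
      if "i \<in> {..Suc n}" "?c i \<noteq> 0" for i
      using a q that(1) by (auto simp: pval_def)
  qed simp
  also have "(\<Sum>i\<le>Suc n. ?c i * 2 ^ nat (pval a (?ps i))) =
      (\<Sum>i\<le>n. - (3 * (cf i * of_bool (a i \<le> pval a q) * 2 ^ nat (a i)))) + z * 2 ^ nat (pval a q)"
    unfolding split by (intro arg_cong2[of _ _ _ _ "(+)"] sum.cong) (auto simp: ple pval_def)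
  also have "(\<Sum>i\<le>n. - (3 * (cf i * of_bool (a i \<le> pval a q) * 2 ^ nat (a i)))) =
      - (3 * (\<Sum>i\<le>n. cf i * of_bool (a i \<le> pval a q) * 2 ^ nat (a i)))"
    by (simp add: sum_negf sum_distrib_left)
  finally show ?thesis by (simp add: floor_ge_def le_div_iff not_less)
qed

lemma naf_class_iff:
  assumes a: "\<forall>i\<le>n. 0 \<le> a i" and ex: "exact_on {..n} K a v"
    and cf: "3 * (\<Sum>i\<le>n. \<bar>cf i\<bar>) \<le> Z"
    and p: "fst p \<le> n" "\<bar>snd p\<bar> \<le> int T" "0 \<le> pval a p"
  shows "naf_class v cf p r \<longleftrightarrow>
    3 * (\<Sum>i\<le>n. cf i * 2 ^ nat (a i)) div 2 ^ (nat (pval a p) + 1) mod 6 = r"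
proof -
  let ?q = "pval a p + 1" and ?e = "nat (pval a p) + 1"
  define Y where "Y = (\<Sum>i\<le>n. cf i * of_bool (a i \<le> ?q) * 2 ^ nat (a i))"
  define U where "U = (\<Sum>i\<le>n. if a i \<le> ?q then 0 else cf i * 2 ^ (nat (a i) - (?e + 1)))"
  have e: "nat ?q = ?e" using p(3) by simp
  define F where "F = 3 * Y div 2 ^ ?e"
  have fl: "floor_ge v cf (shift p 1) z \<longleftrightarrow> z \<le> F" if "\<bar>z\<bar> \<le> Z + 1" for z
    using floor_ge_iff[OF a ex cf that, of "shift p 1"] p by (simp add: F_def Y_def e)
  \<comment> \<open>A term above \<open>?q\<close> is a multiple of \<open>2 ^ (?e + 1)\<close>;
    after multiplication by 3 and division by \<open>2 ^ ?e\<close> it contributes a multiple of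
    6.\<close>
  have "(\<Sum>i\<le>n. cf i * 2 ^ nat (a i)) = Y + 2 ^ (?e + 1) * U"
    unfolding Y_def U_def sum_distrib_left sum.distrib[symmetric]
  proof (intro sum.cong refl)
    fix i
    have "(2::int) ^ (?e + 1) * 2 ^ (nat (a i) - (?e + 1)) = 2 ^ nat (a i)" if "\<not> a i \<le> ?q"
    proof -
      have "?e + 1 + (nat (a i) - (?e + 1)) = nat (a i)" using that p(3) by linarith
      then show ?thesis by (simp only: power_add[symmetric])
    qed
    then show "cf i * 2 ^ nat (a i) = cf i * of_bool (a i \<le> ?q) * 2 ^ nat (a i) +
        2 ^ (?e + 1) * (if a i \<le> ?q then 0 else cf i * 2 ^ (nat (a i) - (?e + 1)))"
      by (simp add: mult.left_commute)
  qed
  then have "3 * (\<Sum>i\<le>n. cf i * 2 ^ nat (a i)) = 3 * Y + (6 * U) * 2 ^ ?e"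
    by simp
  then have "3 * (\<Sum>i\<le>n. cf i * 2 ^ nat (a i)) div 2 ^ ?e = 6 * U + F"
    unfolding F_def by (simp only: div_mult_self1[OF power_not_zero[OF zero_neq_numeral[symmetric]]])
  then have mod: "3 * (\<Sum>i\<le>n. cf i * 2 ^ nat (a i)) div 2 ^ ?e mod 6 = F mod 6"
    by simp
  \<comment> \<open>Every remaining power is at most \<open>2 ^ ?e\<close>, so \<open>F\<close> lies
    in the range searched by \<open>naf_class\<close>.\<close>
  have "\<bar>3 * Y\<bar> \<le> Z * 2 ^ ?e"
  proof -
    have "\<bar>Y\<bar> \<le> (\<Sum>i\<le>n. \<bar>cf i * of_bool (a i \<le> ?q) * 2 ^ nat (a i)\<bar>)"
      unfolding Y_def by (rule sum_abs)
    also have "\<dots> \<le> (\<Sum>i\<le>n. \<bar>cf i\<bar> * 2 ^ ?e)"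
    proof (rule sum_mono)
      fix i
      have "(2::int) ^ nat (a i) \<le> 2 ^ ?e" if "a i \<le> ?q"
        using that e by (intro power_increasing) linarith+
      then show "\<bar>cf i * of_bool (a i \<le> ?q) * 2 ^ nat (a i)\<bar> \<le> \<bar>cf i\<bar> * 2 ^ ?e"
        by (cases "a i \<le> ?q") (auto simp: abs_mult intro!: mult_left_mono)
    qed
    finally have "\<bar>Y\<bar> \<le> (\<Sum>i\<le>n. \<bar>cf i\<bar>) * 2 ^ ?e"
      by (simp only: sum_distrib_right)
    then have "3 * \<bar>Y\<bar> \<le> 3 * (\<Sum>i\<le>n. \<bar>cf i\<bar>) * 2 ^ ?e"
      using mult_left_mono[of "\<bar>Y\<bar>" "(\<Sum>i\<le>n. \<bar>cf i\<bar>) * 2 ^ ?e" 3] by (simp only: mult.assoc)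
    also have "\<dots> \<le> Z * 2 ^ ?e" using cf by (rule mult_right_mono) simp
    finally show ?thesis by (simp add: abs_mult)
  qed
  then have "- Z * 2 ^ ?e \<le> 3 * Y" "3 * Y \<le> Z * 2 ^ ?e" by linarith+
  then have "- Z \<le> F" "F \<le> Z"
    unfolding F_def using zdiv_mono1[of "3 * Y" "Z * 2 ^ ?e" "2 ^ ?e"]
    by (simp_all only: le_div_iff zero_less_power zero_less_numeral) simp
  have "naf_class v cf p r \<longleftrightarrow> F mod 6 = r"
  proof
    assume "naf_class v cf p r"
    then obtain z where z: "z \<in> {-Z..Z}" "z mod 6 = r" "z \<le> F" "\<not> z + 1 \<le> F"
      unfolding naf_class_def using fl by auto
    then have "z = F" by simp
    then show "F mod 6 = r" using z(2) by simp
  next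
    assume "F mod 6 = r"
    then show "naf_class v cf p r"
      unfolding naf_class_def using \<open>- Z \<le> F\<close> \<open>F \<le> Z\<close> fl by (intro bexI[of _ F]) auto
  qed
  then show ?thesis using mod by simp
qed

lemma digit_bit_iff:
  assumes a: "\<forall>i\<le>n. 0 \<le> a i" and ex: "exact_on {..n} K a v"
    and cf: "3 * (\<Sum>i\<le>n. \<bar>cf i\<bar>) \<le> Z"
    and p: "fst p \<le> n" "\<bar>snd p\<bar> \<le> int T" "0 \<le> pval a p"
  shows "digit_bit v cf p b \<longleftrightarrow>
    encode_symbol (naf (\<Sum>i\<le>n. cf i * 2 ^ nat (a i)) (nat (pval a p))) ! of_bool b"
  unfolding digit_bit_def naf_class_iff[OF a ex cf p]
  by (cases b) (auto simp: encode_symbol_def naf_cases Let_def)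

end

lemma card_less_eq_iff:
  fixes E :: "nat set"
  assumes "finite E" "e \<in> E" "u < card E"
  shows "card {e' \<in> E. e' < e} = u \<longleftrightarrow> e = sorted_list_of_set E ! u"
proof -
  let ?es = "sorted_list_of_set E"
  have "e \<in> set ?es" using assms(1,2) by simp
  then obtain i where "i < length ?es" "?es ! i = e" unfolding in_set_conv_nth by blast
  then have i: "card {e' \<in> E. e' < e} = i" "?es ! i = e"
    using card_less_nth_sorted_list[OF assms(1), of i] by auto
  show ?thesis
  proof
    assume "card {e' \<in> E. e' < e} = u"
    then show "e = ?es ! u" using i by simp
  next
    assume "e = ?es ! u"
    then show "card {e' \<in> E. e' < e} = u" using card_less_nth_sorted_list[OF assms(1,3)] by simp
  qed
qed

context layout
begin

text \<open>Inverts the layout of \<open>encode\<close> for \<open>T\<close> nodes: rows of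
  \<open>2 * T\<close> bits, the marking as row \<open>T\<close>, the parity of \<open>i\<close>
  selecting the bit of a symbol.\<close>

definition out_bit :: "(wire \<Rightarrow> bool) \<Rightarrow> nat \<Rightarrow> bool" where
  "out_bit v i = (let u = i div (2 * T); w = i mod (2 * T) div 2
     in if u < T then row_bit v u w (odd i) else mark_bit v w (odd i))"

lemma hf_out_bit: "hf 130 (\<lambda>v. out_bit v i)"
  using hf_row_bit hf_mark_bit
  by (cases "i div (2 * T) < T") (simp_all add: out_bit_def)

context
  fixes \<delta> :: "nat \<Rightarrow> nat \<Rightarrow> int" and M a :: "nat \<Rightarrow> int" and v :: "wire \<Rightarrow> bool"
  assumes a: "exponents n \<delta> a" and v: "reads n \<delta> M v" and ex: "exact_on {..n} K a v"
begin

section \<open>The exponents of the output circuit\<close>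

definition node_exp :: "nat \<times> int \<Rightarrow> nat" where
  "node_exp p = nat (pval a p)"

definition new_exps :: "nat \<Rightarrow> nat set" where
  "new_exps m = node_exp ` cands m"

lemma pval_nonneg: "m \<le> T \<Longrightarrow> p \<in> cands m \<Longrightarrow> 0 \<le> pval a p"
  using exponentsD(2)[OF a, of "fst p"] cands_fst[of p m] cands_snd[of m p]
  by (simp add: pval_def)

lemma ple_cands:
  assumes "m \<le> T" "p \<in> cands m" "q \<in> cands m"
  shows "ple v p q \<longleftrightarrow> node_exp p \<le> node_exp q"
proof -
  have "\<bar>snd p - snd q\<bar> \<le> K"
    using cands_snd[OF assms(1,2)] cands_snd[OF assms(1,3)] K by (auto simp: abs_le_iff)
  then have "ple v p q \<longleftrightarrow> pval a p \<le> pval a q"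
    using cands_fst assms by (intro ple_iff[OF ex]) auto
  then show ?thesis
    using pval_nonneg[OF assms(1,3)] by (simp add: node_exp_def nat_le_eq_zle)
qed

lemma canon_iff:
  assumes "m \<le> T" "p \<in> cands m"
  shows "canon v m p \<longleftrightarrow> (\<forall>p'\<in>cands m. fst p < fst p' \<longrightarrow> node_exp p \<noteq> node_exp p')"
  unfolding canon_def
  by (intro ball_cong refl imp_cong) (auto simp: peq_def ple_cands[OF assms(1)] assms(2))

lemma node_exp_inj:
  "m \<le> T \<Longrightarrow> p \<in> cands m \<Longrightarrow> p' \<in> cands m \<Longrightarrow> fst p = fst p' \<Longrightarrow> node_exp p = node_exp p' \<Longrightarrow> p = p'"
  using pval_nonneg[of m p] pval_nonneg[of m p'] by (simp add: node_exp_def pval_def prod_eq_iff)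

lemma rank_eq:
  assumes "m \<le> T" "q \<in> cands m"
  shows "rank v m q = int (card {e \<in> new_exps m. e < node_exp q})"
proof -
  have "rank v m q = (\<Sum>p\<in>cands m. of_bool ((\<forall>p'\<in>cands m. fst p < fst p' \<longrightarrow> node_exp p \<noteq> node_exp p') \<and>
      node_exp p < node_exp q))"
    unfolding rank_def
  proof (rule sum.cong[OF refl])
    fix p assume "p \<in> cands m"
    then show "of_bool (canon v m p \<and> \<not> ple v q p) =
      (of_bool ((\<forall>p'\<in>cands m. fst p < fst p' \<longrightarrow> node_exp p \<noteq> node_exp p') \<and> node_exp p < node_exp q) :: int)"
      using canon_iff[OF assms(1)] ple_cands[OF assms(1) assms(2)] by (simp add: not_le)
  qed
  also have "\<dots> = int (card {e \<in> node_exp ` cands m. e < node_exp q})"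
    by (rule card_eq_sum_representatives[OF finite_cands]) (rule node_exp_inj[OF assms(1)])
  finally show ?thesis by (simp add: new_exps_def)
qed

lemma total_eq:
  assumes "m \<le> T"
  shows "total v m = int (card (new_exps m))"
proof -
  have "total v m = (\<Sum>p\<in>cands m. of_bool ((\<forall>p'\<in>cands m. fst p < fst p' \<longrightarrow> node_exp p \<noteq> node_exp p') \<and> True))"
    unfolding total_def using canon_iff[OF assms] by (intro sum.cong refl) simp
  also have "\<dots> = int (card {e \<in> node_exp ` cands m. True})"
    by (rule card_eq_sum_representatives[OF finite_cands]) (rule node_exp_inj[OF assms])
  finally show ?thesis by (simp add: new_exps_def)
qed

text \<open>Node \<open>n\<close> has exponent 0, so its shifts are the numbers below
  \<open>m\<close>; raising \<open>m\<close> by one adds at most one exponent.\<close>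

lemma new_exps_eq: "new_exps m = new_exps 0 \<union> {..<m}"
proof -
  have "node_exp ` ({n} \<times> {0..<int m}) = {..<m}"
  proof (intro equalityI subsetI)
    fix e assume "e \<in> {..<m}"
    then have "(n, int e) \<in> {n} \<times> {0..<int m}" "node_exp (n, int e) = e"
      using exponentsD(1)[OF a] by (auto simp: node_exp_def pval_def)
    then show "e \<in> node_exp ` ({n} \<times> {0..<int m})" by (metis imageI)
  qed (use exponentsD(1)[OF a] in \<open>auto simp: node_exp_def pval_def\<close>)
  then show ?thesis by (auto simp: new_exps_def cands_def image_Un)
qed

lemma finite_new_exps [simp]: "finite (new_exps m)"
  by (simp add: new_exps_def)

lemma card_new_exps: "card (new_exps m) \<le> n * c + m"
proof -
  have "card (new_exps m) \<le> card (cands m)" unfolding new_exps_def by (rule card_image_le) simp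
  also have "\<dots> \<le> n * c + m"
    unfolding cands_def by (rule order.trans[OF card_Un_le]) (simp add: card_cartesian_product)
  finally show ?thesis .
qed

text \<open>A discrete intermediate value argument: the cardinality is at most
  \<open>n * c \<le> T\<close> for \<open>m = 0\<close>, at least \<open>T\<close> for
  \<open>m = T\<close>, and grows by at most 1 per step.\<close>

lemma ex_new_exps: "\<exists>m\<le>T. card (new_exps m) = T"
proof -
  have T_le: "T \<le> card (new_exps T)"
    using card_mono[of "new_exps T" "{..<T}"] new_exps_eq[of T] by simp
  define m where "m = (LEAST m. T \<le> card (new_exps m))"
  have m: "T \<le> card (new_exps m)" "m \<le> T"
    unfolding m_def using T_le by (auto intro: LeastI Least_le)
  moreover have "card (new_exps m) \<le> T"
  proof (cases m)
    case 0
    then show ?thesis using card_new_exps[of 0] nc_le_T by simp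
  next
    case (Suc k)
    then have "\<not> T \<le> card (new_exps k)"
      using not_less_Least[of k "\<lambda>m. T \<le> card (new_exps m)"] by (simp add: m_def)
    moreover have "new_exps (Suc k) = insert k (new_exps k)"
      using new_exps_eq[of "Suc k"] new_exps_eq[of k] by auto
    ultimately show ?thesis using Suc card_insert_le_m1[of "Suc T" "new_exps k" k] card_insert_if[of "new_exps k" k] by simp
  qed
  ultimately show ?thesis by (metis le_antisym)
qed

definition final_m :: nat where
  "final_m = (SOME m. m \<le> T \<and> card (new_exps m) = T)"

definition E :: "nat set" where
  "E = new_exps final_m"

lemma final_m: "final_m \<le> T" "card (new_exps final_m) = T"
  using someI_ex[of "\<lambda>m. m \<le> T \<and> card (new_exps m) = T"] ex_new_exps
  unfolding final_m_def by blast+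

lemma finite_E [simp]: "finite E" and card_E [simp]: "card E = T"
  using final_m by (auto simp: E_def)

text \<open>The sets form a chain in \<open>m\<close>, and members of a chain with equal finite
  cardinality coincide.\<close>

lemma new_exps_unique: "card (new_exps m) = T \<Longrightarrow> new_exps m = E"
proof -
  assume m: "card (new_exps m) = T"
  have "new_exps m \<subseteq> E \<or> E \<subseteq> new_exps m"
    unfolding E_def new_exps_eq[of m] new_exps_eq[of final_m]
    by (metis Un_mono lessThan_subset_iff linear order_refl)
  then show ?thesis
    using m card_subset_eq[of E "new_exps m"] card_subset_eq[of "new_exps m" E] by auto
qed

text \<open>The other nodes supply at most \<open>n * c\<close> exponents, so reaching
  \<open>T = n * c + c\<close> takes \<open>c\<close> shifts of node \<open>n\<close>. Hence this
  node, too, has all shifts that digits may require.\<close>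

lemma c_le_final_m: "c \<le> final_m"
  using card_new_exps[of final_m] final_m(2) nc_le_T by linarith

lemma naf_in_E:
  assumes "3 * (\<Sum>i\<le>n. \<bar>cf i\<bar>) \<le> Z" "naf (\<Sum>i\<le>n. cf i * 2 ^ nat (a i)) p \<noteq> 0"
  shows "p \<in> E"
proof -
  have "Z < 2 ^ c"
  proof -
    have "int (3 * (n + T)) < int (2 ^ c)" using c by (simp only: of_nat_less_iff)
    then show ?thesis using Z by simp
  qed
  with assms(1) have "3 * (\<Sum>i\<le>n. \<bar>cf i\<bar>) < 2 ^ c" by linarith
  from naf_support[OF _ this assms(2)] obtain i where
    i: "i \<le> n" "nat (a i) \<le> p" "p < nat (a i) + c" by auto
  have a_i: "0 \<le> a i" by (rule exponentsD(2)[OF a i(1)])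
  show ?thesis
  proof (cases "i = n")
    case True
    then have "p < final_m" using i(3) exponentsD(1)[OF a] c_le_final_m by simp
    then show ?thesis unfolding E_def new_exps_eq[of final_m] by simp
  next
    case False
    then have "(i, int p - a i) \<in> cands final_m"
      using i a_i by (simp add: cands_def) linarith
    moreover have "node_exp (i, int p - a i) = p" by (simp add: node_exp_def pval_def)
    ultimately show ?thesis unfolding E_def new_exps_def by (metis imageI)
  qed
qed

lemma pos_coeff_bound: "m \<le> T \<Longrightarrow> p \<in> cands m \<Longrightarrow> 3 * (\<Sum>i\<le>n. \<bar>pos_coeff n v p i\<bar>) \<le> Z"
  using sum_abs_pos_coeff[of n v p] cands_snd[of m p] Z by simp

lemma node_exp_eq_sum:
  "m \<le> T \<Longrightarrow> p \<in> cands m \<Longrightarrow> (\<Sum>i\<le>n. pos_coeff n v p i * 2 ^ nat (a i)) = int (node_exp p)"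
  using pval_eq_sum[OF a v cands_fst] pval_nonneg[of m p] by (simp add: node_exp_def)

text \<open>An exponent in \<open>E\<close> is itself a sum over the nodes with coefficient sum at
  most \<open>n + T\<close>, so the choice of \<open>c\<close> covers it just like the given
  marking.\<close>

lemma E_closed:
  assumes "e \<in> E" "naf (int e) p \<noteq> 0"
  shows "p \<in> E"
proof -
  obtain q where q: "q \<in> cands final_m" "e = node_exp q"
    using assms(1) by (auto simp: E_def new_exps_def)
  show ?thesis
  proof (rule naf_in_E)
    show "3 * (\<Sum>i\<le>n. \<bar>pos_coeff n v q i\<bar>) \<le> Z" by (rule pos_coeff_bound[OF final_m(1) q(1)])
    show "naf (\<Sum>i\<le>n. pos_coeff n v q i * 2 ^ nat (a i)) p \<noteq> 0"
      using assms(2) node_exp_eq_sum[OF final_m(1) q(1)] q(2) by simp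
  qed
qed

abbreviation es :: "nat list" where
  "es \<equiv> sorted_list_of_set E"

definition mark_value :: int where
  "mark_value = (\<Sum>S<n. M S * 2 ^ nat (a S))"

lemma mark_value_eq: "mark_value = (\<Sum>i\<le>n. mark_coeff n v i * 2 ^ nat (a i))"
proof -
  have "mark_coeff n v n = 0" by (simp add: mark_coeff_def)
  then show ?thesis using v by (simp add: mark_value_def reads_def flip: lessThan_Suc_atMost)
qed

lemma mark_coeff_bound: "3 * (\<Sum>i\<le>n. \<bar>mark_coeff n v i\<bar>) \<le> Z"
  using sum_abs_mark_coeff[of n v] Z by simp

lemma digit_bit_cands:
  assumes "3 * (\<Sum>i\<le>n. \<bar>cf i\<bar>) \<le> Z" "m \<le> T" "p \<in> cands m"
  shows "digit_bit v cf p b \<longleftrightarrow>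
    encode_symbol (naf (\<Sum>i\<le>n. cf i * 2 ^ nat (a i)) (node_exp p)) ! of_bool b"
proof -
  have "\<forall>i\<le>n. 0 \<le> a i" using exponentsD(2)[OF a] by blast
  from digit_bit_iff[OF this ex assms(1), of p b] show ?thesis
    using cands_fst[OF assms(3)] cands_snd[OF assms(2,3)] pval_nonneg[OF assms(2,3)]
    by (simp add: node_exp_def)
qed

lemma rank_iff:
  assumes "m \<le> T" "card (new_exps m) = T" "p \<in> cands m" "w < T"
  shows "rank v m p = int w \<longleftrightarrow> node_exp p = es ! w"
proof -
  have "node_exp p \<in> E"
    using new_exps_unique[OF assms(2)] assms(3) by (auto simp: new_exps_def)
  then show ?thesis
    using rank_eq[OF assms(1,3)] new_exps_unique[OF assms(2)]
      card_less_eq_iff[OF finite_E _, of "node_exp p" w] assms(4) by simp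
qed

lemma ex_cand: "w < T \<Longrightarrow> \<exists>p\<in>cands final_m. node_exp p = es ! w"
proof -
  assume "w < T"
  then have "es ! w \<in> E"
    using nth_mem[of w es] by simp
  then show ?thesis by (auto simp: E_def new_exps_def)
qed

section \<open>Correctness of the output bits\<close>

lemma row_bit_iff:
  assumes "u < T" "w < T"
  shows "row_bit v u w b \<longleftrightarrow> encode_symbol (naf (int (es ! u)) (es ! w)) ! of_bool b"
proof -
  have *: "digit_bit v (pos_coeff n v p') p b \<longleftrightarrow>
      encode_symbol (naf (int (node_exp p')) (node_exp p)) ! of_bool b"
    if "m \<le> T" "p \<in> cands m" "p' \<in> cands m" for m p p'
    using digit_bit_cands[OF pos_coeff_bound[OF that(1,3)] that(1,2)] node_exp_eq_sum[OF that(1,3)]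
    by simp
  show ?thesis
  proof
    assume "row_bit v u w b"
    then obtain m p p' where m: "m \<le> T" "total v m = int T" "p \<in> cands m" "rank v m p = int w"
      "p' \<in> cands m" "rank v m p' = int u" "digit_bit v (pos_coeff n v p') p b"
      unfolding row_bit_def by blast
    then have "card (new_exps m) = T" using total_eq by simp
    then show "encode_symbol (naf (int (es ! u)) (es ! w)) ! of_bool b"
      using m rank_iff[of m] assms *[of m p p'] by simp
  next
    assume enc: "encode_symbol (naf (int (es ! u)) (es ! w)) ! of_bool b"
    obtain p p' where p: "p \<in> cands final_m" "node_exp p = es ! w"
      "p' \<in> cands final_m" "node_exp p' = es ! u"
      using ex_cand assms by meson
    moreover have "digit_bit v (pos_coeff n v p') p b"
      using *[OF final_m(1) p(1,3)] enc p by simp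
    moreover have "rank v final_m p = int w" "rank v final_m p' = int u"
      using rank_iff[OF final_m] p assms by simp_all
    moreover have "total v final_m = int T" using total_eq final_m by simp
    ultimately show "row_bit v u w b"
      unfolding row_bit_def using final_m(1) by blast
  qed
qed

lemma mark_bit_iff:
  assumes "w < T"
  shows "mark_bit v w b \<longleftrightarrow> encode_symbol (naf mark_value (es ! w)) ! of_bool b"
proof -
  have *: "digit_bit v (mark_coeff n v) p b \<longleftrightarrow>
      encode_symbol (naf mark_value (node_exp p)) ! of_bool b"
    if "m \<le> T" "p \<in> cands m" for m p
    using digit_bit_cands[OF mark_coeff_bound that] mark_value_eq by simp
  show ?thesis
  proof
    assume "mark_bit v w b"
    then obtain m p where m: "m \<le> T" "total v m = int T" "p \<in> cands m" "rank v m p = int w"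
      "digit_bit v (mark_coeff n v) p b"
      unfolding mark_bit_def by blast
    then have "card (new_exps m) = T" using total_eq by simp
    then show "encode_symbol (naf mark_value (es ! w)) ! of_bool b"
      using m rank_iff[of m] assms *[of m p] by simp
  next
    assume enc: "encode_symbol (naf mark_value (es ! w)) ! of_bool b"
    obtain p where p: "p \<in> cands final_m" "node_exp p = es ! w"
      using ex_cand assms by meson
    moreover have "digit_bit v (mark_coeff n v) p b"
      using *[OF final_m(1) p(1)] enc p by simp
    moreover have "rank v final_m p = int w"
      using rank_iff[OF final_m] p assms by simp
    moreover have "total v final_m = int T" using total_eq final_m by simp
    ultimately show "mark_bit v w b"
      unfolding mark_bit_def using final_m(1) by blast
  qed
qed

lemma out_bits_eq_encode:
  "map (out_bit v) [0..<2 * T * T + 2 * T] =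
    encode T (\<lambda>u w. naf (int (es ! u)) (es ! w)) (\<lambda>w. naf mark_value (es ! w))"
    (is "_ = encode T ?d ?M")
proof (rule nth_equalityI)
  show "length (map (out_bit v) [0..<2 * T * T + 2 * T]) = length (encode T ?d ?M)"
    by (simp add: length_encode)
next
  fix i assume "i < length (map (out_bit v) [0..<2 * T * T + 2 * T])"
  then have i: "i < 2 * T * (T + 1)" by (simp add: algebra_simps)
  then have T0: "0 < 2 * T" by (cases T) auto
  define u j where "u = i div (2 * T)" and "j = i mod (2 * T)"
  define w where "w = j div 2"
  have i_eq: "i = 2 * T * u + j" and j: "j < 2 * T" using T0 by (simp_all add: u_def j_def)
  have u: "u < T + 1" unfolding u_def using i T0 by (simp add: less_mult_imp_div_less mult.commute)
  have w: "w < T" using j by (auto simp: w_def)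
  have odd: "odd i \<longleftrightarrow> odd j" unfolding i_eq by simp
  have j_eq: "j = 2 * w + of_bool (odd j)" unfolding w_def by (simp add: mod2_eq_if[symmetric])
  have sym: "encode_marking T f ! j = encode_symbol (f w) ! of_bool (odd j)" for f
    using encode_marking_nth[OF w, of f] j_eq by (cases "odd j") (auto simp: encode_symbol_def)
  have "out_bit v i = encode T ?d ?M ! i"
  proof (cases "u < T")
    case True
    then have "out_bit v i = row_bit v u w (odd j)"
      by (simp add: out_bit_def u_def[symmetric] j_def[symmetric] w_def odd)
    then show ?thesis
      using row_bit_iff[OF True w] encode_nth(1)[OF j True, of ?d ?M] sym[of "?d u"] i_eq by simp
  next
    case False
    then have "u = T" using u by simp
    then have "out_bit v i = mark_bit v w (odd j)"
      by (simp add: out_bit_def u_def[symmetric] j_def[symmetric] w_def odd)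
    then show ?thesis
      using mark_bit_iff[OF w] encode_nth(2)[OF j, of ?d ?M] sym[of ?M] i_eq \<open>u = T\<close> by simp
  qed
  then show "map (out_bit v) [0..<2 * T * T + 2 * T] ! i = encode T ?d ?M ! i"
    using i by (simp add: algebra_simps)
qed

lemma out_bits_correct:
  "\<exists>n' \<delta>' M'. encodes_reduced (map (out_bit v) [0..<2 * T * T + 2 * T]) n' \<delta>' M' \<and>
     eval_marking {..<n'} \<delta>' M' = real_of_int mark_value"
proof -
  let ?d = "\<lambda>u w. naf (int (es ! u)) (es ! w)" and ?M = "\<lambda>w. naf mark_value (es ! w)"
  have "p \<in> E" if "naf mark_value p \<noteq> 0" for p
    using that unfolding mark_value_eq by (rule naf_in_E[OF mark_coeff_bound])
  then have "eval_marking {..<card E} ?d ?M = real_of_int mark_value"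
    by (intro eval_marking_naf finite_E) (rule E_closed)
  moreover have "encodes_reduced (encode (card E) ?d ?M) (card E) ?d ?M"
    by (intro encodes_reduced_naf finite_E) (rule E_closed)
  ultimately show ?thesis unfolding out_bits_eq_encode card_E by blast
qed

end

end

section \<open>Assembling the circuit\<close>

lemma vals_inputs: "vals (gs @ map Input_Gate [0..<l]) x = vals gs x @ map ((!) x) [0..<l]"
  by (induction l) (simp_all add: vals_snoc flip: append_assoc)

lemma lvls_inputs: "lvls (gs @ map Input_Gate [0..<l]) = lvls gs @ replicate l 0"
proof (induction l)
  case (Suc l)
  have "lvls (gs @ map Input_Gate [0..<Suc l]) = lvls (gs @ map Input_Gate [0..<l]) @ [0]"
    by (simp add: lvls_snoc flip: append_assoc)
  then show ?case unfolding Suc by (simp add: replicate_append_same)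
qed simp

lemma topo_inputs: "topo (gs @ map Input_Gate [0..<l]) = topo gs"
  by (induction l) (simp_all add: topo_snoc flip: append_assoc)

definition circuit_upto :: "nat \<Rightarrow> nat \<Rightarrow> nat \<Rightarrow> gate list \<Rightarrow> bool" where
  "circuit_upto l s d gs \<longleftrightarrow> topo gs \<and> (\<forall>i. Input_Gate i \<in> set gs \<longrightarrow> i < l) \<and>
     length gs \<le> s \<and> (\<forall>i < length gs. lvls gs ! i \<le> d)"

lemma circuit_upto_extend:
  assumes "circuit_upto l s d gs" "extends s' (d + d') gs hs"
  shows "circuit_upto l (s + s') (d + d') (gs @ hs)"
proof -
  have "lvls (gs @ hs) ! i \<le> d + d'" if "i < length (gs @ hs)" for i
  proof (cases "i < length gs")
    case True
    then show ?thesis using assms(1) lvls_append_nth[OF True, of hs] by (auto simp: circuit_upto_def intro: trans_le_add1)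
  next
    case False
    then show ?thesis using assms(2) that by (simp add: extends_def)
  qed
  then show ?thesis using assms by (auto simp: circuit_upto_def extends_def)
qed

lemma lvls_gate_levels: "gate_levels C = lvls (gates C)" and vals_gate_values: "gate_values C x = vals (gates C) x"
  by (simp_all add: gate_levels_def lvls_def gate_values_def vals_def)

context layout
begin

lemma K_less_N: "K < int N"
proof -
  have "(2::int) ^ G \<le> int N"
    using sizes(1) by (metis of_nat_le_iff of_nat_numeral of_nat_power)
  then show ?thesis using B by linarith
qed

lemma rounds_circuit:
  "\<exists>gs idx. circuit_upto l (l + 2 + t * (card ({..n} \<times> {..n} \<times> {-K..K}) * N ^ 90)) (t * 90) gs \<and>
     (\<forall>w. idx w < length gs) \<and>
     (\<forall>x. length x = l \<longrightarrow> after_rounds n G B K t x (\<lambda>w. vals gs x ! idx w))"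
proof (induction t)
  case 0
  let ?gs = "[And_Gate {}, Or_Gate {}] @ map Input_Gate [0..<l]"
  \<comment> \<open>Gates 0 and 1 are the constants true and false. Input wires beyond
    \<open>l\<close> go to gate 0, because \<open>realizes\<close> asks for every wire to be
    attached somewhere.\<close>
  define idx where "idx w = (case w of In i \<Rightarrow> if i < l then i + 2 else 0 | Le Q R k \<Rightarrow> if k \<le> 0 then 0 else 1)" for w
  have "vals [And_Gate {}, Or_Gate {}] x = [True, False]" for x
    by (simp add: vals_def)
  then have vals: "vals ?gs x = [True, False] @ map ((!) x) [0..<l]" for x
    unfolding vals_inputs by simp
  have "lvls [And_Gate {}, Or_Gate {}] = [0, 0]"
    by (simp add: lvls_def)
  then have lvls: "lvls ?gs = [0, 0] @ replicate l 0"
    unfolding lvls_inputs by simp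
  have "topo [And_Gate {}, Or_Gate {}]"
    by (simp add: topo_def less_Suc_eq)
  then have "topo ?gs"
    unfolding topo_inputs .
  then have "circuit_upto l (l + 2) 0 ?gs"
    unfolding circuit_upto_def lvls by (auto simp: nth_Cons split: nat.split)
  moreover have "idx w < length ?gs" for w
    by (cases w) (auto simp: idx_def)
  moreover have "after_rounds n G B K 0 x (\<lambda>w. vals ?gs x ! idx w)" if "length x = l" for x
    unfolding vals using that by (auto simp: idx_def nth_Cons)
  ultimately show ?case
    by (intro exI[of _ ?gs] exI[of _ idx]) auto
next
  case (Suc t)
  let ?A = "{..n} \<times> {..n} \<times> {-K..K}"
  obtain gs idx where gs: "circuit_upto l (l + 2 + t * (card ?A * N ^ 90)) (t * 90) gs"
    and idx: "\<forall>w. idx w < length gs"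
    and after: "\<And>x. length x = l \<Longrightarrow> after_rounds n G B K t x (\<lambda>w. vals gs x ! idx w)"
    using Suc.IH by blast
  have "\<forall>A\<in>?A. realizes (N ^ 90) 90 (\<lambda>v. case A of (Q, R, k) \<Rightarrow> round_le n G B v Q R k)"
  proof
    fix A assume "A \<in> ?A"
    then obtain Q R k where A: "A = (Q, R, k)" "\<bar>k\<bar> \<le> int N" using K_less_N by auto
    then have "hf 90 (\<lambda>v. round_le n G B v Q R k)"
      using sizes by (intro hf_round_le) auto
    then show "realizes (N ^ 90) 90 (\<lambda>v. case A of (Q, R, k) \<Rightarrow> round_le n G B v Q R k)"
      by (simp add: A hf_def)
  qed
  moreover have "topo gs" "\<forall>w. idx w < length gs \<and> lvls gs ! idx w \<le> t * 90"
    using gs idx by (auto simp: circuit_upto_def)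
  ultimately obtain hs pos where hs: "extends (card ?A * N ^ 90) (t * 90 + 90) gs hs"
    and pos: "\<forall>A\<in>?A. pos A < length gs + length hs \<and> length gs \<le> pos A \<and>
      (\<forall>x. vals (gs @ hs) x ! pos A = (case A of (Q, R, k) \<Rightarrow> round_le n G B (\<lambda>w. vals gs x ! idx w) Q R k))"
    using realizes_family[of ?A "N ^ 90" 90 "\<lambda>A v. case A of (Q, R, k) \<Rightarrow> round_le n G B v Q R k" gs idx "t * 90"]
    by auto
  define idx' where "idx' w = (case w of In i \<Rightarrow> idx w
    | Le Q R k \<Rightarrow> if (Q, R, k) \<in> ?A then pos (Q, R, k) else idx w)" for w
  have "circuit_upto l (l + 2 + Suc t * (card ?A * N ^ 90)) (Suc t * 90) (gs @ hs)"
    using circuit_upto_extend[OF gs hs] by (simp add: algebra_simps)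
  moreover have "idx' w < length (gs @ hs)" for w
    using idx pos by (cases w) (auto simp: idx'_def intro: trans_less_add1)
  moreover have "after_rounds n G B K (Suc t) x (\<lambda>w. vals (gs @ hs) x ! idx' w)" if "length x = l" for x
  proof -
    have "vals (gs @ hs) x ! idx' (In i) = x ! i" if "i < l" for i
      using after_rounds_inputs[OF after, of x i] \<open>length x = l\<close> that idx
      by (simp add: idx'_def vals_append_nth)
    moreover have "vals (gs @ hs) x ! idx' (Le Q R k) = round_le n G B (\<lambda>w. vals gs x ! idx w) Q R k"
      if "Q \<le> n" "R \<le> n" "\<bar>k\<bar> \<le> K" for Q R k
    proof -
      have "(Q, R, k) \<in> ?A" using that by auto
      then show ?thesis using pos by (simp add: idx'_def)
    qed
    ultimately show ?thesis using after[OF that] that by auto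
  qed
  ultimately show ?case
    by (intro exI[of _ "gs @ hs"] exI[of _ idx']) blast
qed

text \<open>There are at most \<open>N\<close> rounds of \<open>N ^ 3\<close> comparisons with
  \<open>N ^ 90\<close> gates each, and at most \<open>N ^ 2\<close> outputs with
  \<open>N ^ 130\<close> gates each; 140 is a generous common exponent.\<close>

lemma size_bound:
  assumes "t \<le> n" "l = 2 * n * n + 2 * n" "(n + 1) ^ 2 \<le> N"
  shows "l + 2 + t * (card ({..n} \<times> {..n} \<times> {-K..K}) * N ^ 90) + (2 * T * T + 2 * T) * N ^ 130 \<le> N ^ 140"
proof -
  have N1: "1 \<le> N ^ k" for k using N by simp
  have l: "l + 2 \<le> N ^ 2"
  proof -
    have "l + 2 \<le> 2 * (n + 1) ^ 2" using assms(2) by (simp add: power2_eq_square)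
    also have "\<dots> \<le> N * N" using assms(3) N by (intro mult_le_mono) auto
    finally show ?thesis by (simp add: power2_eq_square)
  qed
  have "nat (2 * K + 1) \<le> N * N"
  proof -
    have "2 * K + 1 \<le> 2 * int N" using K_less_N by simp
    then have "nat (2 * K + 1) \<le> 2 * N" by simp
    also have "\<dots> \<le> N * N" using N by simp
    finally show ?thesis .
  qed
  then have "(n + 1) ^ 2 * nat (2 * K + 1) \<le> N * (N * N)"
    using assms(3) by (intro mult_le_mono)
  moreover have "card ({..n} \<times> {..n} \<times> {-K..K}) = (n + 1) ^ 2 * nat (2 * K + 1)"
    by (simp add: card_cartesian_product power2_eq_square algebra_simps)
  ultimately have "card ({..n} \<times> {..n} \<times> {-K..K}) \<le> N * (N * N)"
    by simp
  then have "t * (card ({..n} \<times> {..n} \<times> {-K..K}) * N ^ 90) \<le> N * (N * (N * N) * N ^ 90)"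
    using assms(1) sizes(3) by (intro mult_le_mono) auto
  also have "\<dots> = N ^ 4 * N ^ 90" by (simp only: power4_eq_xxxx mult.assoc)
  also have "\<dots> = N ^ 94" by (simp flip: power_add)
  finally have rounds: "t * (card ({..n} \<times> {..n} \<times> {-K..K}) * N ^ 90) \<le> N ^ 94" .
  have "2 * T * T + 2 * T = (2 * T) * (T + 1)" by simp
  also have "\<dots> \<le> N * N" using sizes(4) by (intro mult_le_mono) auto
  finally have "(2 * T * T + 2 * T) * N ^ 130 \<le> N * N * N ^ 130" by (rule mult_le_mono1)
  also have "N * N * N ^ 130 = N ^ 2 * N ^ 130" by (simp only: power2_eq_square)
  also have "\<dots> = N ^ 132" by (simp flip: power_add)
  finally have out: "(2 * T * T + 2 * T) * N ^ 130 \<le> N ^ 132" .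
  have "N ^ 2 \<le> N ^ 132" "N ^ 94 \<le> N ^ 132" by (rule N_power_mono; simp)+
  then have "l + 2 + t * (card ({..n} \<times> {..n} \<times> {-K..K}) * N ^ 90) + (2 * T * T + 2 * T) * N ^ 130
      \<le> 2 ^ 2 * N ^ 132"
    using l rounds out by simp
  also have "\<dots> \<le> N ^ 2 * N ^ 132"
    using N by (intro mult_right_mono power_mono) auto
  also have "\<dots> = N ^ 134" by (simp flip: power_add)
  also have "\<dots> \<le> N ^ 140" by (rule N_power_mono) simp
  finally show ?thesis .
qed

lemma reduction_circuit:
  assumes "t \<le> n" "l = 2 * n * n + 2 * n" "(n + 1) ^ 2 \<le> N"
  shows "\<exists>C. wf_circuit l C \<and> num_gates C \<le> N ^ 140 \<and> circuit_depth C \<le> t * 90 + 130 \<and>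
    (\<forall>x. length x = l \<longrightarrow> (\<exists>v. after_rounds n G B K t x v \<and>
       circuit_output C x = map (out_bit v) [0..<2 * T * T + 2 * T]))"
proof -
  let ?s = "l + 2 + t * (card ({..n} \<times> {..n} \<times> {-K..K}) * N ^ 90)" and ?L = "2 * T * T + 2 * T"
  obtain gs idx where gs: "circuit_upto l ?s (t * 90) gs"
    and idx: "\<forall>w. idx w < length gs"
    and after: "\<And>x. length x = l \<Longrightarrow> after_rounds n G B K t x (\<lambda>w. vals gs x ! idx w)"
    using rounds_circuit by blast
  have "topo gs" "\<forall>w. idx w < length gs \<and> lvls gs ! idx w \<le> t * 90"
    using gs idx by (auto simp: circuit_upto_def)
  moreover have "\<forall>i\<in>{..<?L}. realizes (N ^ 130) 130 (\<lambda>v. out_bit v i)"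
    using hf_out_bit by (simp add: hf_def)
  ultimately obtain hs pos where hs: "extends (card {..<?L} * N ^ 130) (t * 90 + 130) gs hs"
    and inj: "inj_on pos {..<?L}"
    and pos: "\<forall>i\<in>{..<?L}. pos i < length gs + length hs \<and> length gs \<le> pos i \<and>
      (\<forall>x. vals (gs @ hs) x ! pos i = out_bit (\<lambda>w. vals gs x ! idx w) i)"
    using realizes_family[of "{..<?L}" "N ^ 130" 130 "\<lambda>i v. out_bit v i" gs idx "t * 90"] by auto
  define C where "C = Circuit (gs @ hs) (map pos [0..<?L])"
  have up: "circuit_upto l (?s + ?L * N ^ 130) (t * 90 + 130) (gs @ hs)"
    using circuit_upto_extend[OF gs hs] by simp
  have "wf_circuit l C"
    using up pos inj
    by (auto simp: wf_circuit_def C_def circuit_upto_def topo_def distinct_map atLeast0LessThan)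
  moreover have "num_gates C \<le> N ^ 140"
    using up size_bound[OF assms] by (simp add: num_gates_def C_def circuit_upto_def)
  moreover have "circuit_depth C \<le> t * 90 + 130"
    using up unfolding circuit_depth_def lvls_gate_levels
    by (auto simp: C_def circuit_upto_def in_set_conv_nth)
  moreover have "circuit_output C x = map (out_bit (\<lambda>w. vals gs x ! idx w)) [0..<?L]" for x
    unfolding circuit_output_def vals_gate_values using pos by (simp add: C_def)
  ultimately show ?thesis using after by blast
qed

end

section \<open>Exponents of the nodes of a power circuit\<close>

text \<open>By injectivity of the real power, the natural numbers \<open>k\<close> with value
  \<open>2 ^ k\<close> satisfy the recursion over the integers. From here on real numbers are left
  behind.\<close>

lemma power_circuit_exponents:
  assumes "power_circuit {..<n} \<delta>"
  obtains a where "exponents n \<delta> a"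
    "\<And>M. eval_marking {..<n} \<delta> M = real_of_int (\<Sum>S<n. M S * 2 ^ nat (a S))"
proof -
  have dag: "signed_dag {..<n} \<delta>"
    using assms by (simp add: power_circuit_def)
  have "\<forall>P\<in>{..<n}. \<exists>k::nat. eval_node {..<n} \<delta> P = 2 ^ k"
    using assms by (simp add: power_circuit_def)
  then obtain k :: "nat \<Rightarrow> nat" where k: "\<And>P. P < n \<Longrightarrow> eval_node {..<n} \<delta> P = 2 ^ k P"
    by (metis lessThan_iff)
  \<comment> \<open>The default 0 outside the circuit provides the exponent of the extra node
    \<open>n\<close>.\<close>
  define a where "a P = (if P < n then int (k P) else 0)" for P
  have ev: "eval_marking {..<n} \<delta> M = real_of_int (\<Sum>S<n. M S * 2 ^ nat (a S))" for M
    unfolding eval_marking_def by (simp add: a_def k)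
  have "a P = (\<Sum>S<n. \<delta> P S * 2 ^ nat (a S))" if "P < n" for P
  proof -
    have "2 powr real (k P) = 2 powr eval_marking {..<n} \<delta> (\<delta> P)"
      using eval_node_eq[OF dag, of P] k[OF that] that by (simp add: powr_realpow)
    then have "real (k P) = eval_marking {..<n} \<delta> (\<delta> P)" by (simp add: powr_inj)
    then have "real_of_int (a P) = real_of_int (\<Sum>S<n. \<delta> P S * 2 ^ nat (a S))"
      using that unfolding ev by (simp add: a_def)
    then show ?thesis by (simp only: of_int_eq_iff)
  qed
  moreover have "a n = 0" "\<forall>Q\<le>n. 0 \<le> a Q" by (simp_all add: a_def)
  ultimately have "exponents n \<delta> a" unfolding exponents_def by blast
  then show ?thesis using ev that by blast
qed

lemma encode_length_inj: "2 * n * n + 2 * n = 2 * m * m + 2 * m \<Longrightarrow> n = m" for n m :: nat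
proof (rule ccontr)
  have less: "2 * a * a + 2 * a < 2 * b * b + 2 * b" if "a < b" for a b :: nat
    using that mult_le_mono[of a b a b] by (simp add: mult.assoc)
  assume "2 * n * n + 2 * n = 2 * m * m + 2 * m" "n \<noteq> m"
  then show False using less[of n m] less[of m n] by (cases n m rule: linorder_cases) auto
qed

lemma (in layout) reduction_correct_if:
  assumes x: "encodes_instance x n \<delta> M" and D: "instance_depth x \<le> D"
    and v: "after_rounds n G B K (min (Suc D) n) x v"
  shows "\<exists>n' \<delta>' M'. encodes_reduced (map (out_bit v) [0..<2 * T * T + 2 * T]) n' \<delta>' M' \<and>
    eval_marking {..<n'} \<delta>' M' = eval_marking {..<n} \<delta> M"
proof -
  have pc: "power_circuit {..<n} \<delta>" and M: "marking {..<n} M" and x_eq: "x = encode n \<delta> M"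
    using x by (simp_all add: encodes_instance_def)
  then have dag: "signed_dag {..<n} \<delta>" by (simp add: power_circuit_def)
  then have \<delta>: "marking {..<n} (\<delta> Q)" if "Q < n" for Q using that by (simp add: signed_dag_def)
  obtain a where a: "exponents n \<delta> a"
    and ev: "\<And>M. eval_marking {..<n} \<delta> M = real_of_int (\<Sum>S<n. M S * 2 ^ nat (a S))"
    using power_circuit_exponents[OF pc] by blast
  have reads: "reads n \<delta> M v"
    using \<delta> M after_rounds_inputs[OF v] x_eq by (intro reads_encode) auto
  have "exact_on (known n \<delta> (min (Suc D) n)) K a v"
    by (rule after_rounds_exact[OF a _ M _ B(2,3)]) (use \<delta> v x_eq K in auto)
  moreover have "known n \<delta> (min (Suc D) n) = {..n}"
    using known_all[OF dag] D instance_depth_eq[OF x] by simp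
  ultimately have ex: "exact_on {..n} K a v" by simp
  have "mark_value M a = (\<Sum>S<n. M S * 2 ^ nat (a S))"
    by (rule mark_value_def[OF a reads ex])
  then show ?thesis
    using out_bits_correct[OF a reads ex] ev[of M] by simp
qed

lemma (in layout) reduction_correct_out_bits:
  assumes "length x = 2 * n * n + 2 * n" "instance_depth x \<le> D"
    and "after_rounds n G B K (min (Suc D) n) x v"
  shows "reduction_correct x (map (out_bit v) [0..<2 * T * T + 2 * T])"
  unfolding reduction_correct_def
proof (intro allI impI)
  fix m \<delta> M assume inst: "encodes_instance x m \<delta> M"
  then have "2 * m * m + 2 * m = 2 * n * n + 2 * n"
    using assms(1) by (simp add: encodes_instance_def length_encode)
  then have "m = n" by (rule encode_length_inj)
  then show "\<exists>n' \<delta>' M'. encodes_reduced (map (out_bit v) [0..<2 * T * T + 2 * T]) n' \<delta>' M' \<and>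
      eval_marking {..<n'} \<delta>' M' = eval_marking {..<m} \<delta> M"
    using reduction_correct_if[OF _ assms(2,3)] inst by simp
qed

section \<open>Parameters and polynomial bounds\<close>

lemma quadratic_less_exp: "3 * (n * n) + 36 * n + 60 < 1024 * 2 ^ n" for n :: nat
  by (induction n) (auto simp: algebra_simps)

text \<open>\<open>K\<close> has to exceed \<open>2 * G\<close>, \<open>B\<close> has to exceed
  \<open>K\<close>, and \<open>G\<close> is about the logarithm of \<open>B\<close>. The circle is
  broken by putting the crude bound \<open>n + 20\<close> for \<open>G\<close> into
  \<open>K\<close>. Minimality of \<open>G\<close> keeps \<open>2 ^ G\<close> at most
  \<open>2 * B\<close>, hence quadratic in \<open>n\<close>.\<close>

lemma layout_exists: "\<exists>G c T K B Z. layout (1000 * (n + 1) ^ 2) n G c T K B Z"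
proof -
  \<comment> \<open>Logarithmic growth would suffice; a linear choice makes the comparison with
    \<open>2 ^ c\<close> easy and stays polynomial.\<close>
  define c where "c = n + 10"
  define T where "T = (n + 1) * c"
  define Z where "Z = 3 * (int n + int T)"
  define K where "K = 2 * (int T + 1) + 2 * (int n + 20) + 1"
  define B where "B = 2 * Z + 2 + 2 * int n + K"
  define G where "G = (LEAST G. B \<le> 2 ^ G)"
  define q where "q = n * n"
  have T_eq: "T = q + 11 * n + 10" by (simp add: T_def c_def q_def algebra_simps)
  have exp: "3 * q + 36 * n + 60 < 2 ^ (n + 10)"
    using quadratic_less_exp[of n] by (simp add: q_def power_add mult.commute)
  have B_eq: "B = 8 * int q + 98 * int n + 125"
    by (simp add: B_def K_def Z_def T_eq)
  have "B \<le> int (2 ^ (n + 20))"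
  proof -
    have "8 * q + 98 * n + 125 \<le> 1024 * 2 ^ (n + 10)" using exp by linarith
    then have "8 * q + 98 * n + 125 \<le> 2 ^ (n + 20)" by (simp add: power_add)
    then have "int (8 * q + 98 * n + 125) \<le> int (2 ^ (n + 20))" by (simp only: of_nat_le_iff)
    then show ?thesis by (simp add: B_eq)
  qed
  then have "B \<le> 2 ^ (n + 20)" by simp
  then have G: "B \<le> 2 ^ G" "G \<le> n + 20"
    unfolding G_def by (auto intro: LeastI Least_le)
  have "2 ^ G \<le> 2 * B"
  proof (cases G)
    case (Suc g)
    then have "\<not> B \<le> 2 ^ g"
      using not_less_Least[of g "\<lambda>G. B \<le> 2 ^ G"] by (simp add: G_def)
    then show ?thesis using Suc by simp
  qed (simp add: B_eq)
  then have "int (2 ^ G) \<le> int (16 * q + 196 * n + 250)" by (simp add: B_eq)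
  then have G_size: "2 ^ G \<le> 16 * q + 196 * n + 250" by (simp only: of_nat_le_iff)
  have N_eq: "1000 * (n + 1) ^ 2 = 1000 * q + 2000 * n + 1000"
    by (simp add: q_def power2_eq_square algebra_simps)
  have "layout (1000 * (n + 1) ^ 2) n G c T K B Z"
  proof (intro layout.intro size_base.intro layout_axioms.intro)
    show "T = (n + 1) * c" by (rule T_def)
    show "3 * (n + T) < 2 ^ c" using exp by (simp add: T_eq c_def)
    show "2 * (int T + 1) + 2 * int G + 1 \<le> K" using G(2) by (simp add: K_def)
    show "2 * Z + 1 < B" by (simp add: B_def K_def)
    show "2 * int n + K < B" by (simp add: B_def Z_def)
    show "2 * Z + 1 \<le> int (1000 * (n + 1)\<^sup>2)" unfolding N_eq by (simp add: Z_def T_eq)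
  qed (use G G_size in \<open>simp_all only: N_eq T_eq Z_def\<close>, simp_all)
  then show ?thesis by blast
qed

lemma polynomial_bound: "\<exists>c :: nat. \<forall>l. (A * (l + 1) ^ 2) ^ e \<le> c * l ^ c + c"
proof -
  \<comment> \<open>The factor 4 comes from \<open>l + 1 \<le> 2 * l\<close> for positive
    \<open>l\<close>; the additive \<open>c\<close> serves \<open>l = 0\<close>.\<close>
  define c where "c = (4 * A) ^ e + 2 * e"
  have "(A * (l + 1) ^ 2) ^ e \<le> c * l ^ c + c" for l
  proof (cases "l = 0")
    case True
    have "A ^ e \<le> (4 * A) ^ e" by (rule power_mono) auto
    then have "A ^ e \<le> c" unfolding c_def by linarith
    then show ?thesis using True by simp
  next
    case False
    then have "(l + 1) ^ 2 \<le> (2 * l) ^ 2" by (intro power_mono) auto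
    then have "A * (l + 1) ^ 2 \<le> A * (2 * l) ^ 2" by (rule mult_le_mono2)
    then have "(A * (l + 1) ^ 2) ^ e \<le> (A * (2 * l) ^ 2) ^ e" by (rule power_mono) simp
    also have "A * (2 * l) ^ 2 = 4 * A * l ^ 2" by (simp add: power_mult_distrib)
    also have "(4 * A * l ^ 2) ^ e = (4 * A) ^ e * l ^ (2 * e)"
      by (simp add: power_mult_distrib power_mult)
    also have "\<dots> \<le> c * l ^ c"
      using False by (intro mult_le_mono power_increasing) (auto simp: c_def)
    finally show ?thesis by simp
  qed
  then show ?thesis by blast
qed

lemma reduction_circuit_exists:
  "\<exists>C. wf_circuit l C \<and> num_gates C \<le> (1000 * (l + 1) ^ 2) ^ 140 \<and> circuit_depth C \<le> 310 * max 1 D \<and>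
    (\<forall>x. length x = l \<longrightarrow> instance_depth x \<le> D \<longrightarrow> reduction_correct x (circuit_output C x))"
proof (cases "\<exists>n. l = 2 * n * n + 2 * n")
  case False
  \<comment> \<open>No instance has such a length, so every answer is correct.\<close>
  have "reduction_correct x y" if "length x = l" for x y
    using False that by (auto simp: reduction_correct_def encodes_instance_def length_encode)
  then show ?thesis
    by (intro exI[of _ "Circuit [] []"])
      (auto simp: wf_circuit_def num_gates_def circuit_depth_def gate_levels_def)
next
  case True
  then obtain n where l: "l = 2 * n * n + 2 * n" by blast
  define N where "N = 1000 * (n + 1) ^ 2"
  obtain G c T K B Z where lay: "layout N n G c T K B Z"
    using layout_exists unfolding N_def by blast
  have N: "(n + 1) ^ 2 \<le> N" unfolding N_def by linarith
  obtain C where C: "wf_circuit l C" "num_gates C \<le> N ^ 140"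
    "circuit_depth C \<le> min (Suc D) n * 90 + 130"
    and out: "\<forall>x. length x = l \<longrightarrow> (\<exists>v. after_rounds n G B K (min (Suc D) n) x v \<and>
       circuit_output C x = map (layout.out_bit n G c T B Z v) [0..<2 * T * T + 2 * T])"
    using layout.reduction_circuit[OF lay min.cobounded2 l N] by blast
  have "n \<le> l" using l by simp
  then have "N \<le> 1000 * (l + 1) ^ 2"
    unfolding N_def by (intro power_mono mult_le_mono order_refl) linarith+
  then have size: "num_gates C \<le> (1000 * (l + 1) ^ 2) ^ 140"
    using C(2) power_mono[of N _ 140] by (meson le0 order.trans)
  \<comment> \<open>With at most \<open>D + 1\<close> rounds the depth is at most
    \<open>90 * D + 220\<close>; the factor 310 absorbs the constant, also for
    \<open>D = 0\<close>.\<close>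
  have "t * 90 + 130 \<le> 310 * M" if "t \<le> Suc D" "D \<le> M" "1 \<le> M" for t M :: nat
    using that by linarith
  from this[of "min (Suc D) n" "max 1 D"] have depth: "circuit_depth C \<le> 310 * max 1 D"
    using C(3) by (meson max.cobounded1 max.cobounded2 min.cobounded1 order.trans)
  have "reduction_correct x (circuit_output C x)" if "length x = l" "instance_depth x \<le> D" for x
    using out layout.reduction_correct_out_bits[OF lay _ that(2)] that(1) l by metis
  with C(1) size depth show ?thesis by blast
qed

theorem theorem31: "reduction_correct \<in> DepParaTC 0 instance_depth"
proof -
  define good where "good l D C \<longleftrightarrow> wf_circuit l C \<and> num_gates C \<le> (1000 * (l + 1) ^ 2) ^ 140 \<and>
    circuit_depth C \<le> 310 * max 1 D \<and>
    (\<forall>x. length x = l \<longrightarrow> instance_depth x \<le> D \<longrightarrow> reduction_correct x (circuit_output C x))" for l D C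
  have "\<exists>C. good l D C" for l D
    unfolding good_def by (rule reduction_circuit_exists)
  then obtain C where C: "\<And>l D. good l D (C l D)" by metis
  obtain c :: nat where c: "\<And>l. (1000 * (l + 1) ^ 2) ^ 140 \<le> c * l ^ c + c"
    using polynomial_bound[of 1000 140] by blast
  have "num_gates (C n D) \<le> c * n ^ c + c" for n D
    using C[of n D] c[of n] unfolding good_def by (meson order.trans)
  moreover have "real (circuit_depth (C n D)) \<le> 310 * real (max 1 D) * log 2 (real (max 2 n)) ^ 0" for n D
  proof -
    have "real (circuit_depth (C n D)) \<le> real (310 * max 1 D)"
      using C[of n D] unfolding good_def by (simp only: of_nat_le_iff)
    then show ?thesis by simp
  qed
  moreover have "wf_circuit n (C n D)" for n D using C[of n D] unfolding good_def by blast
  moreover have "reduction_correct x (circuit_output (C n D) x)"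
    if "length x = n" "instance_depth x \<le> D" for n D x
    using C[of n D] that unfolding good_def by blast
  ultimately show ?thesis
    unfolding DepParaTC_def by (intro CollectI exI[of _ C]) blast
qed

end
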